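(* Let $d\ge 1$ be an integer and let $j_{d/2,1}$ be the first positive zero of the Bessel function of the first kind $J_{d/2}$. For every $\tau>0$ there exists a constant $c_{d,\tau}>0$, depending only on $d$ and $\tau$, such that the following holds. Let $n>0$, let $Y\subset\mathbb{T}^d$ be a finite nonempty set with separation $q=\operatorname{sep}Y$, and assume $$nq=\sqrt{1+\tau}\,\frac{j_{d/2,1}}{\pi}.$$ Then $$\sigma_{\min}^2\left(\mathscr{A},\tilde{\mathscr{A}}_1,\dots,\tilde{\mathscr{A}}_d\right)\ \ge\ c_{d,\tau}\,n^d ,$$ where $\left(\mathscr{A},\tilde{\mathscr{A}}_1,\dots,\tilde{\mathscr{A}}_d\right)\in\mathbb{C}^{|\mathcal{I}|\times|Y|(d+1)}$ is the block matrix formed from the Vandermonde matrix $\mathscr{A}$ and the confluent Vandermonde matrices $\tilde{\mathscr{A}}_s$ associated with $Y$ and $n$.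
   Context: $\mathbb{T}=\mathbb{R}/\mathbb{Z}$. For a finite nonempty set $Y\subset\mathbb{T}^d$ (points identified with representatives in $\mathbb{R}^d$), its separation is $$\operatorname{sep}Y=\min\{\|t-t'+\ell\|_2 : t,t'\in Y,\ \ell\in\mathbb{Z}^d,\ t-t'+\ell\neq 0\}.$$ For a real bandlimit parameter $n>0$ let $\mathcal{I}=\{k\in\mathbb{Z}^d:\|k\|_2\le n\}$, and set $$\mathscr{A}=\left(e^{-2\pi i\,t\cdot k}\right)_{k\in\mathcal{I},\,t\in Y}\in\mathbb{C}^{|\mathcal{I}|\times|Y|},\qquad \tilde{\mathscr{A}}_s=\left(-2\pi i\,k_s e^{-2\pi i\,t\cdot k}\right)_{k\in\mathcal{I},\,t\in Y}\in\mathbb{C}^{|\mathcal{I}|\times|Y|},\quad s=1,\dots,d.$$ $\sigma_{\min}(M)$ denotes the smallest singular value of a matrix $M$, i.e. $\sigma_{\min}(M)=\min_{\|u\|_2=1}\|Mu\|_2$. *)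

theory Defs
  imports "HOL-Analysis.Analysis"
begin

text \<open>
  The dimension is \<open>d = CARD('d)\<close> for a finite index type \<open>'d\<close>; it is automatically at least 1.
  The norm on \<^typ>\<open>real ^ 'd\<close> is the Euclidean one.
\<close>

definition int_lattice :: "(real ^ 'd) set" where
  "int_lattice = {l. \<forall>i. l $ i \<in> \<int>}"

text \<open>
  A finite subset of the torus is given by a finite set of representatives in \<^typ>\<open>real ^ 'd\<close>,
  exactly one (arbitrarily chosen) for each point; distinct representatives must therefore be
  distinct modulo the integer lattice.
\<close>

definition torus_representatives :: "(real ^ 'd) set \<Rightarrow> bool" where
  "torus_representatives Y \<longleftrightarrow> (\<forall>t\<in>Y. \<forall>t'\<in>Y. t - t' \<in> int_lattice \<longrightarrow> t = t')"

text \<open>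
  The infimum is a minimum for finite nonempty \<open>Y\<close>, see \<open>sep_attained\<close> below. The case
  \<open>t = t'\<close>, \<open>l \<noteq> 0\<close> is included.
\<close>

definition sep_norms :: "(real ^ 'd) set \<Rightarrow> real set" where
  "sep_norms Y = {norm (t - t' + l) | t t' l.
     t \<in> Y \<and> t' \<in> Y \<and> l \<in> int_lattice \<and> t - t' + l \<noteq> 0}"

definition sep :: "(real ^ 'd) set \<Rightarrow> real" where
  "sep Y = Inf (sep_norms Y)"

definition freqs :: "real \<Rightarrow> (real ^ 'd) set" where
  "freqs n = {k \<in> int_lattice. norm k \<le> n}"

text \<open>
  A matrix with rows indexed by \<open>R\<close> and columns indexed by \<open>C\<close> is a function of a row and a
  column index.
\<close>

definition vandermonde :: "real ^ 'd \<Rightarrow> real ^ 'd \<Rightarrow> complex" where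
  "vandermonde k t = exp (- 2 * of_real pi * \<i> * of_real (t \<bullet> k))"

definition confluent_vandermonde :: "'d \<Rightarrow> real ^ 'd \<Rightarrow> real ^ 'd \<Rightarrow> complex" where
  "confluent_vandermonde s k t =
     - 2 * of_real pi * \<i> * of_real (k $ s) * exp (- 2 * of_real pi * \<i> * of_real (t \<bullet> k))"

text \<open>
  The columns of the block matrix are indexed by pairs of a block and a node: block \<^const>\<open>None\<close>
  is the Vandermonde matrix, block \<open>Some s\<close> is the \<open>s\<close>-th confluent one.
\<close>

definition block_matrix :: "real ^ 'd \<Rightarrow> 'd option \<times> (real ^ 'd) \<Rightarrow> complex" where
  "block_matrix k = (\<lambda>(b, t). case b of
       None \<Rightarrow> vandermonde k t
     | Some s \<Rightarrow> confluent_vandermonde s k t)"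

definition mat_vec :: "'c set \<Rightarrow> ('r \<Rightarrow> 'c \<Rightarrow> complex) \<Rightarrow> ('c \<Rightarrow> complex) \<Rightarrow> 'r \<Rightarrow> complex" where
  "mat_vec C M u r = (\<Sum>c\<in>C. M r c * u c)"

definition l2_norm_on :: "'a set \<Rightarrow> ('a \<Rightarrow> complex) \<Rightarrow> real" where
  "l2_norm_on A u = L2_set (\<lambda>a. cmod (u a)) A"

text \<open>The infimum is a minimum for finite nonempty \<open>C\<close>, see \<open>sigma_min_attained\<close> below.\<close>

definition sigma_min :: "'r set \<Rightarrow> 'c set \<Rightarrow> ('r \<Rightarrow> 'c \<Rightarrow> complex) \<Rightarrow> real" where
  "sigma_min R C M = Inf {l2_norm_on R (mat_vec C M u) | u. l2_norm_on C u = 1}"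

text \<open>The power series of the Bessel function of the first kind; only used for \<open>x > 0\<close>, \<open>\<nu> > 0\<close>.\<close>

definition bessel_J :: "real \<Rightarrow> real \<Rightarrow> real" where
  "bessel_J \<nu> x =
     (\<Sum>m. (- 1) ^ m / (fact m * Gamma (real m + \<nu> + 1)) * (x / 2) powr (2 * real m + \<nu>))"

definition bessel_first_zero :: "real \<Rightarrow> real" where
  "bessel_first_zero \<nu> = (LEAST x. 0 < x \<and> bessel_J \<nu> x = 0)"

lemma finite_freqs: "finite (freqs n :: (real ^ 'd) set)"
proof -
  let ?Z = "(of_int ` {- \<lceil>n\<rceil>..\<lceil>n\<rceil>}) :: real set"
  have "freqs n \<subseteq> {k :: real ^ 'd. \<forall>i. k $ i \<in> ?Z}"
  proof clarify
    fix k :: "real ^ 'd" and i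
    assume k: "k \<in> freqs n"
    then obtain z where z: "k $ i = of_int z"
      by (auto simp: freqs_def int_lattice_def elim: Ints_cases)
    have "\<bar>k $ i\<bar> \<le> n"
      using k component_le_norm_cart[of k i] by (simp add: freqs_def)
    then have "z \<in> {- \<lceil>n\<rceil>..\<lceil>n\<rceil>}"
      unfolding z by (simp add: abs_le_iff) linarith
    then show "k $ i \<in> ?Z"
      using z by auto
  qed
  moreover have "finite {k :: real ^ 'd. \<forall>i. k $ i \<in> ?Z}"
  proof (rule finite_subset)
    show "{k :: real ^ 'd. \<forall>i. k $ i \<in> ?Z} \<subseteq> vec_lambda ` (UNIV \<rightarrow>\<^sub>E ?Z)"
      by (intro subsetI image_eqI[where x = "vec_nth _"]) auto
    show "finite ((vec_lambda :: _ \<Rightarrow> real ^ 'd) ` (UNIV \<rightarrow>\<^sub>E ?Z))"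
      by (intro finite_imageI finite_PiE) auto
  qed
  ultimately show ?thesis
    by (rule finite_subset)
qed

lemma sep_attained:
  fixes Y :: "(real ^ 'd) set"
  assumes "finite Y" "Y \<noteq> {}"
  shows "sep Y \<in> sep_norms Y" "\<forall>r\<in>sep_norms Y. sep Y \<le> r"
proof -
  obtain t0 where t0: "t0 \<in> Y"
    using assms by blast
  have one: "1 \<in> sep_norms Y"
  proof -
    let ?l = "axis undefined 1 :: real ^ 'd"
    have "norm (t0 - t0 + ?l) = 1" "?l \<in> int_lattice" "t0 - t0 + ?l \<noteq> 0"
      by (auto simp: norm_axis_1 axis_eq_0_iff) (simp add: int_lattice_def axis_def)
    then show ?thesis
      unfolding sep_norms_def using t0 by (smt (verit) mem_Collect_eq)
  qed
  define S where "S = {r \<in> sep_norms Y. r \<le> 1}"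
  have "S \<subseteq> (\<Union>t\<in>Y. \<Union>t'\<in>Y. (\<lambda>l. norm (t - t' + l)) ` freqs (1 + norm (t - t')))"
  proof
    fix r assume "r \<in> S"
    then obtain t t' l where *: "t \<in> Y" "t' \<in> Y" "l \<in> int_lattice"
      "r = norm (t - t' + l)" "r \<le> 1"
      by (auto simp: S_def sep_norms_def)
    have "norm l \<le> norm (t - t' + l) + norm (t - t')"
      by norm
    with * show "r \<in> (\<Union>t\<in>Y. \<Union>t'\<in>Y. (\<lambda>l. norm (t - t' + l)) ` freqs (1 + norm (t - t')))"
      by (fastforce simp: freqs_def)
  qed
  then have fin: "finite S"
    by (rule finite_subset) (use assms finite_freqs in auto)
  have ne: "1 \<in> S"
    using one by (simp add: S_def)
  have Min: "Min S \<in> S" "\<And>r. r \<in> S \<Longrightarrow> Min S \<le> r"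
    using fin ne Min_in by auto
  have le: "Min S \<le> r" if "r \<in> sep_norms Y" for r
    using that Min(2)[of r] Min(2)[OF ne] by (cases "r \<le> 1") (auto simp: S_def)
  have "sep Y = Min S"
    unfolding sep_def by (rule cInf_eq_minimum) (use Min le in \<open>auto simp: S_def\<close>)
  then show "sep Y \<in> sep_norms Y" "\<forall>r\<in>sep_norms Y. sep Y \<le> r"
    using Min le by (auto simp: S_def)
qed

lemma sigma_min_attained:
  fixes M :: "'r \<Rightarrow> 'c \<Rightarrow> complex"
  assumes "finite C" "C \<noteq> {}"
  shows "\<exists>u. l2_norm_on C u = 1 \<and> sigma_min R C M = l2_norm_on R (mat_vec C M u) \<and>
    (\<forall>v. l2_norm_on C v = 1 \<longrightarrow> l2_norm_on R (mat_vec C M u) \<le> l2_norm_on R (mat_vec C M v))"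
proof -
  let ?F = "\<lambda>u. l2_norm_on R (mat_vec C M u)"
  define B :: "('c \<Rightarrow> complex) set" where
    "B = PiE UNIV (\<lambda>c. if c \<in> C then cball 0 1 else {0})"
  define K where "K = B \<inter> {u. l2_norm_on C u \<in> {1}}"
  have "compact B"
    using compactin_PiE[of "\<lambda>_. euclidean" "UNIV :: 'c set"
        "\<lambda>c. if c \<in> C then cball (0::complex) 1 else {0}"]
    unfolding B_def by (auto simp: euclidean_product_topology)
  have cont: "continuous_on UNIV (\<lambda>u. l2_norm_on C u)" "continuous_on UNIV ?F"
    unfolding l2_norm_on_def mat_vec_def L2_set_def
    by (intro continuous_intros continuous_on_product_coordinates)+
  have "closed {u. l2_norm_on C u \<in> {1}}"
    using closed_vimage[OF closed_singleton cont(1), of 1] by (simp add: vimage_def)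
  with \<open>compact B\<close> have "compact K"
    unfolding K_def by (rule compact_Int_closed)
  have restr: "\<exists>w\<in>K. ?F w = ?F v" if "l2_norm_on C v = 1" for v
  proof -
    define w where "w = (\<lambda>c. if c \<in> C then v c else 0)"
    have eq: "l2_norm_on C w = 1"
      using that unfolding l2_norm_on_def w_def by (simp cong: L2_set_cong)
    have "cmod (w c) \<le> 1" if "c \<in> C" for c
      using member_le_L2_set[OF assms(1) that, of "\<lambda>c. cmod (w c)"] eq
      by (simp add: l2_norm_on_def)
    then have "w \<in> K"
      using eq by (auto simp: K_def B_def w_def)
    moreover have "mat_vec C M w = mat_vec C M v"
      unfolding mat_vec_def w_def by (simp cong: sum.cong)
    ultimately show ?thesis
      by (metis (no_types))
  qed
  obtain c0 where c0: "c0 \<in> C"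
    using assms by blast
  have "l2_norm_on C (\<lambda>c. if c = c0 then 1 else 0) = 1"
    unfolding l2_norm_on_def L2_set_def using assms c0
    by (simp add: if_distrib[of cmod] if_distrib[of "\<lambda>x. x ^ 2"] cong: if_cong)
  then have "K \<noteq> {}"
    using restr by blast
  then obtain u where u: "u \<in> K" "\<And>w. w \<in> K \<Longrightarrow> ?F u \<le> ?F w"
    using continuous_attains_inf[OF \<open>compact K\<close> _ continuous_on_subset[OF cont(2)]] by blast
  have min: "?F u \<le> ?F v" if "l2_norm_on C v = 1" for v
    using restr[OF that] u(2) by fastforce
  have u1: "l2_norm_on C u = 1"
    using u(1) by (simp add: K_def)
  have "sigma_min R C M = ?F u"
    unfolding sigma_min_def by (rule cInf_eq_minimum) (use u1 min in auto)
  with u1 min show ?thesis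
    by blast
qed

end

theory Submission
  imports Defs
begin

text \<open>
  Put \<open>u\<^sub>t = \<alpha>\<^sub>t g - \<beta>\<^sub>t \<bullet> \<nabla>g\<close>, where \<open>g\<close> is the radial Neumann eigenfunction of a ball of radius
  \<open>\<rho>\<close>, shifted to vanish on the sphere and extended by 0. Its gradient vanishes on the sphere as
  well, its partial derivatives are Dirichlet eigenfunctions with eigenvalue
  \<open>\<lambda> = (j\<^bsub>d/2,1\<^esub> / \<rho>)\<^sup>2\<close>, and Green's formula gives \<open>\<parallel>\<nabla>u\<^sub>t\<parallel>\<^sup>2 \<le> \<lambda> \<parallel>u\<^sub>t\<parallel>\<^sup>2\<close>.
  Let \<open>F\<close> be the periodic sum of the translates \<open>u\<^sub>t(x - t)\<close>; its \<open>k\<close>-th Fourier coefficient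
  is the Fourier transform of \<open>g\<close> at \<open>k\<close> times the \<open>k\<close>-th entry of the block matrix applied to
  \<open>(\<alpha>, \<beta>)\<close>. If \<open>2 \<rho> < sep Y\<close>, the supports are disjoint, so that
  \<open>(2 \<pi> n)\<^sup>2 \<parallel>F\<parallel>\<^sup>2 - \<parallel>\<nabla>F\<parallel>\<^sup>2 \<ge> ((2 \<pi> n)\<^sup>2 - \<lambda>) (\<Sum>\<^sub>t \<parallel>u\<^sub>t\<parallel>\<^sup>2)\<close>, while by Parseval the
  left-hand side is at most \<open>(2 \<pi> n)\<^sup>2\<close> times the sum of the squared Fourier coefficients of
  frequency at most \<open>n\<close>. The hypothesis on \<open>n q\<close> makes \<open>(2 \<pi> n)\<^sup>2 - \<lambda>\<close> positive for some
  \<open>\<rho> < q / 2\<close>. Parseval's identity is used only for the discrete Fourier transform on grids of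
  mesh \<open>1 / (2 M + 1)\<close>, with \<open>M\<close> tending to infinity.
\<close>

section \<open>Bessel functions as entire series\<close>

text \<open>Value and derivative data are served by one function: the Fourier transform of g factors
  out of every coefficient at frequency k, and only an upper bound for its modulus enters.
  Differentiating g raises the Bessel order from d/2 - 1 to d/2, so the radius at which the gradient
  vanishes is governed by a zero of J of order d/2.

  Extended by 0, the functions u are Lipschitz along coordinate lines, but their gradients may jump
  across the sphere. Finite Fourier identities on grids avoid all questions of convergence of
  Fourier series. Their price is a factor \<theta> < 1, since the discrete symbol 4 N^2 sin^2(pi k_i
  / N) lies below (2 pi k_i)^2. The slack \<tau> > 0 pays for this factor, for a radius strictly
  below q/2 and for the remaining spectral gap.

  The power of n comes from scaling: the squared norms of the u sum to at least a multiple of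
  \<rho>^d, the squared transform of g is at most a multiple of \<rho>^(2d), and \<rho> is
  proportional to 1/n.\<close>

definition bessel_E :: "real \<Rightarrow> real \<Rightarrow> real" where
  "bessel_E \<mu> z = (\<Sum>m. (- 1) ^ m / (fact m * Gamma (real m + \<mu> + 1)) * z ^ m)"

lemma summable_bessel_E:
  fixes z :: real
  assumes "\<mu> > -1"
  shows "summable (\<lambda>m. (- 1) ^ m / (fact m * Gamma (real m + \<mu> + 1)) * z ^ m)"
proof -
  obtain N :: nat where N: "real N > 2 * \<bar>z\<bar>" "N \<ge> 1"
  proof -
    obtain N :: nat where "2 * \<bar>z\<bar> < real N"
      using reals_Archimedean2 by blast
    then show ?thesis
      using that[of "N"] by (cases "N = 0") auto
  qed
  show ?thesis
  proof (rule summable_ratio_test[of "1/2" N])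
    fix m assume m: "N \<le> m"
    define G where "G = Gamma (real m + \<mu> + 1)"
    have G: "G > 0"
      unfolding G_def using assms by (intro Gamma_real_pos) auto
    have G1: "Gamma (real (Suc m) + \<mu> + 1) = (real m + \<mu> + 1) * G"
      using assms Gamma_plus1[of "real m + \<mu> + 1"]
      by (auto simp: G_def nonpos_Ints_def add_ac)
    have mz: "real m > 2 * \<bar>z\<bar>" "real m \<ge> 1"
      using N m by linarith+
    have "2 * \<bar>z\<bar> \<le> (1 + real m) * (real m + \<mu> + 1)"
    proof -
      have "1 * real m \<le> (1 + real m) * (real m + \<mu> + 1)"
        using assms by (intro mult_mono) auto
      then show ?thesis
        using mz by linarith
    qed
    then have le: "\<bar>z\<bar> / ((1 + real m) * (real m + \<mu> + 1)) \<le> 1 / 2"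
      using assms mz by (subst pos_divide_le_eq) (auto intro!: mult_pos_pos)
    have pos: "real m + \<mu> + 1 > 0"
      using assms by linarith
    have "norm ((- 1) ^ Suc m / (fact (Suc m) * Gamma (real (Suc m) + \<mu> + 1)) * z ^ Suc m)
        = \<bar>z\<bar> / ((1 + real m) * (real m + \<mu> + 1)) * (\<bar>z\<bar> ^ m / (fact m * G))"
      unfolding G1 using G pos by (simp add: abs_mult power_abs)
    also have "\<dots> \<le> 1 / 2 * (\<bar>z\<bar> ^ m / (fact m * G))"
      using G by (intro mult_right_mono le) auto
    also have "\<bar>z\<bar> ^ m / (fact m * G) = norm ((- 1) ^ m / (fact m * Gamma (real m + \<mu> + 1)) * z ^ m)"
      unfolding G_def[symmetric] using G by (simp add: abs_mult power_abs)
    finally show "norm ((- 1) ^ Suc m / (fact (Suc m) * Gamma (real (Suc m) + \<mu> + 1)) * z ^ Suc m)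
        \<le> 1/2 * norm ((- 1) ^ m / (fact m * Gamma (real m + \<mu> + 1)) * z ^ m)" .
  qed simp
qed

text \<open>In termwise differentiation the new factor m + 1 cancels against the factorial, while
  the argument of Gamma keeps its shift by one. Hence the order rises and no power of z is left
  over, unlike for J itself.\<close>

lemma bessel_E_deriv:
  assumes "\<mu> > -1"
  shows "(bessel_E \<mu> has_real_derivative - bessel_E (\<mu> + 1) z) (at z)"
proof -
  define c where "c \<mu> m = (- 1) ^ m / (fact m * Gamma (real m + \<mu> + 1))" for \<mu> :: real and m
  have "DERIV (\<lambda>x. \<Sum>m. c \<mu> m * x ^ m) z :> (\<Sum>m. diffs (c \<mu>) m * z ^ m)"
    using summable_bessel_E[OF assms]
    by (intro termdiffs_strong_converges_everywhere) (simp add: c_def)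
  moreover have "diffs (c \<mu>) m = - c (\<mu> + 1) m" for m
  proof -
    have "diffs (c \<mu>) m = (1 + real m) * ((- 1) ^ Suc m / ((1 + real m) * (fact m * Gamma (real m + (\<mu> + 1) + 1))))"
      unfolding diffs_def c_def by (simp add: add_ac mult.assoc)
    also have "\<dots> = - c (\<mu> + 1) m"
      unfolding c_def by (subst times_divide_eq_right, subst mult_divide_mult_cancel_left) auto
    finally show ?thesis .
  qed
  moreover have "(\<lambda>x. \<Sum>m. c \<mu> m * x ^ m) = bessel_E \<mu>"
    by (rule ext) (simp add: bessel_E_def c_def)
  moreover have "(\<Sum>m. - c (\<mu> + 1) m * z ^ m) = - bessel_E (\<mu> + 1) z"
    using summable_bessel_E[of "\<mu> + 1" z] assms
    by (simp add: bessel_E_def c_def suminf_minus)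
  ultimately show ?thesis
    by simp
qed

text \<open>Combined with \<open>bessel_E_deriv\<close> this is the Bessel equation z E'' + (\<mu> +
  1) E' + E = 0. With X = (-1)^m / (m! Gamma(m + \<mu> + 2)) the three contributions to z^m are -m
  X, -(\<mu> + 1) X and (m + \<mu> + 1) X.\<close>

lemma bessel_E_recurrence:
  assumes "\<mu> > -1"
  shows "z * bessel_E (\<mu> + 2) z - (\<mu> + 1) * bessel_E (\<mu> + 1) z + bessel_E \<mu> z = 0"
proof -
  define c where "c \<mu> m = (- 1) ^ m / (fact m * Gamma (real m + \<mu> + 1))" for \<mu> :: real and m
  have S: "(\<lambda>m. c \<mu> m * z ^ m) sums bessel_E \<mu> z" if "\<mu> > -1" for \<mu>
    using summable_bessel_E[OF that] by (simp add: bessel_E_def c_def sums_iff)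
  have "(\<lambda>m. z * (c (\<mu> + 2) m * z ^ m)) sums (z * bessel_E (\<mu> + 2) z)"
    using S[of "\<mu> + 2"] assms by (intro sums_mult) auto
  then have 1: "(\<lambda>m. if m = 0 then 0 else c (\<mu> + 2) (m - 1) * z ^ m) sums (z * bessel_E (\<mu> + 2) z)"
    using sums_Suc_iff[of "\<lambda>m. if m = 0 then 0 else c (\<mu> + 2) (m - 1) * z ^ m" "z * bessel_E (\<mu> + 2) z"]
    by (simp add: mult_ac)
  have 2: "(\<lambda>m. (if m = 0 then 0 else c (\<mu> + 2) (m - 1) * z ^ m) - (\<mu> + 1) * (c (\<mu> + 1) m * z ^ m)
      + c \<mu> m * z ^ m) sums (z * bessel_E (\<mu> + 2) z - (\<mu> + 1) * bessel_E (\<mu> + 1) z + bessel_E \<mu> z)"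
    using S[of "\<mu> + 1"] S[of \<mu>] assms by (intro sums_add sums_diff sums_mult 1) auto
  have "(if m = 0 then 0 else c (\<mu> + 2) (m - 1) * z ^ m) - (\<mu> + 1) * (c (\<mu> + 1) m * z ^ m)
      + c \<mu> m * z ^ m = 0" for m
  proof -
    define G where "G = Gamma (real m + \<mu> + 1)"
    have G: "G > 0"
      unfolding G_def using assms by (intro Gamma_real_pos) auto
    have G1: "Gamma (real m + \<mu> + 2) = (real m + \<mu> + 1) * G"
      using assms Gamma_plus1[of "real m + \<mu> + 1"]
      by (auto simp: G_def nonpos_Ints_def add_ac)
    show ?thesis
    proof (cases m)
      case 0
      then show ?thesis
        using G1 assms by (simp add: c_def G_def add.commute)
    next
      case (Suc k)
      have p: "real m + \<mu> + 1 > 0" using assms by linarith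
      have "c (\<mu> + 2) (m - 1) = - real m * ((- 1) ^ m / (fact m * ((real m + \<mu> + 1) * G)))"
      proof -
        have "c (\<mu> + 2) k = (- 1) ^ k / (fact k * ((real m + \<mu> + 1) * G))"
          using G1 Suc by (simp add: c_def add_ac)
        also have "\<dots> = (real m * (- 1) ^ k) / (real m * (fact k * ((real m + \<mu> + 1) * G)))"
          using Suc by (subst mult_divide_mult_cancel_left) auto
        also have "real m * (fact k * ((real m + \<mu> + 1) * G)) = fact m * ((real m + \<mu> + 1) * G)"
          using Suc by simp
        finally show ?thesis
          using Suc by (simp del: fact_Suc of_nat_Suc)
      qed
      moreover have "c (\<mu> + 1) m = (- 1) ^ m / (fact m * ((real m + \<mu> + 1) * G))"
        using G1 by (simp add: c_def add_ac)
      moreover have "c \<mu> m = (real m + \<mu> + 1) * ((- 1) ^ m / (fact m * ((real m + \<mu> + 1) * G)))"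
        using p by (simp add: c_def G_def)
      ultimately obtain X where "c (\<mu> + 2) (m - 1) = - real m * X" "c (\<mu> + 1) m = X"
        "c \<mu> m = (real m + \<mu> + 1) * X"
        by blast
      then show ?thesis
        using Suc by (simp add: algebra_simps del: of_nat_Suc)
    qed
  qed
  then show ?thesis
    using 2 by (simp add: sums_iff)
qed

lemma bessel_E_zero: "bessel_E \<mu> 0 = 1 / Gamma (\<mu> + 1)"
  unfolding bessel_E_def by (subst suminf_finite[of "{0}"]) auto

lemma continuous_bessel_E:
  assumes "\<mu> > -1"
  shows "continuous_on S (bessel_E \<mu>)"
  using bessel_E_deriv[OF assms] 
  by (auto intro!: continuous_at_imp_continuous_on DERIV_isCont)

text \<open>\<open>bessel_E\<close> is the Bessel-Clifford function at negated argument. The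
  prefactor is positive, so x > 0 is a zero of J exactly if x^2 / 4 is one of the entire series. The
  series composed with a multiple of |x|^2 is smooth at the origin, which is what radial functions
  on a ball require.\<close>

lemma bessel_J_eq_bessel_E:
  assumes "x > 0" "\<nu> > -1"
  shows "bessel_J \<nu> x = (x / 2) powr \<nu> * bessel_E \<nu> (x\<^sup>2 / 4)"
proof -
  have "(x / 2) powr (2 * real m + \<nu>) = (x / 2) powr \<nu> * (x\<^sup>2 / 4) ^ m" for m
  proof -
    have "(x / 2) powr (2 * real m) = (x / 2) ^ (2 * m)"
      using assms powr_realpow[of "x / 2" "2 * m"] by simp
    also have "\<dots> = (x\<^sup>2 / 4) ^ m"
      by (simp add: power_mult power_divide)
    finally show ?thesis
      by (simp add: powr_add)
  qed
  then have "bessel_J \<nu> x = (\<Sum>m. (x / 2) powr \<nu> *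
      ((- 1) ^ m / (fact m * Gamma (real m + \<nu> + 1)) * (x\<^sup>2 / 4) ^ m))"
    unfolding bessel_J_def by (simp add: mult_ac)
  also have "\<dots> = (x / 2) powr \<nu> * bessel_E \<nu> (x\<^sup>2 / 4)"
    unfolding bessel_E_def using assms by (intro suminf_mult summable_bessel_E)
  finally show ?thesis .
qed

text \<open>
  If \<open>E = bessel_E \<nu>\<close> had no positive zero, then \<open>w = - z E' / E\<close> would satisfy the Riccati
  equation \<open>w' = 1 + (w\<^sup>2 - \<nu> w) / z\<close>, whose solutions blow up in finite time.
\<close>

lemma bessel_E_has_zero:
  assumes "\<nu> > 0"
  shows "\<exists>z>0. bessel_E \<nu> z = 0"
proof (rule ccontr)
  assume no: "\<not> ?thesis"
  let ?E = "bessel_E \<nu>" and ?E1 = "bessel_E (\<nu> + 1)" and ?E2 = "bessel_E (\<nu> + 2)"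
  have E0: "?E 0 > 0"
    using assms by (simp add: bessel_E_zero Gamma_real_pos)
  have pos: "?E z > 0" if "z > 0" for z
  proof (rule ccontr)
    assume "\<not> ?E z > 0"
    moreover have "0 \<le> z" "continuous_on {0..z} ?E"
      using continuous_bessel_E[of \<nu> "{0..z}"] assms that by auto
    ultimately obtain x where "0 \<le> x" "x \<le> z" "?E x = 0"
      using IVT2'[of ?E z 0 0] E0 by fastforce
    then show False
      using no E0 by (cases "x = 0") auto
  qed
  define w where "w z = z * ?E1 z / ?E z" for z
  have dE: "(?E has_real_derivative - ?E1 z) (at z)" for z
    using bessel_E_deriv[of \<nu> z] assms by simp
  have dE1: "(?E1 has_real_derivative - ?E2 z) (at z)" for z
    using bessel_E_deriv[of "\<nu> + 1" z] assms by (simp add: add_ac)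
  have rec: "z * ?E2 z = (\<nu> + 1) * ?E1 z - ?E z" for z
    using bessel_E_recurrence[of \<nu> z] assms by simp
  have dw: "(w has_real_derivative 1 + ((w z)\<^sup>2 - \<nu> * w z) / z) (at z)" if "z > 0" for z
  proof -
    have "(w has_real_derivative ((1 * ?E1 z + - ?E2 z * z) * ?E z - z * ?E1 z * - ?E1 z)
        / (?E z * ?E z)) (at z)"
      unfolding w_def using pos[OF that] by (intro DERIV_divide DERIV_mult' DERIV_mult DERIV_ident dE dE1) auto
    moreover have "?E2 z * z = (\<nu> + 1) * ?E1 z - ?E z"
      using rec[of z] by (simp add: mult_ac)
    moreover have "((1 * ?E1 z + - ((\<nu> + 1) * ?E1 z - ?E z)) * ?E z - z * ?E1 z * - ?E1 z) / (?E z * ?E z)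
        = 1 + ((w z)\<^sup>2 - \<nu> * w z) / z"
      using pos[OF that] that by (simp add: w_def field_simps power2_eq_square)
    ultimately show ?thesis
      by (metis minus_mult_left)
  qed
  \<comment> \<open>Completing the square gives w^2 - \<nu> w >= -\<nu>^2 / 4. For z >= \<nu>^2 / 2
    this is at least -z / 2, so that w' >= 1/2.\<close>
  define z0 where "z0 = \<nu>\<^sup>2 / 2"
  have z0: "z0 > 0"
    using assms by (simp add: z0_def)
  have w_lower: "w z \<ge> w z0 + (z - z0) / 2" if "z \<ge> z0" for z
  proof -
    have "w z0 - z0 / 2 \<le> w z - z / 2"
    proof (rule DERIV_nonneg_imp_nondecreasing[OF that])
      fix x assume x: "z0 \<le> x" "x \<le> z"
      then have "x > 0" using z0 by linarith
      have "(w x - \<nu> / 2)\<^sup>2 \<ge> 0" by simp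
      then have "(w x)\<^sup>2 - \<nu> * w x \<ge> - (\<nu>\<^sup>2 / 4)"
        by (simp add: power2_eq_square algebra_simps)
      moreover have "\<nu>\<^sup>2 / 4 \<le> x / 2"
        using x by (simp add: z0_def)
      ultimately have "((w x)\<^sup>2 - \<nu> * w x) / x \<ge> - 1/2"
        using \<open>x > 0\<close> by (simp add: field_simps)
      moreover have "((\<lambda>x. w x - x / 2) has_real_derivative
          1 + ((w x)\<^sup>2 - \<nu> * w x) / x - 1/2) (at x)"
        using dw[OF \<open>x > 0\<close>] by (auto intro!: derivative_eq_intros)
      ultimately show "\<exists>y. ((\<lambda>x. w x - x / 2) has_real_derivative y) (at x) \<and> 0 \<le> y"
        by (intro exI[of _ "1 + ((w x)\<^sup>2 - \<nu> * w x) / x - 1/2"] conjI) linarith+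
    qed
    then show ?thesis by (simp add: field_simps)
  qed
  \<comment> \<open>Growth at rate 1/2 lifts w above 2 \<nu> from here on, whatever its sign at z0.
    Then \<nu> w <= w^2 / 2, and the Riccati equation yields w' >= w^2 / (2 z).\<close>
  define z1 where "z1 = z0 + 2 * (\<bar>w z0\<bar> + 2 * \<nu>)"
  have z1: "z1 \<ge> z0" "z1 > 0"
    using assms z0 by (auto simp: z1_def)
  have w_large: "w z \<ge> 2 * \<nu>" if "z \<ge> z1" for z
  proof -
    have "w z \<ge> w z0 + (z - z0) / 2"
      using w_lower that z1 by auto
    moreover have "z - z0 \<ge> 2 * (\<bar>w z0\<bar> + 2 * \<nu>)"
      using that by (simp add: z1_def)
    moreover have "- w z0 \<le> \<bar>w z0\<bar>"
      by simp
    ultimately show ?thesis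
      by argo
  qed
  \<comment> \<open>The integrated form of w' / w^2 >= 1 / (2 z). It is absurd for large z, because
    1 / w is positive and the logarithm is unbounded.\<close>
  have decr: "1 / w z + ln z / 2 \<le> 1 / w z1 + ln z1 / 2" if "z \<ge> z1" for z
  proof (rule DERIV_nonpos_imp_nonincreasing[OF that])
    fix x assume x: "z1 \<le> x" "x \<le> z"
    then have x0: "x > 0" using z1 by linarith
    have wl: "w x \<ge> 2 * \<nu>" "w x > 0"
      using w_large[of x] x assms by auto
    have "((\<lambda>x. 1 / w x + ln x / 2) has_real_derivative
        - (1 + ((w x)\<^sup>2 - \<nu> * w x) / x) / (w x)\<^sup>2 + 1 / (2 * x)) (at x)"
    proof -
      define D where "D = 1 + ((w x)\<^sup>2 - \<nu> * w x) / x"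
      have wD: "(w has_real_derivative D) (at x)"
        using dw[OF x0] by (simp add: D_def)
      have "((\<lambda>x. inverse (w x) + ln x / 2) has_real_derivative
          - (inverse (w x) * D * inverse (w x)) + inverse x / 2) (at x)"
      proof (rule DERIV_add)
        show "((\<lambda>x. inverse (w x)) has_real_derivative - (inverse (w x) * D * inverse (w x))) (at x)"
          by (rule DERIV_inverse'[OF wD]) (rule less_imp_neq[OF wl(2), symmetric])
        show "((\<lambda>x. ln x / 2) has_real_derivative inverse x / 2) (at x)"
          by (rule DERIV_cdivide[OF DERIV_ln[OF x0]])
      qed
      moreover have "- (inverse (w x) * D * inverse (w x)) + inverse x / 2 = - D / (w x)\<^sup>2 + 1 / (2 * x)"
        using wl(2) x0 by (simp add: field_simps power2_eq_square)
      ultimately show ?thesis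
        by (simp add: D_def inverse_eq_divide)
    qed
    moreover have "- (1 + ((w x)\<^sup>2 - \<nu> * w x) / x) / (w x)\<^sup>2 + 1 / (2 * x) \<le> 0"
    proof -
      have "2 * \<nu> * w x \<le> (w x)\<^sup>2"
        using wl by (simp add: power2_eq_square mult_right_mono)
      then have "(w x)\<^sup>2 / (2 * x) \<le> ((w x)\<^sup>2 - \<nu> * w x) / x"
        using x0 by (simp add: field_simps)
      then have "1 / (2 * x) * (w x)\<^sup>2 \<le> 1 + ((w x)\<^sup>2 - \<nu> * w x) / x"
        by simp
      then have "1 / (2 * x) \<le> (1 + ((w x)\<^sup>2 - \<nu> * w x) / x) / (w x)\<^sup>2"
        using wl by (subst pos_le_divide_eq) auto
      then show ?thesis
        unfolding minus_divide_left[symmetric] by linarith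
    qed
    ultimately show "\<exists>y. ((\<lambda>x. 1 / w x + ln x / 2) has_real_derivative y) (at x) \<and> y \<le> 0"
      by blast
  qed
  define z2 where "z2 = max z1 (exp (2 * (1 / w z1 + ln z1 / 2)))"
  have "z2 \<ge> z1" "z2 > 0"
    using z1 by (auto simp: z2_def)
  have "ln z2 / 2 \<ge> 1 / w z1 + ln z1 / 2"
    using \<open>z2 > 0\<close> by (simp add: ln_ge_iff z2_def)
  moreover have "1 / w z2 > 0"
    using w_large[OF \<open>z2 \<ge> z1\<close>] assms by simp
  ultimately show False
    using decr[OF \<open>z2 \<ge> z1\<close>] by linarith
qed

text \<open>\<open>LEAST\<close> over the reals says something only if a minimum exists. The series
  is positive at 0, so its zeros stay away from 0; the condition x > 0 may therefore be replaced by
  x >= \<delta>, the set of zeros is closed, and its infimum is attained.\<close>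

lemma bessel_first_zero:
  assumes "\<nu> > 0"
  shows "bessel_first_zero \<nu> > 0" "bessel_E \<nu> ((bessel_first_zero \<nu>)\<^sup>2 / 4) = 0"
proof -
  define Z where "Z = {x. x > 0 \<and> bessel_E \<nu> (x\<^sup>2 / 4) = 0}"
  have Z: "x > 0 \<and> bessel_J \<nu> x = 0 \<longleftrightarrow> x \<in> Z" for x
    using assms by (auto simp: Z_def bessel_J_eq_bessel_E)
  obtain z where z: "z > 0" "bessel_E \<nu> z = 0"
    using bessel_E_has_zero[OF assms] by blast
  have "sqrt (4 * z) \<in> Z"
    using z by (simp add: Z_def)
  define f where "f x = bessel_E \<nu> (x\<^sup>2 / 4)" for x
  have cont: "continuous_on UNIV f"
    unfolding f_def using assms
    by (intro continuous_on_compose2[OF continuous_bessel_E[of \<nu> UNIV]] continuous_intros) auto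
  have "f 0 > 0"
    using assms by (simp add: f_def bessel_E_zero Gamma_real_pos)
  then obtain \<delta> where \<delta>: "\<delta> > 0" "\<And>x. dist 0 x < \<delta> \<Longrightarrow> f x \<noteq> 0"
    using continuous_on_avoid[of UNIV f 0 0] cont by auto
  have "Z = {\<delta>..} \<inter> f -` {0}"
  proof (intro equalityI subsetI)
    fix x assume x: "x \<in> Z"
    then have "\<not> dist 0 x < \<delta>"
      using \<delta>(2)[of x] by (auto simp: Z_def f_def)
    with x show "x \<in> {\<delta>..} \<inter> f -` {0}"
      by (auto simp: Z_def f_def)
  qed (use \<delta>(1) in \<open>auto simp: Z_def f_def\<close>)
  moreover have "closed ({\<delta>..} \<inter> f -` {0})"
    using cont by (intro closed_Int closed_vimage) auto
  ultimately have "closed Z" by simp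
  have bdd: "bdd_below Z"
    by (intro bdd_belowI[of _ 0]) (auto simp: Z_def)
  have I: "Inf Z \<in> Z"
    using \<open>sqrt (4 * z) \<in> Z\<close> \<open>closed Z\<close> bdd by (intro closed_contains_Inf) auto
  have "bessel_first_zero \<nu> = Inf Z"
    unfolding bessel_first_zero_def Z
    by (rule Least_equality) (use I bdd in \<open>auto intro: cInf_lower\<close>)
  with I show "bessel_first_zero \<nu> > 0" "bessel_E \<nu> ((bessel_first_zero \<nu>)\<^sup>2 / 4) = 0"
    by (auto simp: Z_def)
qed

section \<open>Functions cut off outside a ball\<close>

text \<open>Differentiability along a single axis, at every point. One-dimensional calculus on
  segments is enough both for integration by parts and for difference quotients, and it treats real
  and complex values alike.\<close>

definition has_partial :: "'d \<Rightarrow> (real ^ 'd \<Rightarrow> 'b::real_normed_vector) \<Rightarrow> (real ^ 'd \<Rightarrow> 'b) \<Rightarrow> bool" where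
  "has_partial i f f' \<longleftrightarrow>
     (\<forall>x. ((\<lambda>s. f (x + s *\<^sub>R axis i 1)) has_vector_derivative f' x) (at 0))"

lemma has_partial_along:
  assumes "has_partial i f f'"
  shows "((\<lambda>s. f (x + s *\<^sub>R axis i 1)) has_vector_derivative f' (x + s *\<^sub>R axis i 1)) (at s)"
proof -
  let ?y = "x + s *\<^sub>R axis i 1"
  have 1: "((\<lambda>t. t - s) has_vector_derivative 1) (at s)"
    by (auto intro!: derivative_eq_intros)
  have 2: "((\<lambda>h. f (?y + h *\<^sub>R axis i 1)) has_vector_derivative f' ?y) (at (s - s))"
    using assms by (simp add: has_partial_def)
  have "(((\<lambda>h. f (?y + h *\<^sub>R axis i 1)) \<circ> (\<lambda>t. t - s)) has_vector_derivative 1 *\<^sub>R f' ?y) (at s)"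
    by (rule vector_diff_chain_at[OF 1 2])
  moreover have "(\<lambda>h. f (?y + h *\<^sub>R axis i 1)) \<circ> (\<lambda>t. t - s) = (\<lambda>t. f (x + t *\<^sub>R axis i 1))"
    by (auto simp: o_def algebra_simps)
  ultimately show ?thesis by simp
qed

text \<open>Mean value inequality for s -> f(x + s e) - s c. The choice c = 0 gives Lipschitz
  bounds, c = f'(y) gives convergence of difference quotients at y.\<close>

lemma has_partial_increment_bound:
  fixes f :: "real ^ 'd \<Rightarrow> 'b::real_normed_vector"
  assumes "has_partial i f f'" "h \<ge> 0"
    and K: "\<And>s. 0 \<le> s \<Longrightarrow> s \<le> h \<Longrightarrow> norm (f' (x + s *\<^sub>R axis i 1) - c) \<le> K"
  shows "norm (f (x + h *\<^sub>R axis i 1) - f x - h *\<^sub>R c) \<le> K * h"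
proof -
  define g where "g s = f (x + s *\<^sub>R axis i 1) - s *\<^sub>R c" for s
  have "norm (g h - g 0) \<le> K * norm (h - 0)"
  proof (rule differentiable_bound[of "{0..h}" g "\<lambda>s t. t *\<^sub>R (f' (x + s *\<^sub>R axis i 1) - c)"])
    fix s assume s: "s \<in> {0..h}"
    have "(g has_vector_derivative f' (x + s *\<^sub>R axis i 1) - 1 *\<^sub>R c) (at s within {0..h})"
      unfolding g_def
      by (intro has_vector_derivative_diff has_vector_derivative_at_within[OF has_partial_along[OF assms(1)]]
          has_vector_derivative_scaleR[where g = "\<lambda>_. c" and g' = 0, simplified] DERIV_ident)
    then show "(g has_derivative (\<lambda>t. t *\<^sub>R (f' (x + s *\<^sub>R axis i 1) - c))) (at s within {0..h})"
      by (simp add: has_vector_derivative_def)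
    show "onorm (\<lambda>t. t *\<^sub>R (f' (x + s *\<^sub>R axis i 1) - c)) \<le> K"
      using K[of s] s by (intro onorm_le) (simp add: mult.commute[of K] mult_left_mono)
  qed (use assms(2) in auto)
  then show ?thesis
    using assms(2) by (simp add: g_def algebra_simps)
qed

section \<open>Extension by zero outside a ball\<close>

definition ball_cut :: "real \<Rightarrow> ('a::real_normed_vector \<Rightarrow> 'b::zero) \<Rightarrow> 'a \<Rightarrow> 'b" where
  "ball_cut \<rho> f x = (if norm x < \<rho> then f x else 0)"

lemma ball_cut_outside: "norm x \<ge> \<rho> \<Longrightarrow> ball_cut \<rho> f x = 0"
  by (simp add: ball_cut_def)

lemma borel_measurable_ball_cut:
  fixes f :: "'a::euclidean_space \<Rightarrow> 'b::euclidean_space"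
  assumes "continuous_on UNIV f"
  shows "ball_cut \<rho> f \<in> borel_measurable borel"
proof -
  have [measurable]: "f \<in> borel_measurable borel"
    using assms by (rule borel_measurable_continuous_onI)
  have "ball_cut \<rho> f = (\<lambda>x. indicator (ball 0 \<rho>) x *\<^sub>R f x)"
    by (auto simp: ball_cut_def indicator_def)
  then show ?thesis
    by (simp only:) (intro borel_measurable_scaleR borel_measurable_indicator; simp)
qed

lemma integrable_bounded_support:
  fixes f :: "'a::euclidean_space \<Rightarrow> 'b::euclidean_space"
  assumes "f \<in> borel_measurable borel" "\<And>x. norm (f x) \<le> B" "\<And>x. norm x > R \<Longrightarrow> f x = 0"
  shows "integrable lborel f"
proof (rule integrableI_bounded_set[of "cball 0 R" lborel f B])
  show "emeasure lborel (cball (0::'a) R) < \<infinity>"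
    by (rule emeasure_lborel_cball_finite)
qed (use assms in auto)

lemma continuous_cball_bound:
  fixes f :: "'a::euclidean_space \<Rightarrow> 'b::real_normed_vector"
  assumes "continuous_on UNIV f"
  shows "\<exists>B>0. \<forall>x. norm x \<le> \<rho> \<longrightarrow> norm (f x) \<le> B"
proof -
  have "compact (f ` cball 0 \<rho>)"
    by (intro compact_continuous_image continuous_on_subset[OF assms]) auto
  then obtain B where "B > 0" "\<forall>y \<in> f ` cball 0 \<rho>. norm y \<le> B"
    using compact_imp_bounded bounded_pos by blast
  then show ?thesis
    by (intro exI[of _ B]) auto
qed

lemma bounded_ball_cut:
  fixes f :: "'a::euclidean_space \<Rightarrow> 'b::real_normed_vector"
  assumes "continuous_on UNIV f"
  shows "\<exists>B\<ge>0. \<forall>x. norm (ball_cut \<rho> f x) \<le> B"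
proof -
  obtain B where B: "B > 0" "\<And>x. norm x \<le> \<rho> \<Longrightarrow> norm (f x) \<le> B"
    using continuous_cball_bound[OF assms, of \<rho>] by blast
  then show ?thesis
    by (intro exI[of _ B]) (auto simp: ball_cut_def)
qed

lemma integrable_ball_cut:
  fixes f :: "'a::euclidean_space \<Rightarrow> 'b::euclidean_space"
  assumes "continuous_on UNIV f"
  shows "integrable lborel (ball_cut \<rho> f)"
  using bounded_ball_cut[OF assms, of \<rho>]
  by (auto intro!: integrable_bounded_support[where R = \<rho>] borel_measurable_ball_cut assms simp: ball_cut_def)

lemma integral_shift:
  fixes f :: "'a::euclidean_space \<Rightarrow> 'b::euclidean_space"
  assumes "f \<in> borel_measurable borel"
  shows "(LINT x|lborel. f (x + c)) = (LINT x|lborel. f x)"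
proof -
  have "(LINT x|lborel. f x) = (LINT x|distr lborel borel ((+) c). f x)"
    by (simp add: lborel_distr_plus)
  also have "\<dots> = (LINT x|lborel. f (c + x))"
    using assms by (subst integral_distr) auto
  finally show ?thesis by (simp add: add.commute)
qed

text \<open>A step across the sphere is cut at the crossing point. There f is 0, so only the part
  inside the ball contributes, and on the closed ball the derivative is bounded. Convexity of the
  ball keeps the segments inside.\<close>

lemma ball_cut_lipschitz:
  fixes f :: "real ^ 'd \<Rightarrow> 'b::real_normed_vector"
  assumes f: "has_partial i f f'" and cont: "continuous_on UNIV f'"
    and zero: "\<And>x. norm x = \<rho> \<Longrightarrow> f x = 0"
  shows "\<exists>K\<ge>0. \<forall>x. \<forall>h\<ge>0. norm (ball_cut \<rho> f (x + h *\<^sub>R axis i 1) - ball_cut \<rho> f x) \<le> K * h"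
proof -
  define e :: "real ^ 'd" where "e = axis i 1"
  obtain K where K: "K > 0" "\<And>x. norm x \<le> \<rho> \<Longrightarrow> norm (f' x) \<le> K"
    using continuous_cball_bound[OF cont, of \<rho>] by blast
  have seg: "norm (f (x + h *\<^sub>R e) - f x) \<le> K * h"
    if "norm x \<le> \<rho>" "norm (x + h *\<^sub>R e) \<le> \<rho>" "h \<ge> 0" for x h
  proof -
    have "norm (f (x + h *\<^sub>R axis i 1) - f x - h *\<^sub>R 0) \<le> K * h"
    proof (rule has_partial_increment_bound[OF f that(3)])
      fix s assume s: "0 \<le> s" "s \<le> h"
      have "x + s *\<^sub>R e = (1 - s / h) *\<^sub>R x + (s / h) *\<^sub>R (x + h *\<^sub>R e)"
        using s by (cases "h = 0") (auto simp: algebra_simps)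
      also have "\<dots> \<in> cball 0 \<rho>"
        using s that by (intro convexD[OF convex_cball]) (auto simp: divide_le_eq_1)
      finally show "norm (f' (x + s *\<^sub>R axis i 1) - 0) \<le> K"
        using K by (simp add: e_def)
    qed
    then show ?thesis by (simp add: e_def)
  qed
  have crossing: "\<exists>s\<in>{0..h}. norm (x + s *\<^sub>R e) = \<rho>"
    if "h \<ge> 0" "norm x \<le> \<rho> \<and> \<rho> \<le> norm (x + h *\<^sub>R e) \<or> \<rho> \<le> norm x \<and> norm (x + h *\<^sub>R e) \<le> \<rho>" for x h
  proof -
    have c: "continuous_on {0..h} (\<lambda>s. norm (x + s *\<^sub>R e))"
      by (intro continuous_intros)
    from that(2) show ?thesis
    proof (elim disjE conjE)
      assume "norm x \<le> \<rho>" "\<rho> \<le> norm (x + h *\<^sub>R e)"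
      then show ?thesis
        using IVT'[of "\<lambda>s. norm (x + s *\<^sub>R e)" 0 \<rho> h] c that(1) by auto
    next
      assume "\<rho> \<le> norm x" "norm (x + h *\<^sub>R e) \<le> \<rho>"
      then show ?thesis
        using IVT2'[of "\<lambda>s. norm (x + s *\<^sub>R e)" h \<rho> 0] c that(1) by auto
    qed
  qed
  have "norm (ball_cut \<rho> f (x + h *\<^sub>R e) - ball_cut \<rho> f x) \<le> K * h" if h: "h \<ge> 0" for x h
  proof -
    consider "norm x < \<rho>" "norm (x + h *\<^sub>R e) < \<rho>" | "norm x < \<rho>" "norm (x + h *\<^sub>R e) \<ge> \<rho>"
      | "norm x \<ge> \<rho>" "norm (x + h *\<^sub>R e) < \<rho>" | "norm x \<ge> \<rho>" "norm (x + h *\<^sub>R e) \<ge> \<rho>"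
      by linarith
    then show ?thesis
    proof cases
      case 1
      then show ?thesis
        using seg[of x h] h by (simp add: ball_cut_def)
    next
      case 2
      then obtain s where s: "0 \<le> s" "s \<le> h" "norm (x + s *\<^sub>R e) = \<rho>"
        using crossing[of h x] h by auto
      have "norm (f (x + s *\<^sub>R e) - f x) \<le> K * s"
        using seg[of x s] s 2 by auto
      also have "\<dots> \<le> K * h"
        using s K by (intro mult_left_mono) auto
      finally show ?thesis
        using 2 s zero[of "x + s *\<^sub>R e"] by (simp add: ball_cut_def norm_minus_commute)
    next
      case 3
      then obtain s where s: "0 \<le> s" "s \<le> h" "norm (x + s *\<^sub>R e) = \<rho>"
        using crossing[of h x] h by auto
      have "norm (f ((x + s *\<^sub>R e) + (h - s) *\<^sub>R e) - f (x + s *\<^sub>R e)) \<le> K * (h - s)"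
        using seg[of "x + s *\<^sub>R e" "h - s"] s 3 by (auto simp: algebra_simps)
      also have "\<dots> \<le> K * h"
        using s K by (intro mult_left_mono) auto
      finally show ?thesis
        using 3 s zero[of "x + s *\<^sub>R e"] by (simp add: ball_cut_def algebra_simps)
    next
      \<comment> \<open>The segment may run through the ball, but both end values are 0.\<close>
      case 4
      then show ?thesis
        using K h by (simp add: ball_cut_def)
    qed
  qed
  then show ?thesis
    using K(1) by (intro exI[of _ K]) (auto simp: e_def)
qed

text \<open>The base points move because the points of a grid only approximate y. Off the sphere all
  points involved are eventually on the same side as y: inside, continuity of f' at y controls the
  increment; outside, everything is 0.\<close>

lemma ball_cut_difference_quotient:
  fixes f :: "real ^ 'd \<Rightarrow> 'b::real_normed_vector"
  assumes f: "has_partial i f f'" and cont: "continuous_on UNIV f'"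
    and y: "norm y \<noteq> \<rho>" and z: "z \<longlonglongrightarrow> y" and h: "h \<longlonglongrightarrow> 0" "\<And>n. h n > 0"
  shows "(\<lambda>n. (ball_cut \<rho> f (z n + h n *\<^sub>R axis i 1) - ball_cut \<rho> f (z n)) /\<^sub>R h n) \<longlonglongrightarrow> ball_cut \<rho> f' y"
proof (cases "norm y < \<rho>")
  case True
  show ?thesis
  proof (rule tendstoI)
    fix \<epsilon> :: real assume "\<epsilon> > 0"
    then have "\<epsilon> / 2 > 0" by simp
    have "isCont f' y"
      using cont by (simp add: continuous_on_eq_continuous_at)
    then obtain d where d: "d > 0" "\<And>x. dist x y < d \<Longrightarrow> dist (f' x) (f' y) < \<epsilon> / 2"
      using \<open>\<epsilon> / 2 > 0\<close> unfolding continuous_at_eps_delta dist_norm by (metis dist_norm)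
    define \<delta> where "\<delta> = min d (\<rho> - norm y)"
    have \<delta>: "\<delta> > 0" "\<And>x. dist x y < \<delta> \<Longrightarrow> norm x < \<rho>"
    proof -
      fix x assume "dist x y < \<delta>"
      then have "norm (x - y) < \<rho> - norm y" by (simp add: \<delta>_def dist_norm)
      then show "norm x < \<rho>" using norm_triangle_ineq2[of x y] by linarith
    qed (use d True in \<open>auto simp: \<delta>_def\<close>)
    have "eventually (\<lambda>n. dist (z n) y < \<delta> / 2) sequentially"
      using tendstoD[OF z, of "\<delta> / 2"] \<delta>(1) by simp
    moreover have "eventually (\<lambda>n. dist (h n) 0 < \<delta> / 2) sequentially"
      using tendstoD[OF h(1), of "\<delta> / 2"] \<delta>(1) by simp
    ultimately show "eventually (\<lambda>n. dist ((ball_cut \<rho> f (z n + h n *\<^sub>R axis i 1) - ball_cut \<rho> f (z n)) /\<^sub>R h n)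
        (ball_cut \<rho> f' y) < \<epsilon>) sequentially"
    proof eventually_elim
      case (elim n)
      have near: "dist (z n + s *\<^sub>R axis i 1) y < \<delta>" if "0 \<le> s" "s \<le> h n" for s
      proof -
        have "norm (z n + s *\<^sub>R axis i 1 - y) \<le> norm (z n - y) + norm (s *\<^sub>R axis i 1 :: real ^ 'd)"
          by (metis add_diff_eq add.commute diff_add_eq norm_triangle_ineq)
        also have "norm (s *\<^sub>R axis i 1 :: real ^ 'd) = s"
          using that by simp
        finally show ?thesis
          using that elim by (simp add: dist_norm)
      qed
      have n0: "norm (z n) < \<rho>" "norm (z n + h n *\<^sub>R axis i 1) < \<rho>"
        using \<delta>(2)[OF near[of 0]] \<delta>(2)[OF near[of "h n"]] h(2)[of n] by auto
      have "norm (f (z n + h n *\<^sub>R axis i 1) - f (z n) - h n *\<^sub>R f' y) \<le> \<epsilon> / 2 * h n"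
      proof (rule has_partial_increment_bound[OF f])
        show "h n \<ge> 0" using h(2)[of n] by simp
        fix s assume "0 \<le> s" "s \<le> h n"
        then show "norm (f' (z n + s *\<^sub>R axis i 1) - f' y) \<le> \<epsilon> / 2"
          using near[of s] d(2) by (fastforce simp: \<delta>_def dist_norm)
      qed
      moreover have "(f (z n + h n *\<^sub>R axis i 1) - f (z n)) /\<^sub>R h n - f' y
          = (f (z n + h n *\<^sub>R axis i 1) - f (z n) - h n *\<^sub>R f' y) /\<^sub>R h n"
        using h(2)[of n] by (simp add: scaleR_diff_right)
      ultimately have "norm ((f (z n + h n *\<^sub>R axis i 1) - f (z n)) /\<^sub>R h n - f' y) \<le> \<epsilon> / 2"
        using h(2)[of n] by (simp add: pos_divide_le_eq divide_inverse_commute[symmetric])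
      then show ?case
        using n0 True \<open>\<epsilon> > 0\<close> by (simp add: ball_cut_def dist_norm)
    qed
  qed
next
  case False
  then have gt: "norm y > \<rho>" using y by simp
  have "(\<lambda>n. z n + h n *\<^sub>R axis i 1) \<longlonglongrightarrow> y + 0 *\<^sub>R axis i 1"
    by (intro tendsto_intros z h)
  then have "(\<lambda>n. norm (z n + h n *\<^sub>R axis i 1)) \<longlonglongrightarrow> norm y"
    using tendsto_norm by fastforce
  then have "eventually (\<lambda>n. norm (z n + h n *\<^sub>R axis i 1) > \<rho>) sequentially"
    using gt by (rule order_tendstoD)
  moreover have "eventually (\<lambda>n. norm (z n) > \<rho>) sequentially"
    using tendsto_norm[OF z] gt by (rule order_tendstoD)
  ultimately have "eventually (\<lambda>n. (ball_cut \<rho> f (z n + h n *\<^sub>R axis i 1) - ball_cut \<rho> f (z n)) /\<^sub>R h n = ball_cut \<rho> f' y) sequentially"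
    by eventually_elim (use gt in \<open>simp add: ball_cut_def\<close>)
  then show ?thesis
    by (rule tendsto_eventually)
qed

lemma AE_norm_neq: "AE x::'a::euclidean_space in lborel. norm x \<noteq> \<rho>"
proof -
  have "negligible (sphere (0::'a) \<rho>)"
    by (rule negligible_sphere)
  then have "sphere (0::'a) \<rho> \<in> null_sets lborel"
    by (simp add: negligible_iff_null_sets null_sets_completion_iff)
  then show ?thesis
    by (rule AE_not_in[THEN eventually_mono]) simp
qed

text \<open>Divergence theorem without surface integrals. By translation invariance each difference
  quotient of the extension has integral 0. The Lipschitz bound dominates these quotients, and they
  converge off the sphere, a null set.\<close>

lemma integral_ball_cut_partial_eq_zero:
  fixes f :: "real ^ 'd \<Rightarrow> 'b::euclidean_space"
  assumes f: "has_partial i f f'" and cont: "continuous_on UNIV f" "continuous_on UNIV f'"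
    and zero: "\<And>x. norm x = \<rho> \<Longrightarrow> f x = 0"
  shows "(LINT x|lborel. ball_cut \<rho> f' x) = 0"
proof -
  define e :: "real ^ 'd" where "e = axis i 1"
  define h where "h n = 1 / real (Suc n)" for n
  have h: "h \<longlonglongrightarrow> 0" "\<And>n. h n > 0" "\<And>n. h n \<le> 1"
    unfolding h_def using LIMSEQ_inverse_real_of_nat by (auto simp: inverse_eq_divide)
  obtain K where K: "K \<ge> 0"
    "\<And>x h. h \<ge> 0 \<Longrightarrow> norm (ball_cut \<rho> f (x + h *\<^sub>R e) - ball_cut \<rho> f x) \<le> K * h"
    using ball_cut_lipschitz[OF f cont(2) zero] unfolding e_def by blast
  have meas: "ball_cut \<rho> f \<in> borel_measurable borel" "ball_cut \<rho> f' \<in> borel_measurable borel"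
    using cont by (auto intro: borel_measurable_ball_cut)
  note meas[measurable]
  let ?q = "\<lambda>n x. (ball_cut \<rho> f (x + h n *\<^sub>R e) - ball_cut \<rho> f x) /\<^sub>R h n"
  have int: "integrable lborel (\<lambda>x. ball_cut \<rho> f (x + c))" for c
  proof -
    obtain B where "\<And>x. norm (ball_cut \<rho> f x) \<le> B"
      using bounded_ball_cut[OF cont(1)] by blast
    moreover have "norm (x + c) \<ge> \<rho>" if "norm x > \<rho> + norm c" for x
      using norm_triangle_ineq4[of "x + c" c] that by simp
    ultimately show ?thesis
      by (intro integrable_bounded_support[where B = B and R = "\<rho> + norm c"]) (auto intro: ball_cut_outside)
  qed
  have "(LINT x|lborel. ?q n x) = 0" for n
    using int[of 0] int[of "h n *\<^sub>R e"] integral_shift[OF meas(1)] by simp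
  moreover have "(\<lambda>n. LINT x|lborel. ?q n x) \<longlonglongrightarrow> (LINT x|lborel. ball_cut \<rho> f' x)"
  proof (rule integral_dominated_convergence[where w = "\<lambda>x. K * indicator (cball 0 (\<rho> + 1)) x"])
    show "integrable lborel (\<lambda>x::real ^ 'd. K * indicator (cball 0 (\<rho> + 1)) x)"
      by (intro integrable_mult_right integrable_real_indicator)
        (use emeasure_lborel_cball_finite[of "0 :: real ^ 'd" "\<rho> + 1"] in auto)
    show "AE x in lborel. (\<lambda>n. ?q n x) \<longlonglongrightarrow> ball_cut \<rho> f' x"
      using AE_norm_neq[of \<rho>]
    proof eventually_elim
      case (elim x)
      then show ?case
        unfolding e_def
        by (intro ball_cut_difference_quotient[OF f cont(2) _ _ h(1,2)]) auto
    qed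
    show "AE x in lborel. norm (?q n x) \<le> K * indicator (cball 0 (\<rho> + 1)) x" for n
    proof (rule AE_I2)
      fix x :: "real ^ 'd"
      have "norm (?q n x) \<le> K"
        using K(2)[of "h n" x] h(2)[of n]
        by (simp add: pos_divide_le_eq divide_inverse_commute[symmetric])
      moreover have "?q n x = 0" if "norm x > \<rho> + 1"
      proof -
        have "norm (x + h n *\<^sub>R e) \<ge> norm x - norm (h n *\<^sub>R e)"
          using norm_triangle_ineq4[of "x + h n *\<^sub>R e" "h n *\<^sub>R e"] by simp
        moreover have "norm (h n *\<^sub>R e) \<le> 1"
          using h(2,3)[of n] by (simp add: e_def)
        ultimately show ?thesis
          using that by (simp add: ball_cut_outside)
      qed
      ultimately show "norm (?q n x) \<le> K * indicator (cball 0 (\<rho> + 1)) x"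
        by (cases "norm x > \<rho> + 1") (auto simp: indicator_def)
    qed
  qed measurable
  ultimately have "(\<lambda>n. 0) \<longlonglongrightarrow> (LINT x|lborel. ball_cut \<rho> f' x)"
    by (simp only:)
  then show ?thesis
    by (simp add: LIMSEQ_const_iff)
qed

section \<open>Extremal functions on the ball\<close>

lemma has_partial_const: "has_partial i (\<lambda>x. c) (\<lambda>x. 0)"
  by (simp add: has_partial_def)

lemma has_partial_add:
  "has_partial i f f' \<Longrightarrow> has_partial i g g' \<Longrightarrow> has_partial i (\<lambda>x. f x + g x) (\<lambda>x. f' x + g' x)"
  unfolding has_partial_def by (auto intro: has_vector_derivative_add)

lemma has_partial_mult:
  fixes f g :: "real ^ 'd \<Rightarrow> 'b::real_normed_algebra"
  assumes "has_partial i f f'" "has_partial i g g'"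
  shows "has_partial i (\<lambda>x. f x * g x) (\<lambda>x. f x * g' x + f' x * g x)"
  unfolding has_partial_def
proof
  fix x
  show "((\<lambda>s. f (x + s *\<^sub>R axis i 1) * g (x + s *\<^sub>R axis i 1)) has_vector_derivative
      f x * g' x + f' x * g x) (at 0)"
    using has_vector_derivative_mult[of "\<lambda>s. f (x + s *\<^sub>R axis i 1)" "f' x" 0 UNIV
        "\<lambda>s. g (x + s *\<^sub>R axis i 1)" "g' x"] assms
    by (simp add: has_partial_def)
qed

lemma has_partial_cmult:
  fixes f :: "real ^ 'd \<Rightarrow> 'b::real_normed_algebra"
  shows "has_partial i f f' \<Longrightarrow> has_partial i (\<lambda>x. c * f x) (\<lambda>x. c * f' x)"
  using has_partial_mult[OF has_partial_const] by simp

lemma has_partial_inner: "has_partial i (\<lambda>x. b \<bullet> x) (\<lambda>x. b $ i)"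
  unfolding has_partial_def
proof
  fix x
  have "((\<lambda>s. b \<bullet> x + s * (b $ i)) has_vector_derivative (b $ i)) (at 0)"
    by (auto intro!: derivative_eq_intros simp flip: has_real_derivative_iff_has_vector_derivative)
  then show "((\<lambda>s. b \<bullet> (x + s *\<^sub>R axis i 1)) has_vector_derivative b $ i) (at 0)"
    by (simp add: inner_add_right inner_axis)
qed

lemma has_partial_component: "has_partial i (\<lambda>x. x $ i) (\<lambda>x. 1)"
  using has_partial_inner[of i "axis i 1"] by (simp add: inner_axis' )

lemma has_partial_of_real:
  "has_partial i f f' \<Longrightarrow> has_partial i (\<lambda>x. complex_of_real (f x)) (\<lambda>x. complex_of_real (f' x))"
  unfolding has_partial_def using bounded_linear.has_vector_derivative[OF bounded_linear_of_real] by blast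

lemma has_partial_cis:
  "has_partial i (\<lambda>x. cis (k \<bullet> x)) (\<lambda>x. \<i> * of_real (k $ i) * cis (k \<bullet> x))"
  unfolding has_partial_def
proof
  fix x
  have "((\<lambda>z. exp (\<i> * (of_real (k \<bullet> x) + z * of_real (k $ i)))) has_field_derivative
      exp (\<i> * (of_real (k \<bullet> x) + 0 * of_real (k $ i))) * (\<i> * of_real (k $ i))) (at 0)"
    by (auto intro!: derivative_eq_intros)
  then have "((\<lambda>s. exp (\<i> * (of_real (k \<bullet> x) + of_real s * of_real (k $ i)))) has_vector_derivative
      exp (\<i> * (of_real (k \<bullet> x) + 0 * of_real (k $ i))) * (\<i> * of_real (k $ i))) (at 0)"
    by (intro has_vector_derivative_real_field) simp
  then show "((\<lambda>s. cis (k \<bullet> (x + s *\<^sub>R axis i 1))) has_vector_derivative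
      \<i> * of_real (k $ i) * cis (k \<bullet> x)) (at 0)"
    by (simp add: cis_conv_exp inner_add_right inner_axis mult_ac)
qed

section \<open>Integrals over the ball\<close>

definition ball_int :: "real \<Rightarrow> (real ^ 'd \<Rightarrow> 'b::euclidean_space) \<Rightarrow> 'b" where
  "ball_int \<rho> f = (LINT x|lborel. ball_cut \<rho> f x)"

lemma ball_int_add:
  assumes "continuous_on UNIV f" "continuous_on UNIV g"
  shows "ball_int \<rho> (\<lambda>x. f x + g x) = ball_int \<rho> f + ball_int \<rho> g"
proof -
  have "ball_cut \<rho> (\<lambda>x. f x + g x) = (\<lambda>x. ball_cut \<rho> f x + ball_cut \<rho> g x)"
    by (auto simp: ball_cut_def)
  then show ?thesis
    unfolding ball_int_def using assms by (simp add: integrable_ball_cut)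
qed

lemma ball_int_cmult:
  fixes c :: "'b::{real_normed_field, euclidean_space}"
  assumes "continuous_on UNIV f"
  shows "ball_int \<rho> (\<lambda>x. c * f x) = c * ball_int \<rho> f"
proof -
  have "ball_cut \<rho> (\<lambda>x. c * f x) = (\<lambda>x. c * ball_cut \<rho> f x)"
    by (auto simp: ball_cut_def)
  then show ?thesis
    unfolding ball_int_def using assms by (simp add: integrable_ball_cut)
qed

lemma ball_int_sum:
  assumes "\<And>i. i \<in> A \<Longrightarrow> continuous_on UNIV (f i)"
  shows "ball_int \<rho> (\<lambda>x. \<Sum>i\<in>A. f i x) = (\<Sum>i\<in>A. ball_int \<rho> (f i))"
proof -
  have "ball_cut \<rho> (\<lambda>x. \<Sum>i\<in>A. f i x) = (\<lambda>x. \<Sum>i\<in>A. ball_cut \<rho> (f i) x)"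
    by (auto simp: ball_cut_def)
  then show ?thesis
    unfolding ball_int_def using assms by (simp add: integrable_ball_cut)
qed

lemma ball_int_nonneg: "(\<And>x. f x \<ge> (0::real)) \<Longrightarrow> ball_int \<rho> f \<ge> 0"
  unfolding ball_int_def by (rule integral_nonneg_AE) (simp add: ball_cut_def)

lemma ball_int_partial_eq_zero:
  assumes "has_partial i f f'" "continuous_on UNIV f" "continuous_on UNIV f'"
    and "\<And>x. norm x = \<rho> \<Longrightarrow> f x = 0"
  shows "ball_int \<rho> f' = 0"
  unfolding ball_int_def by (rule integral_ball_cut_partial_eq_zero[OF assms])

section \<open>Radial Bessel profiles, their derivatives and the Rayleigh quotient\<close>

definition rad :: "nat \<Rightarrow> real \<Rightarrow> real ^ 'd \<Rightarrow> real" where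
  "rad m \<kappa> x = bessel_E (real CARD('d) / 2 - 1 + real m) (\<kappa> * (x \<bullet> x))"

lemma dim_ge_one: "real CARD('d::finite) \<ge> 1"
  by (simp add: Suc_leI)

text \<open>The inner function \<kappa> |x|^2 contributes 2 \<kappa> x_i and the series raises its
  order. All derivatives of \<open>rad 0\<close> are thus polynomials in x times members of this
  family. The lowest order d/2 - 1 exceeds -1 because d >= 1.\<close>

lemma has_partial_rad:
  "has_partial i (rad m \<kappa> :: real ^ 'd \<Rightarrow> real) (\<lambda>x. - 2 * \<kappa> * (x $ i) * rad (Suc m) \<kappa> x)"
  unfolding has_partial_def
proof
  fix x :: "real ^ 'd"
  let ?\<mu> = "real CARD('d) / 2 - 1 + real m"
  let ?q = "\<lambda>s. \<kappa> * (x \<bullet> x + 2 * s * x $ i + s\<^sup>2)"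
  have \<mu>: "?\<mu> > -1"
    using dim_ge_one[where 'd = 'd] by linarith
  have eq: "\<kappa> * ((x + s *\<^sub>R axis i 1) \<bullet> (x + s *\<^sub>R axis i 1)) = ?q s" for s
    by (simp add: inner_add_left inner_add_right inner_axis inner_axis' power2_eq_square algebra_simps)
  have "(?q has_real_derivative 2 * \<kappa> * (x $ i)) (at 0)"
    by (auto intro!: derivative_eq_intros)
  then have "((\<lambda>s. bessel_E ?\<mu> (?q s)) has_real_derivative
      - bessel_E (?\<mu> + 1) (?q 0) * (2 * \<kappa> * (x $ i))) (at 0)"
    by (intro DERIV_chain2[OF bessel_E_deriv[OF \<mu>]])
  then show "((\<lambda>s. rad m \<kappa> (x + s *\<^sub>R axis i 1)) has_vector_derivative
      - 2 * \<kappa> * (x $ i) * rad (Suc m) \<kappa> x) (at 0)"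
    unfolding rad_def eq by (simp add: has_real_derivative_iff_has_vector_derivative mult_ac add_ac)
qed

lemma continuous_rad: "continuous_on S (rad m \<kappa> :: real ^ 'd \<Rightarrow> real)"
  unfolding rad_def
  by (intro continuous_on_compose2[OF continuous_bessel_E[of _ UNIV]] continuous_intros)
    (auto intro!: add_pos_nonneg)

text \<open>The Bessel equation in radial form. It eliminates the factors |x|^2 that arise when
  second derivatives are summed to a Laplacian.\<close>

lemma rad_recurrence:
  fixes x :: "real ^ 'd"
  shows "\<kappa> * (x \<bullet> x) * rad (Suc (Suc m)) \<kappa> x
    = (real CARD('d) / 2 + real m) * rad (Suc m) \<kappa> x - rad m \<kappa> x"
  using bessel_E_recurrence[of "real CARD('d) / 2 - 1 + real m" "\<kappa> * (x \<bullet> x)"]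
    dim_ge_one[where 'd = 'd]
  by (simp add: rad_def algebra_simps)

text \<open>
  On the ball \<open>bump\<close> is a Neumann eigenfunction of the Laplacian minus its boundary value, so that
  it vanishes on the sphere together with its gradient.
\<close>

definition bump :: "real \<Rightarrow> real \<Rightarrow> real ^ 'd \<Rightarrow> real" where
  "bump c \<rho> x = rad 0 (c / \<rho>\<^sup>2) x - bessel_E (real CARD('d) / 2 - 1) c"

text \<open>\<open>rad 1\<close> has order d/2, and on the sphere its argument is c. The gradient
  therefore vanishes there as soon as c is a zero of \<open>bessel_E\<close> of order d/2.\<close>

definition bump_grad :: "real \<Rightarrow> real \<Rightarrow> 'd \<Rightarrow> real ^ 'd \<Rightarrow> real" where
  "bump_grad c \<rho> i x = - 2 * (c / \<rho>\<^sup>2) * (x $ i) * rad 1 (c / \<rho>\<^sup>2) x"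

text \<open>The combination a g - b . grad g with g = \<open>bump\<close> (see
  \<open>probe_eq\<close>). The gradient is written out so that the result can be differentiated
  twice more.\<close>

definition probe :: "real \<Rightarrow> real \<Rightarrow> real \<Rightarrow> real ^ 'd \<Rightarrow> real ^ 'd \<Rightarrow> real" where
  "probe c \<rho> a b x = a * bump c \<rho> x + 2 * (c / \<rho>\<^sup>2) * ((b \<bullet> x) * rad 1 (c / \<rho>\<^sup>2) x)"

definition probe_grad :: "real \<Rightarrow> real \<Rightarrow> real \<Rightarrow> real ^ 'd \<Rightarrow> 'd \<Rightarrow> real ^ 'd \<Rightarrow> real" where
  "probe_grad c \<rho> a b i x = (let \<kappa> = c / \<rho>\<^sup>2 in
     - 2 * \<kappa> * a * ((x $ i) * rad 1 \<kappa> x) + 2 * \<kappa> * (b $ i) * rad 1 \<kappa> x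
     + - 4 * \<kappa>\<^sup>2 * ((b \<bullet> x) * ((x $ i) * rad 2 \<kappa> x)))"

text \<open>The pure second derivative in direction i; these are the ones that sum to the
  Laplacian.\<close>

definition probe_grad2 :: "real \<Rightarrow> real \<Rightarrow> real \<Rightarrow> real ^ 'd \<Rightarrow> 'd \<Rightarrow> real ^ 'd \<Rightarrow> real" where
  "probe_grad2 c \<rho> a b i x = (let \<kappa> = c / \<rho>\<^sup>2 in
     - 2 * \<kappa> * a * (rad 1 \<kappa> x - 2 * \<kappa> * ((x $ i) * (x $ i)) * rad 2 \<kappa> x)
     - 8 * \<kappa>\<^sup>2 * (b $ i * x $ i) * rad 2 \<kappa> x - 4 * \<kappa>\<^sup>2 * (b \<bullet> x) * rad 2 \<kappa> x
     + 8 * \<kappa> ^ 3 * (b \<bullet> x) * ((x $ i) * (x $ i)) * rad 3 \<kappa> x)"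

lemma has_partial_eq_rhs: "has_partial i f f' \<Longrightarrow> (\<And>x. f' x = g x) \<Longrightarrow> has_partial i f g"
  by (simp add: has_partial_def)

lemma has_partial_bump: "has_partial i (bump c \<rho>) (bump_grad c \<rho> i)"
proof -
  have "has_partial i (\<lambda>x. rad 0 (c / \<rho>\<^sup>2) x + - bessel_E (real CARD('a) / 2 - 1) c)
      (\<lambda>x :: real ^ 'a. - 2 * (c / \<rho>\<^sup>2) * (x $ i) * rad (Suc 0) (c / \<rho>\<^sup>2) x + 0)"
    by (intro has_partial_add has_partial_const has_partial_rad)
  then show ?thesis
    by (simp add: has_partial_def bump_def bump_grad_def)
qed

lemma continuous_bump: "continuous_on S (bump c \<rho>)"
  unfolding bump_def by (intro continuous_intros continuous_rad)

lemma continuous_bump_grad: "continuous_on S (bump_grad c \<rho> i)"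
  unfolding bump_grad_def by (intro continuous_intros continuous_rad)

lemma has_partial_probe: "has_partial i (probe c \<rho> a b) (probe_grad c \<rho> a b i)"
  unfolding probe_def
  by (rule has_partial_eq_rhs[OF has_partial_add[OF has_partial_cmult[OF has_partial_bump]
        has_partial_cmult[OF has_partial_mult[OF has_partial_inner has_partial_rad]]]])
    (simp add: probe_grad_def bump_grad_def Let_def algebra_simps power2_eq_square eval_nat_numeral)

lemma has_partial_probe_grad: "has_partial i (probe_grad c \<rho> a b i) (probe_grad2 c \<rho> a b i)"
  unfolding probe_grad_def Let_def
  by (rule has_partial_eq_rhs[OF has_partial_add[OF has_partial_add[OF
          has_partial_cmult[OF has_partial_mult[OF has_partial_component has_partial_rad]]
          has_partial_cmult[OF has_partial_rad]]
          has_partial_cmult[OF has_partial_mult[OF has_partial_inner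
            has_partial_mult[OF has_partial_component has_partial_rad]]]]])
    (simp add: probe_grad2_def Let_def algebra_simps power2_eq_square power3_eq_cube eval_nat_numeral)

lemma continuous_probe: "continuous_on S (probe c \<rho> a b)"
  unfolding probe_def by (intro continuous_intros continuous_rad continuous_bump)

lemma continuous_probe_grad: "continuous_on S (probe_grad c \<rho> a b i)"
  unfolding probe_grad_def Let_def by (intro continuous_intros continuous_rad)

lemma continuous_probe_grad2: "continuous_on S (probe_grad2 c \<rho> a b i)"
  unfolding probe_grad2_def Let_def by (intro continuous_intros continuous_rad)

text \<open>\<open>rad 0\<close> and its partial derivatives are eigenfunctions for -4 \<kappa>; the
  constant subtracted in \<open>bump\<close> leaves the term with a. The recurrence at orders m = 0
  and m = 1 removes |x|^2 \<open>rad 2\<close> and |x|^2 \<open>rad 3\<close>.\<close>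

lemma probe_laplacian:
  fixes x b :: "real ^ 'd"
  shows "(\<Sum>i\<in>UNIV. probe_grad2 c \<rho> a b i x)
    = - 4 * (c / \<rho>\<^sup>2) * (probe c \<rho> a b x + a * bessel_E (real CARD('d) / 2 - 1) c)"
proof -
  define \<kappa> where "\<kappa> = c / \<rho>\<^sup>2"
  define d where "d = real CARD('d)"
  have r2: "\<kappa> * (x \<bullet> x) * rad 2 \<kappa> x = d / 2 * rad 1 \<kappa> x - rad 0 \<kappa> x"
    using rad_recurrence[of \<kappa> x 0] by (simp add: d_def eval_nat_numeral)
  have r3: "\<kappa> * (x \<bullet> x) * rad 3 \<kappa> x = (d / 2 + 1) * rad 2 \<kappa> x - rad 1 \<kappa> x"
    using rad_recurrence[of \<kappa> x 1] by (simp add: d_def eval_nat_numeral)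
  have xx: "(\<Sum>i\<in>UNIV. x $ i * x $ i) = x \<bullet> x" and bx: "(\<Sum>i\<in>UNIV. b $ i * x $ i) = b \<bullet> x"
    by (simp_all add: inner_vec_def)
  have "(\<Sum>i\<in>UNIV. probe_grad2 c \<rho> a b i x) =
      - 2 * \<kappa> * a * (d * rad 1 \<kappa> x - 2 * \<kappa> * (\<Sum>i\<in>UNIV. x $ i * x $ i) * rad 2 \<kappa> x)
      - 8 * \<kappa>\<^sup>2 * (\<Sum>i\<in>UNIV. b $ i * x $ i) * rad 2 \<kappa> x - d * (4 * \<kappa>\<^sup>2 * (b \<bullet> x) * rad 2 \<kappa> x)
      + 8 * \<kappa> ^ 3 * (b \<bullet> x) * (\<Sum>i\<in>UNIV. x $ i * x $ i) * rad 3 \<kappa> x"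
    unfolding probe_grad2_def Let_def \<kappa>_def[symmetric] sum.distrib sum_subtractf
    by (simp add: d_def sum_subtractf sum_negf flip: sum_distrib_left sum_distrib_right)
  also have "\<dots> = - 2 * \<kappa> * a * (d * rad 1 \<kappa> x - 2 * (\<kappa> * (x \<bullet> x) * rad 2 \<kappa> x))
      - 8 * \<kappa>\<^sup>2 * (b \<bullet> x) * rad 2 \<kappa> x - d * (4 * \<kappa>\<^sup>2 * (b \<bullet> x) * rad 2 \<kappa> x)
      + 8 * \<kappa>\<^sup>2 * (b \<bullet> x) * (\<kappa> * (x \<bullet> x) * rad 3 \<kappa> x)"
    unfolding xx bx by (simp add: algebra_simps power2_eq_square power3_eq_cube)
  also have "\<dots> = - 4 * \<kappa> * (a * rad 0 \<kappa> x + 2 * \<kappa> * ((b \<bullet> x) * rad 1 \<kappa> x))"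
    unfolding r2 r3 by (simp add: algebra_simps power2_eq_square)
  finally show ?thesis
    by (simp add: probe_def bump_def \<kappa>_def algebra_simps)
qed

lemma rad_sphere:
  fixes x :: "real ^ 'd"
  assumes "norm x = \<rho>" "\<rho> > 0"
  shows "rad m (c / \<rho>\<^sup>2) x = bessel_E (real CARD('d) / 2 - 1 + real m) c"
  using assms by (simp add: rad_def dot_square_norm)

lemma bump_sphere: "norm x = \<rho> \<Longrightarrow> \<rho> > 0 \<Longrightarrow> bump c \<rho> x = 0"
  by (simp add: bump_def rad_sphere)

lemma probe_sphere:
  fixes x :: "real ^ 'd"
  assumes "bessel_E (real CARD('d) / 2) c = 0"
  shows "norm x = \<rho> \<Longrightarrow> \<rho> > 0 \<Longrightarrow> probe c \<rho> a b x = 0"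
  using assms by (simp add: probe_def bump_sphere rad_sphere)

lemma probe_eq: "probe c \<rho> a b x = a * bump c \<rho> x + - (\<Sum>i\<in>UNIV. b $ i * bump_grad c \<rho> i x)"
proof -
  have "(\<Sum>i\<in>UNIV. b $ i * bump_grad c \<rho> i x) = - 2 * (c / \<rho>\<^sup>2) * rad 1 (c / \<rho>\<^sup>2) x * (\<Sum>i\<in>UNIV. b $ i * x $ i)"
    unfolding bump_grad_def sum_distrib_left by (intro sum.cong refl) (simp add: algebra_simps)
  then show ?thesis
    by (simp add: probe_def inner_vec_def algebra_simps)
qed

lemma ball_int_bump_grad: "\<rho> > 0 \<Longrightarrow> ball_int \<rho> (bump_grad c \<rho> i) = 0"
  by (rule ball_int_partial_eq_zero[OF has_partial_bump continuous_bump continuous_bump_grad])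
    (rule bump_sphere)

text \<open>The integrand is half a partial derivative of the square of \<open>bump\<close>, which
  is 0 on the sphere.\<close>

lemma ball_int_bump_mult_bump_grad:
  assumes "\<rho> > 0"
  shows "ball_int \<rho> (\<lambda>x. bump c \<rho> x * bump_grad c \<rho> i x) = 0"
proof -
  have "ball_int \<rho> (\<lambda>x. bump c \<rho> x * bump_grad c \<rho> i x + bump_grad c \<rho> i x * bump c \<rho> x) = 0"
    using assms
    by (intro ball_int_partial_eq_zero[OF has_partial_mult[OF has_partial_bump has_partial_bump]]
        continuous_intros continuous_bump continuous_bump_grad) (simp add: bump_sphere)
  also have "(\<lambda>x. bump c \<rho> x * bump_grad c \<rho> i x + bump_grad c \<rho> i x * bump c \<rho> x)
      = (\<lambda>x. 2 * (bump c \<rho> x * bump_grad c \<rho> i x))"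
    by auto
  finally show ?thesis
    by (simp add: ball_int_cmult continuous_on_mult continuous_bump continuous_bump_grad)
qed

text \<open>The cross terms are multiples of integrals of g times a partial derivative of g, all of
  which are 0. The parts belonging to a and to b can therefore be bounded below separately.\<close>

lemma ball_int_probe_square:
  fixes b :: "real ^ 'd"
  assumes "\<rho> > 0"
  shows "ball_int \<rho> (\<lambda>x. (probe c \<rho> a b x)\<^sup>2)
    = a\<^sup>2 * ball_int \<rho> (\<lambda>x :: real ^ 'd. (bump c \<rho> x)\<^sup>2) + ball_int \<rho> (\<lambda>x. (probe c \<rho> 0 b x)\<^sup>2)"
proof -
  have "(\<lambda>x. (probe c \<rho> a b x)\<^sup>2) = (\<lambda>x. a\<^sup>2 * (bump c \<rho> x)\<^sup>2 + (probe c \<rho> 0 b x)\<^sup>2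
      + (\<Sum>i\<in>UNIV. - 2 * a * b $ i * (bump c \<rho> x * bump_grad c \<rho> i x)))"
  proof
    fix x
    have "(\<Sum>i\<in>UNIV. - 2 * a * b $ i * (bump c \<rho> x * bump_grad c \<rho> i x))
        = 2 * a * bump c \<rho> x * probe c \<rho> 0 b x"
      unfolding probe_eq by (simp add: sum_distrib_left sum_negf algebra_simps)
    moreover have "probe c \<rho> a b x = a * bump c \<rho> x + probe c \<rho> 0 b x"
      by (simp add: probe_def)
    ultimately show "(probe c \<rho> a b x)\<^sup>2 = a\<^sup>2 * (bump c \<rho> x)\<^sup>2 + (probe c \<rho> 0 b x)\<^sup>2
      + (\<Sum>i\<in>UNIV. - 2 * a * b $ i * (bump c \<rho> x * bump_grad c \<rho> i x))"
      by (simp add: power2_eq_square algebra_simps)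
  qed
  moreover have "ball_int \<rho> (\<lambda>x. a\<^sup>2 * (bump c \<rho> x)\<^sup>2 + (probe c \<rho> 0 b x)\<^sup>2
      + (\<Sum>i\<in>UNIV. - 2 * a * b $ i * (bump c \<rho> x * bump_grad c \<rho> i x)))
    = ball_int \<rho> (\<lambda>x :: real ^ 'd. a\<^sup>2 * (bump c \<rho> x)\<^sup>2) + ball_int \<rho> (\<lambda>x. (probe c \<rho> 0 b x)\<^sup>2)
      + ball_int \<rho> (\<lambda>x. \<Sum>i\<in>UNIV. - 2 * a * b $ i * (bump c \<rho> x * bump_grad c \<rho> i x))"
    by (rule trans[OF ball_int_add arg_cong2[where f = "(+)", OF ball_int_add refl]];
        intro continuous_intros continuous_bump continuous_bump_grad continuous_probe)
  moreover have "ball_int \<rho> (\<lambda>x :: real ^ 'd. a\<^sup>2 * (bump c \<rho> x)\<^sup>2) = a\<^sup>2 * ball_int \<rho> (\<lambda>x :: real ^ 'd. (bump c \<rho> x)\<^sup>2)"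
    by (intro ball_int_cmult continuous_intros continuous_bump)
  moreover have "ball_int \<rho> (\<lambda>x. \<Sum>i\<in>UNIV. - 2 * a * b $ i * (bump c \<rho> x * bump_grad c \<rho> i x))
      = (\<Sum>i\<in>UNIV. ball_int \<rho> (\<lambda>x. - 2 * a * b $ i * (bump c \<rho> x * bump_grad c \<rho> i x)))"
    by (intro ball_int_sum continuous_intros continuous_bump continuous_bump_grad)
  moreover have "ball_int \<rho> (\<lambda>x. - 2 * a * b $ i * (bump c \<rho> x * bump_grad c \<rho> i x)) = 0" for i
    using assms by (subst ball_int_cmult)
      (intro continuous_intros continuous_bump continuous_bump_grad, simp add: ball_int_bump_mult_bump_grad)
  ultimately show ?thesis
    by simp
qed

text \<open>Put u = \<open>probe\<close> and let A be the constant subtracted in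
  \<open>bump\<close>. Green's formula with Laplacian -4 \<kappa> (u + a A) gives the claimed
  right-hand side plus 4 \<kappa> a A times the integral of u. Derivatives of g integrate to 0, so
  that integral is a times the one of g, which equals -A times the volume of the ball. The surplus
  is thus -4 \<kappa> (a A)^2 times the volume, hence not positive.\<close>

lemma probe_rayleigh:
  fixes b :: "real ^ 'd"
  assumes \<rho>: "\<rho> > 0" and c: "c > 0" "bessel_E (real CARD('d) / 2) c = 0"
  shows "(\<Sum>i\<in>UNIV. ball_int \<rho> (\<lambda>x. (probe_grad c \<rho> a b i x)\<^sup>2))
    \<le> 4 * (c / \<rho>\<^sup>2) * ball_int \<rho> (\<lambda>x. (probe c \<rho> a b x)\<^sup>2)"
proof -
  define \<kappa> where "\<kappa> = c / \<rho>\<^sup>2"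
  define A where "A = bessel_E (real CARD('d) / 2 - 1) c"
  have \<kappa>: "\<kappa> > 0" using \<rho> c by (simp add: \<kappa>_def)
  note cont = continuous_intros continuous_bump continuous_bump_grad continuous_probe
    continuous_probe_grad continuous_probe_grad2
  have green: "ball_int \<rho> (\<lambda>x. (probe_grad c \<rho> a b i x)\<^sup>2)
      = - ball_int \<rho> (\<lambda>x. probe c \<rho> a b x * probe_grad2 c \<rho> a b i x)" for i
  proof -
    have "ball_int \<rho> (\<lambda>x. probe c \<rho> a b x * probe_grad2 c \<rho> a b i x
        + probe_grad c \<rho> a b i x * probe_grad c \<rho> a b i x) = 0"
      using \<rho> c by (intro ball_int_partial_eq_zero[OF has_partial_mult[OF has_partial_probe has_partial_probe_grad]]
          cont) (simp add: probe_sphere)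
    then show ?thesis
      by (subst (asm) ball_int_add) (intro cont, intro cont, simp add: power2_eq_square)
  qed
  have "(\<Sum>i\<in>UNIV. ball_int \<rho> (\<lambda>x. (probe_grad c \<rho> a b i x)\<^sup>2))
      = - (\<Sum>i\<in>UNIV. ball_int \<rho> (\<lambda>x. probe c \<rho> a b x * probe_grad2 c \<rho> a b i x))"
    by (simp add: green sum_negf)
  also have "(\<Sum>i\<in>UNIV. ball_int \<rho> (\<lambda>x. probe c \<rho> a b x * probe_grad2 c \<rho> a b i x))
      = ball_int \<rho> (\<lambda>x. \<Sum>i\<in>UNIV. probe c \<rho> a b x * probe_grad2 c \<rho> a b i x)"
    by (intro ball_int_sum[symmetric] cont)
  also have "(\<lambda>x. \<Sum>i\<in>UNIV. probe c \<rho> a b x * probe_grad2 c \<rho> a b i x)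
      = (\<lambda>x. (- 4 * \<kappa>) * (probe c \<rho> a b x)\<^sup>2 + (- 4 * \<kappa> * a * A) * probe c \<rho> a b x)"
    unfolding sum_distrib_left[symmetric] probe_laplacian A_def[symmetric] \<kappa>_def[symmetric]
    by (simp add: algebra_simps power2_eq_square)
  also have "ball_int \<rho> \<dots> = ball_int \<rho> (\<lambda>x. (- 4 * \<kappa>) * (probe c \<rho> a b x)\<^sup>2)
      + ball_int \<rho> (\<lambda>x. (- 4 * \<kappa> * a * A) * probe c \<rho> a b x)"
    by (intro ball_int_add cont)
  also have "ball_int \<rho> (\<lambda>x. (- 4 * \<kappa>) * (probe c \<rho> a b x)\<^sup>2)
      = (- 4 * \<kappa>) * ball_int \<rho> (\<lambda>x. (probe c \<rho> a b x)\<^sup>2)"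
    by (intro ball_int_cmult cont)
  also have "ball_int \<rho> (\<lambda>x. (- 4 * \<kappa> * a * A) * probe c \<rho> a b x)
      = (- 4 * \<kappa> * a * A) * ball_int \<rho> (probe c \<rho> a b)"
    by (intro ball_int_cmult cont)
  finally have eq: "(\<Sum>i\<in>UNIV. ball_int \<rho> (\<lambda>x. (probe_grad c \<rho> a b i x)\<^sup>2))
      = 4 * \<kappa> * ball_int \<rho> (\<lambda>x. (probe c \<rho> a b x)\<^sup>2) + 4 * \<kappa> * (a * A * ball_int \<rho> (probe c \<rho> a b))"
    by (simp add: algebra_simps)

  have mean: "ball_int \<rho> (probe c \<rho> a b) = a * ball_int \<rho> (bump c \<rho> :: real ^ 'd \<Rightarrow> real)" for a and b :: "real ^ 'd"
  proof -
    have "probe c \<rho> a b = (\<lambda>x. a * bump c \<rho> x + (\<Sum>i\<in>UNIV. (- b $ i) * bump_grad c \<rho> i x))"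
      by (rule ext) (simp add: probe_eq sum_negf)
    then have "ball_int \<rho> (probe c \<rho> a b)
        = ball_int \<rho> (\<lambda>x. a * bump c \<rho> x + (\<Sum>i\<in>UNIV. (- b $ i) * bump_grad c \<rho> i x))"
      by simp
    also have "\<dots> = ball_int \<rho> (\<lambda>x :: real ^ 'd. a * bump c \<rho> x)
        + ball_int \<rho> (\<lambda>x. \<Sum>i\<in>UNIV. (- b $ i) * bump_grad c \<rho> i x)"
      by (intro ball_int_add cont)
    also have "ball_int \<rho> (\<lambda>x :: real ^ 'd. a * bump c \<rho> x) = a * ball_int \<rho> (bump c \<rho> :: real ^ 'd \<Rightarrow> real)"
      by (intro ball_int_cmult cont)
    also have "ball_int \<rho> (\<lambda>x. \<Sum>i\<in>UNIV. (- b $ i) * bump_grad c \<rho> i x)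
        = (\<Sum>i\<in>UNIV. ball_int \<rho> (\<lambda>x. (- b $ i) * bump_grad c \<rho> i x))"
      by (intro ball_int_sum cont)
    also have "\<dots> = (\<Sum>i\<in>UNIV. (- b $ i) * ball_int \<rho> (bump_grad c \<rho> i))"
      by (intro sum.cong refl ball_int_cmult cont)
    finally show ?thesis
      using \<rho> by (simp add: ball_int_bump_grad)
  qed
  have "ball_int \<rho> (bump c \<rho> :: real ^ 'd \<Rightarrow> real) = - A * ball_int \<rho> (\<lambda>x :: real ^ 'd. 1)"
  proof -
    \<comment> \<open>The flux of grad g through the sphere is 0, because c makes the gradient
      vanish there. This fixes the mean of g.\<close>
    have "ball_int \<rho> (probe_grad2 c \<rho> 1 0 i) = 0" for i :: 'd
    proof (rule ball_int_partial_eq_zero[OF has_partial_probe_grad continuous_probe_grad continuous_probe_grad2])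
      fix x :: "real ^ 'd" assume "norm x = \<rho>"
      then show "probe_grad c \<rho> 1 0 i x = 0"
        using \<rho> c by (simp add: probe_grad_def Let_def rad_sphere)
    qed
    then have "0 = (\<Sum>i\<in>UNIV. ball_int \<rho> (probe_grad2 c \<rho> 1 (0 :: real ^ 'd) i))"
      by simp
    also have "\<dots> = ball_int \<rho> (\<lambda>x. \<Sum>i\<in>UNIV. probe_grad2 c \<rho> 1 (0 :: real ^ 'd) i x)"
      by (intro ball_int_sum[symmetric] cont)
    also have "(\<lambda>x. \<Sum>i\<in>UNIV. probe_grad2 c \<rho> 1 (0 :: real ^ 'd) i x)
        = (\<lambda>x. (- 4 * \<kappa>) * (probe c \<rho> 1 0 x + A * 1))"
      unfolding probe_laplacian A_def[symmetric] \<kappa>_def[symmetric] by simp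
    also have "ball_int \<rho> \<dots> = (- 4 * \<kappa>) * ball_int \<rho> (\<lambda>x :: real ^ 'd. probe c \<rho> 1 0 x + A * 1)"
      by (intro ball_int_cmult cont)
    also have "ball_int \<rho> (\<lambda>x :: real ^ 'd. probe c \<rho> 1 0 x + A * 1)
        = ball_int \<rho> (probe c \<rho> 1 (0 :: real ^ 'd)) + ball_int \<rho> (\<lambda>x :: real ^ 'd. A * 1)"
      by (intro ball_int_add cont)
    also have "ball_int \<rho> (\<lambda>x :: real ^ 'd. A * 1) = A * ball_int \<rho> (\<lambda>x :: real ^ 'd. 1)"
      by (intro ball_int_cmult cont)
    finally show ?thesis
      using \<kappa> by (simp add: mean)
  qed
  then have "a * A * ball_int \<rho> (probe c \<rho> a b) = - ((a * A)\<^sup>2 * ball_int \<rho> (\<lambda>x :: real ^ 'd. 1))"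
    by (simp add: mean power2_eq_square algebra_simps)
  moreover have "(a * A)\<^sup>2 * ball_int \<rho> (\<lambda>x :: real ^ 'd. 1) \<ge> 0"
    by (intro mult_nonneg_nonneg ball_int_nonneg) auto
  ultimately have "4 * \<kappa> * (a * A * ball_int \<rho> (probe c \<rho> a b)) \<le> 0"
    using \<kappa> by (intro mult_nonneg_nonpos[of "4 * \<kappa>"]) auto
  then show ?thesis
    using eq by (simp add: \<kappa>_def)
qed

section \<open>Lower bounds for the norms of probes\<close>

lemma ball_int_lower_bound:
  fixes f :: "real ^ 'd \<Rightarrow> real"
  assumes "continuous_on UNIV f" "\<And>x. f x \<ge> 0" "m \<ge> 0" "r > 0"
    and sub: "ball x0 r \<subseteq> ball 0 \<rho>" and lower: "\<And>x. x \<in> ball x0 r \<Longrightarrow> f x \<ge> m"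
  shows "ball_int \<rho> f \<ge> m * (unit_ball_vol (real CARD('d)) * r ^ CARD('d))"
proof -
  have fin: "emeasure lborel (ball x0 r) < \<infinity>"
    by (rule emeasure_lborel_ball_finite)
  have "m * (unit_ball_vol (real CARD('d)) * r ^ CARD('d)) = m * measure lborel (ball x0 r)"
    using content_ball[of r x0] \<open>r > 0\<close> by simp
  also have "\<dots> = (LINT x|lborel. m * indicator (ball x0 r) x)"
    using fin by simp
  also have "\<dots> \<le> ball_int \<rho> f"
    unfolding ball_int_def
  proof (rule integral_mono)
    show "integrable lborel (\<lambda>x. m * indicator (ball x0 r) x)"
      using fin by (intro integrable_mult_right integrable_real_indicator) auto
    show "m * indicator (ball x0 r) x \<le> ball_cut \<rho> f x" for x
      using lower[of x] sub assms(2)[of x] by (auto simp: indicator_def ball_cut_def subset_iff)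
  qed (rule integrable_ball_cut[OF assms(1)])
  finally show ?thesis .
qed

text \<open>Near the point at distance 2 \<delta> \<rho> from the origin in direction b, the product
  b . x is at least \<delta> \<rho> |b| and \<open>rad 1\<close> stays above half its central value.
  All lengths scale with \<rho>, so the constant depends on c and the dimension alone.\<close>

lemma probe_zero_lower_bound:
  assumes "c > 0"
  shows "\<exists>C>0. \<forall>\<rho>>0. \<forall>b :: real ^ 'd.
    ball_int \<rho> (\<lambda>x. (probe c \<rho> 0 b x)\<^sup>2) \<ge> C * \<rho> ^ CARD('d) * ((norm b)\<^sup>2 / \<rho>\<^sup>2)"
proof -
  let ?E = "\<lambda>w. bessel_E (real CARD('d) / 2) (c * w)"
  define \<eta> where "\<eta> = ?E 0 / 2"
  have \<eta>: "\<eta> > 0"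
    by (simp add: \<eta>_def bessel_E_zero Gamma_real_pos)
  have "continuous_on UNIV ?E"
    by (intro continuous_on_compose2[OF continuous_bessel_E[of _ UNIV]] continuous_intros) auto
  then have "isCont ?E 0"
    by (simp add: continuous_on_eq_continuous_at)
  then obtain \<delta>0 where \<delta>0: "\<delta>0 > 0" "\<And>w. dist w 0 < \<delta>0 \<Longrightarrow> dist (?E w) (?E 0) < \<eta>"
    using \<eta> unfolding continuous_at_eps_delta by blast
  have large: "?E w \<ge> \<eta>" if "0 \<le> w" "w < \<delta>0" for w
  proof -
    have "dist (?E w) (?E 0) < \<eta>"
      using that by (intro \<delta>0) (simp add: dist_real_def)
    then have "?E 0 - ?E w < \<eta>"
      unfolding dist_real_def by linarith
    moreover have "?E 0 = 2 * \<eta>"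
      by (simp add: \<eta>_def)
    ultimately show ?thesis by linarith
  qed
  \<comment> \<open>The points used below have norm less than 4 \<delta> \<rho>. The bound 4
    \<delta> <= 1 keeps them inside the ball, and (4 \<delta>)^2 <= \<delta>0 keeps the profile
    above \<eta>.\<close>
  define \<delta> where "\<delta> = min 1 (sqrt \<delta>0) / 4"
  have \<delta>: "\<delta> > 0" "4 * \<delta> \<le> 1" "(4 * \<delta>)\<^sup>2 \<le> \<delta>0"
  proof -
    have "(4 * \<delta>)\<^sup>2 \<le> (sqrt \<delta>0)\<^sup>2"
      using \<delta>0 by (intro power_mono) (auto simp: \<delta>_def)
    then show "(4 * \<delta>)\<^sup>2 \<le> \<delta>0" using \<delta>0 by simp
  qed (use \<delta>0 in \<open>auto simp: \<delta>_def\<close>)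
  define V where "V = unit_ball_vol (real CARD('d))"
  have V: "V > 0" by (simp add: V_def)
  define C where "C = (2 * c * \<delta> * \<eta>)\<^sup>2 * (V * \<delta> ^ CARD('d))"
  have "C > 0"
    using assms \<delta> \<eta> V by (simp add: C_def)
  moreover have "ball_int \<rho> (\<lambda>x. (probe c \<rho> 0 b x)\<^sup>2) \<ge> C * \<rho> ^ CARD('d) * ((norm b)\<^sup>2 / \<rho>\<^sup>2)"
    if \<rho>: "\<rho> > 0" for \<rho> and b :: "real ^ 'd"
  proof (cases "b = 0")
    case False
    define x0 where "x0 = (2 * \<delta> * \<rho> / norm b) *\<^sub>R b"
    have nx0: "norm x0 = 2 * \<delta> * \<rho>"
      using False \<delta> \<rho> by (simp add: x0_def)
    have small: "norm x < 4 * \<delta> * \<rho>" if "x \<in> ball x0 (\<delta> * \<rho>)" for x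
    proof -
      have "norm x \<le> norm x0 + norm (x0 - x)"
        by norm
      also have "\<dots> < 2 * \<delta> * \<rho> + \<delta> * \<rho>"
        using that nx0 by (simp add: dist_norm)
      also have "\<dots> \<le> 4 * \<delta> * \<rho>"
        using \<delta> \<rho> by simp
      finally show ?thesis .
    qed
    have four: "4 * \<delta> * \<rho> \<le> \<rho>"
      using \<delta> \<rho> by simp
    have "ball_int \<rho> (\<lambda>x. (probe c \<rho> 0 b x)\<^sup>2)
      \<ge> (2 * (c / \<rho>\<^sup>2) * (norm b * \<delta> * \<rho> * \<eta>))\<^sup>2 * (unit_ball_vol (real CARD('d)) * (\<delta> * \<rho>) ^ CARD('d))"
    proof (rule ball_int_lower_bound)
      show "ball x0 (\<delta> * \<rho>) \<subseteq> ball 0 \<rho>"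
        using small four by fastforce
      fix x assume x: "x \<in> ball x0 (\<delta> * \<rho>)"
      have "b \<bullet> x = b \<bullet> x0 - b \<bullet> (x0 - x)"
        by (simp add: inner_diff_right)
      also have "b \<bullet> x0 = norm b * (2 * \<delta> * \<rho>)"
        using False by (simp add: x0_def dot_square_norm power2_eq_square)
      finally have "b \<bullet> x \<ge> norm b * (2 * \<delta> * \<rho>) - norm b * norm (x0 - x)"
        using norm_cauchy_schwarz[of b "x0 - x"] by linarith
      moreover have "norm b * norm (x0 - x) \<le> norm b * (\<delta> * \<rho>)"
        using x by (intro mult_left_mono) (auto simp: dist_norm)
      ultimately have bx: "b \<bullet> x \<ge> norm b * \<delta> * \<rho>"
        by (simp add: algebra_simps)
      have "rad 1 (c / \<rho>\<^sup>2) x = ?E ((norm x)\<^sup>2 / \<rho>\<^sup>2)"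
        by (simp add: rad_def dot_square_norm)
      moreover have "(norm x)\<^sup>2 / \<rho>\<^sup>2 < \<delta>0"
      proof -
        have "(norm x)\<^sup>2 < (4 * \<delta> * \<rho>)\<^sup>2"
          using small[OF x] by (intro power_strict_mono) auto
        also have "\<dots> \<le> \<delta>0 * \<rho>\<^sup>2"
          using \<delta>(3) by (simp add: power_mult_distrib mult_right_mono)
        finally show ?thesis
          using \<rho> by (simp add: pos_divide_less_eq)
      qed
      ultimately have r: "rad 1 (c / \<rho>\<^sup>2) x \<ge> \<eta>"
        using large[of "(norm x)\<^sup>2 / \<rho>\<^sup>2"] by simp
      have "norm b * \<delta> * \<rho> * \<eta> \<le> (b \<bullet> x) * rad 1 (c / \<rho>\<^sup>2) x"
        using bx r \<delta> \<rho> \<eta> by (intro mult_mono) (auto intro: order_trans[OF _ bx])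
      then have "2 * (c / \<rho>\<^sup>2) * (norm b * \<delta> * \<rho> * \<eta>) \<le> probe c \<rho> 0 b x"
        unfolding probe_def using assms \<rho> mult_left_mono[of _ _ "2 * (c / \<rho>\<^sup>2)"] by simp
      moreover have "0 \<le> 2 * (c / \<rho>\<^sup>2) * (norm b * \<delta> * \<rho> * \<eta>)"
        using assms \<rho> \<delta> \<eta> by simp
      ultimately show "(probe c \<rho> 0 b x)\<^sup>2 \<ge> (2 * (c / \<rho>\<^sup>2) * (norm b * \<delta> * \<rho> * \<eta>))\<^sup>2"
        by (intro power_mono)
    qed (use \<rho> \<delta> in \<open>auto intro!: continuous_intros continuous_probe\<close>)
    also have "(2 * (c / \<rho>\<^sup>2) * (norm b * \<delta> * \<rho> * \<eta>))\<^sup>2 * (unit_ball_vol (real CARD('d)) * (\<delta> * \<rho>) ^ CARD('d))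
        = C * \<rho> ^ CARD('d) * ((norm b)\<^sup>2 / \<rho>\<^sup>2)"
      using \<rho> by (simp add: C_def V_def power_mult_distrib power_divide power2_eq_square field_simps)
    finally show ?thesis .
  qed (simp add: ball_int_nonneg)
  ultimately show ?thesis by blast
qed

text \<open>For the part with a, the Rayleigh bound is read backwards: a partial derivative of g is,
  up to sign, a probe with a = 0, so its norm is already bounded below, and 4 c / \<rho>^2 times the
  squared norm of g dominates it. The factors \<rho>^2 cancel, which explains C / (4 c).\<close>

lemma probe_lower_bound:
  assumes c: "c > 0" "bessel_E (real CARD('d) / 2) c = 0"
  shows "\<exists>C>0. \<forall>\<rho>>0. \<forall>a. \<forall>b :: real ^ 'd.
    ball_int \<rho> (\<lambda>x. (probe c \<rho> a b x)\<^sup>2) \<ge> C * \<rho> ^ CARD('d) * (a\<^sup>2 + (norm b)\<^sup>2 / \<rho>\<^sup>2)"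
proof -
  obtain C where C: "C > 0" "\<And>\<rho> b. \<rho> > 0 \<Longrightarrow>
      ball_int \<rho> (\<lambda>x. (probe c \<rho> 0 b x)\<^sup>2) \<ge> C * \<rho> ^ CARD('d) * ((norm (b :: real ^ 'd))\<^sup>2 / \<rho>\<^sup>2)"
    using probe_zero_lower_bound[OF c(1), where 'd = 'd] by blast
  define C' where "C' = min C (C / (4 * c))"
  have C': "C' > 0" "C' \<le> C" "C' \<le> C / (4 * c)"
    using C c by (auto simp: C'_def)
  have "ball_int \<rho> (\<lambda>x. (probe c \<rho> a b x)\<^sup>2) \<ge> C' * \<rho> ^ CARD('d) * (a\<^sup>2 + (norm b)\<^sup>2 / \<rho>\<^sup>2)"
    if \<rho>: "\<rho> > 0" for \<rho> a and b :: "real ^ 'd"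
  proof -
    have "C / (4 * c) * \<rho> ^ CARD('d) \<le> ball_int \<rho> (\<lambda>x :: real ^ 'd. (bump c \<rho> x)\<^sup>2)"
    proof -
      define i :: 'd where "i = undefined"
      have "C * \<rho> ^ CARD('d) * (1 / \<rho>\<^sup>2) \<le> ball_int \<rho> (\<lambda>x. (probe c \<rho> 0 (axis i 1 :: real ^ 'd) x)\<^sup>2)"
        using C(2)[OF \<rho>, of "axis i 1"] by simp
      also have "(\<lambda>x. (probe c \<rho> 0 (axis i 1 :: real ^ 'd) x)\<^sup>2) = (\<lambda>x. (probe_grad c \<rho> 1 0 i x)\<^sup>2)"
        by (auto simp: probe_def probe_grad_def Let_def inner_axis' power2_eq_square)
      also have "ball_int \<rho> \<dots> \<le> (\<Sum>i\<in>UNIV. ball_int \<rho> (\<lambda>x :: real ^ 'd. (probe_grad c \<rho> 1 0 i x)\<^sup>2))"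
        by (rule member_le_sum) (auto intro: ball_int_nonneg)
      also have "\<dots> \<le> 4 * (c / \<rho>\<^sup>2) * ball_int \<rho> (\<lambda>x :: real ^ 'd. (probe c \<rho> 1 0 x)\<^sup>2)"
        by (rule probe_rayleigh[OF \<rho> c])
      finally show ?thesis
        using \<rho> c by (simp add: probe_def field_simps)
    qed
    then have "C' * \<rho> ^ CARD('d) \<le> ball_int \<rho> (\<lambda>x :: real ^ 'd. (bump c \<rho> x)\<^sup>2)"
      using C' \<rho> by (meson mult_right_mono order_trans zero_le_power less_imp_le)
    then have "C' * \<rho> ^ CARD('d) * a\<^sup>2 \<le> a\<^sup>2 * ball_int \<rho> (\<lambda>x :: real ^ 'd. (bump c \<rho> x)\<^sup>2)"
      by (simp add: mult.commute[of _ "a\<^sup>2"] mult_left_mono)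
    moreover have "C' * \<rho> ^ CARD('d) * ((norm b)\<^sup>2 / \<rho>\<^sup>2) \<le> ball_int \<rho> (\<lambda>x. (probe c \<rho> 0 b x)\<^sup>2)"
      by (rule order_trans[OF mult_right_mono[OF mult_right_mono[OF C'(2)]] C(2)[OF \<rho>]]) (use \<rho> in auto)
    ultimately show ?thesis
      by (subst ball_int_probe_square[OF \<rho>]) (simp add: distrib_left)
  qed
  then show ?thesis
    using C'(1) by blast
qed

section \<open>Fourier transform of the bump\<close>

definition bump_fourier :: "real \<Rightarrow> real \<Rightarrow> real ^ 'd \<Rightarrow> complex" where
  "bump_fourier c \<rho> k = ball_int \<rho> (\<lambda>x. of_real (bump c \<rho> x) * cis (k \<bullet> x))"

text \<open>Integration by parts against the character; g is 0 on the sphere, so there is no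
  boundary term.\<close>

lemma bump_grad_fourier:
  assumes "\<rho> > 0"
  shows "ball_int \<rho> (\<lambda>x. of_real (bump_grad c \<rho> i x) * cis (k \<bullet> x))
    = - \<i> * of_real (k $ i) * bump_fourier c \<rho> k"
proof -
  note cont = continuous_intros continuous_bump continuous_bump_grad
  have "ball_int \<rho> (\<lambda>x. of_real (bump c \<rho> x) * (\<i> * of_real (k $ i) * cis (k \<bullet> x))
      + of_real (bump_grad c \<rho> i x) * cis (k \<bullet> x)) = 0"
    using assms
    by (intro ball_int_partial_eq_zero[OF has_partial_mult[OF has_partial_of_real[OF has_partial_bump] has_partial_cis]]
        cont) (simp add: bump_sphere)
  then have "ball_int \<rho> (\<lambda>x. of_real (bump c \<rho> x) * (\<i> * of_real (k $ i) * cis (k \<bullet> x)))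
      + ball_int \<rho> (\<lambda>x. of_real (bump_grad c \<rho> i x) * cis (k \<bullet> x)) = 0"
    by (subst (asm) ball_int_add) (intro cont, intro cont, simp)
  moreover have "ball_int \<rho> (\<lambda>x. of_real (bump c \<rho> x) * (\<i> * of_real (k $ i) * cis (k \<bullet> x)))
      = \<i> * of_real (k $ i) * bump_fourier c \<rho> k"
  proof -
    have "(\<lambda>x. of_real (bump c \<rho> x) * (\<i> * of_real (k $ i) * cis (k \<bullet> x)))
        = (\<lambda>x. (\<i> * of_real (k $ i)) * (of_real (bump c \<rho> x) * cis (k \<bullet> x)))"
      by (simp add: mult_ac)
    then show ?thesis
      unfolding bump_fourier_def by (simp only:) (intro ball_int_cmult cont)
  qed
  ultimately show ?thesis
    by (simp add: add_eq_0_iff)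
qed

text \<open>\<open>bump\<close> is one fixed profile evaluated at |x|^2 / \<rho>^2, hence bounded
  independently of \<rho>. The volume of the ball supplies the power of \<rho>, uniformly in
  k.\<close>

lemma bump_fourier_bound:
  "\<exists>S>0. \<forall>\<rho>>0. \<forall>k :: real ^ 'd. cmod (bump_fourier c \<rho> k) \<le> S * \<rho> ^ CARD('d)"
proof -
  let ?f = "\<lambda>w. bessel_E (real CARD('d) / 2 - 1) (c * w) - bessel_E (real CARD('d) / 2 - 1) c"
  have "continuous_on UNIV ?f"
    using dim_ge_one[where 'd = 'd]
    by (intro continuous_intros continuous_on_compose2[OF continuous_bessel_E[of _ UNIV]]) auto
  then obtain S where S: "S > 0" "\<And>w. norm w \<le> 1 \<Longrightarrow> norm (?f w) \<le> S"
    using continuous_cball_bound[of ?f 1] by blast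
  define V where "V = unit_ball_vol (real CARD('d))"
  have "V > 0" by (simp add: V_def)
  have "cmod (bump_fourier c \<rho> k) \<le> (S * V) * \<rho> ^ CARD('d)" if \<rho>: "\<rho> > 0" for \<rho> and k :: "real ^ 'd"
  proof -
    have bound: "\<bar>bump c \<rho> x\<bar> \<le> S" if "norm x < \<rho>" for x :: "real ^ 'd"
    proof -
      have "(norm x)\<^sup>2 / \<rho>\<^sup>2 \<le> 1"
        using that \<rho> by (simp add: pos_divide_le_eq power_mono)
      moreover have "bump c \<rho> x = ?f ((norm x)\<^sup>2 / \<rho>\<^sup>2)"
        by (simp add: bump_def rad_def dot_square_norm)
      ultimately show ?thesis
        using S(2)[of "(norm x)\<^sup>2 / \<rho>\<^sup>2"] by simp
    qed
    have fin: "emeasure lborel (ball (0 :: real ^ 'd) \<rho>) < \<infinity>"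
      by (rule emeasure_lborel_ball_finite)
    have "cmod (bump_fourier c \<rho> k)
        \<le> (LINT x|lborel. norm (ball_cut \<rho> (\<lambda>x. of_real (bump c \<rho> x) * cis (k \<bullet> x)) x))"
      unfolding bump_fourier_def ball_int_def by (rule integral_norm_bound)
    also have "\<dots> \<le> (LINT x|lborel. S * indicator (ball (0 :: real ^ 'd) \<rho>) x)"
    proof (rule integral_mono)
      show "integrable lborel (\<lambda>x. norm (ball_cut \<rho> (\<lambda>x. of_real (bump c \<rho> x) * cis (k \<bullet> x)) x))"
        by (intro integrable_norm integrable_ball_cut continuous_intros continuous_bump)
      show "integrable lborel (\<lambda>x. S * indicator (ball (0 :: real ^ 'd) \<rho>) x)"
        using fin by (intro integrable_mult_right integrable_real_indicator) auto
      show "norm (ball_cut \<rho> (\<lambda>x. of_real (bump c \<rho> x) * cis (k \<bullet> x)) x)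
          \<le> S * indicator (ball 0 \<rho>) x" for x
        using bound[of x] by (auto simp: ball_cut_def indicator_def norm_mult)
    qed
    also have "\<dots> = S * measure lborel (ball (0 :: real ^ 'd) \<rho>)"
      using fin by simp
    also have "measure lborel (ball (0 :: real ^ 'd) \<rho>) = V * \<rho> ^ CARD('d)"
      using content_ball[of \<rho> "0 :: real ^ 'd"] \<rho> by (simp add: V_def)
    finally show ?thesis by simp
  qed
  then show ?thesis
    using S(1) \<open>V > 0\<close> by (intro exI[of _ "S * V"]) auto
qed


section \<open>Probes with complex coefficients\<close>

definition cprobe :: "real \<Rightarrow> real \<Rightarrow> complex \<Rightarrow> ('d \<Rightarrow> complex) \<Rightarrow> real ^ 'd \<Rightarrow> complex" where
  "cprobe c \<rho> \<alpha> \<beta> x = of_real (probe c \<rho> (Re \<alpha>) (\<chi> i. Re (\<beta> i)) x)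
     + \<i> * of_real (probe c \<rho> (Im \<alpha>) (\<chi> i. Im (\<beta> i)) x)"

definition cprobe_grad :: "real \<Rightarrow> real \<Rightarrow> complex \<Rightarrow> ('d \<Rightarrow> complex) \<Rightarrow> 'd \<Rightarrow> real ^ 'd \<Rightarrow> complex" where
  "cprobe_grad c \<rho> \<alpha> \<beta> i x = of_real (probe_grad c \<rho> (Re \<alpha>) (\<chi> i. Re (\<beta> i)) i x)
     + \<i> * of_real (probe_grad c \<rho> (Im \<alpha>) (\<chi> i. Im (\<beta> i)) i x)"

lemma has_partial_cprobe: "has_partial i (cprobe c \<rho> \<alpha> \<beta>) (cprobe_grad c \<rho> \<alpha> \<beta> i)"
  unfolding cprobe_def cprobe_grad_def
  by (intro has_partial_add has_partial_cmult has_partial_of_real has_partial_probe)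

lemma continuous_cprobe: "continuous_on S (cprobe c \<rho> \<alpha> \<beta>)"
  unfolding cprobe_def by (intro continuous_intros continuous_probe)

lemma continuous_cprobe_grad: "continuous_on S (cprobe_grad c \<rho> \<alpha> \<beta> i)"
  unfolding cprobe_grad_def by (intro continuous_intros continuous_probe_grad)

lemma cprobe_sphere:
  fixes x :: "real ^ 'd"
  assumes "bessel_E (real CARD('d) / 2) c = 0" "norm x = \<rho>" "\<rho> > 0"
  shows "cprobe c \<rho> \<alpha> \<beta> x = 0"
  using assms by (simp add: cprobe_def probe_sphere)

lemma cmod_of_real_plus_i: "(cmod (of_real a + \<i> * of_real b))\<^sup>2 = a\<^sup>2 + b\<^sup>2"
  by (simp add: cmod_power2)

text \<open>Real and imaginary parts are real probes, so quadratic statements about complex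
  coefficients follow from the real ones by addition.\<close>

lemma ball_int_cmod_cprobe:
  "ball_int \<rho> (\<lambda>x. (cmod (cprobe c \<rho> \<alpha> \<beta> x))\<^sup>2)
    = ball_int \<rho> (\<lambda>x. (probe c \<rho> (Re \<alpha>) (\<chi> i. Re (\<beta> i)) x)\<^sup>2)
      + ball_int \<rho> (\<lambda>x. (probe c \<rho> (Im \<alpha>) (\<chi> i. Im (\<beta> i)) x)\<^sup>2)"
  unfolding cprobe_def cmod_of_real_plus_i
  by (intro ball_int_add continuous_intros continuous_probe)

lemma cprobe_rayleigh:
  assumes \<rho>: "\<rho> > 0" and c: "c > 0" "bessel_E (real CARD('d) / 2) c = 0"
  shows "(\<Sum>i\<in>UNIV. ball_int \<rho> (\<lambda>x :: real ^ 'd. (cmod (cprobe_grad c \<rho> \<alpha> \<beta> i x))\<^sup>2))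
    \<le> 4 * (c / \<rho>\<^sup>2) * ball_int \<rho> (\<lambda>x. (cmod (cprobe c \<rho> \<alpha> \<beta> x))\<^sup>2)"
proof -
  have "ball_int \<rho> (\<lambda>x. (cmod (cprobe_grad c \<rho> \<alpha> \<beta> i x))\<^sup>2)
    = ball_int \<rho> (\<lambda>x. (probe_grad c \<rho> (Re \<alpha>) (\<chi> i. Re (\<beta> i)) i x)\<^sup>2)
      + ball_int \<rho> (\<lambda>x. (probe_grad c \<rho> (Im \<alpha>) (\<chi> i. Im (\<beta> i)) i x)\<^sup>2)" for i
    unfolding cprobe_grad_def cmod_of_real_plus_i
    by (intro ball_int_add continuous_intros continuous_probe_grad)
  then show ?thesis
    unfolding ball_int_cmod_cprobe distrib_left
    by (simp only: sum.distrib) (intro add_mono probe_rayleigh assms)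
qed

lemma cprobe_lower_bound:
  assumes c: "c > 0" "bessel_E (real CARD('d) / 2) c = 0"
  shows "\<exists>C>0. \<forall>\<rho>>0. \<forall>\<alpha> \<beta>. ball_int \<rho> (\<lambda>x :: real ^ 'd. (cmod (cprobe c \<rho> \<alpha> \<beta> x))\<^sup>2)
    \<ge> C * \<rho> ^ CARD('d) * ((cmod \<alpha>)\<^sup>2 + (\<Sum>i\<in>UNIV. (cmod (\<beta> i))\<^sup>2) / \<rho>\<^sup>2)"
proof -
  obtain C where C: "C > 0" "\<And>\<rho> a b. \<rho> > 0 \<Longrightarrow> ball_int \<rho> (\<lambda>x. (probe c \<rho> a (b :: real ^ 'd) x)\<^sup>2)
      \<ge> C * \<rho> ^ CARD('d) * (a\<^sup>2 + (norm b)\<^sup>2 / \<rho>\<^sup>2)"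
    using probe_lower_bound[OF c] by blast
  have "C * \<rho> ^ CARD('d) * ((cmod \<alpha>)\<^sup>2 + (\<Sum>i\<in>UNIV. (cmod (\<beta> i))\<^sup>2) / \<rho>\<^sup>2)
      \<le> ball_int \<rho> (\<lambda>x :: real ^ 'd. (cmod (cprobe c \<rho> \<alpha> \<beta> x))\<^sup>2)"
    if "\<rho> > 0" for \<rho> \<alpha> and \<beta> :: "'d \<Rightarrow> complex"
  proof -
    let ?b1 = "\<chi> i. Re (\<beta> i)" and ?b2 = "\<chi> i. Im (\<beta> i)"
    have eq: "(norm ?b1)\<^sup>2 + (norm ?b2)\<^sup>2 = (\<Sum>i\<in>UNIV. (cmod (\<beta> i))\<^sup>2)"
      by (simp add: norm_vec_def L2_set_def sum_nonneg cmod_power2 sum.distrib)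
    have "C * \<rho> ^ CARD('d) * ((cmod \<alpha>)\<^sup>2 + (\<Sum>i\<in>UNIV. (cmod (\<beta> i))\<^sup>2) / \<rho>\<^sup>2)
      = C * \<rho> ^ CARD('d) * ((Re \<alpha>)\<^sup>2 + (norm ?b1)\<^sup>2 / \<rho>\<^sup>2)
        + C * \<rho> ^ CARD('d) * ((Im \<alpha>)\<^sup>2 + (norm ?b2)\<^sup>2 / \<rho>\<^sup>2)"
      unfolding eq[symmetric] by (simp add: cmod_power2 add_divide_distrib distrib_left)
    then show ?thesis
      unfolding ball_int_cmod_cprobe using C(2)[OF that, of "Re \<alpha>" ?b1] C(2)[OF that, of "Im \<alpha>" ?b2]
      by linarith
  qed
  then show ?thesis
    using C(1) by blast
qed

text \<open>The transform turns minus a partial derivative into multiplication by i k_i, so the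
  transform of g factors out. At frequency -2 pi k the bracket is \<alpha> - 2 pi i (k . \<beta>),
  which is what row k of the matrix makes of the coefficients of one node, up to a
  character.\<close>

lemma cprobe_fourier:
  assumes "\<rho> > 0"
  shows "ball_int \<rho> (\<lambda>x. cprobe c \<rho> \<alpha> \<beta> x * cis (k \<bullet> x))
    = bump_fourier c \<rho> k * (\<alpha> + \<i> * (\<Sum>i\<in>UNIV. of_real (k $ i) * \<beta> i))"
proof -
  note cont = continuous_intros continuous_bump continuous_bump_grad
  have "cprobe c \<rho> \<alpha> \<beta> x * cis (k \<bullet> x) = \<alpha> * (of_real (bump c \<rho> x) * cis (k \<bullet> x))
      + (\<Sum>i\<in>UNIV. - \<beta> i * (of_real (bump_grad c \<rho> i x) * cis (k \<bullet> x)))" for x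
  proof -
    have "cprobe c \<rho> \<alpha> \<beta> x = \<alpha> * of_real (bump c \<rho> x) - (\<Sum>i\<in>UNIV. \<beta> i * of_real (bump_grad c \<rho> i x))"
      unfolding cprobe_def probe_eq by (simp add: complex_eq_iff sum_negf)
    then show ?thesis
      by (simp add: left_diff_distrib right_diff_distrib sum_distrib_left sum_distrib_right sum_negf mult_ac)
  qed
  then have "ball_int \<rho> (\<lambda>x. cprobe c \<rho> \<alpha> \<beta> x * cis (k \<bullet> x))
      = ball_int \<rho> (\<lambda>x. \<alpha> * (of_real (bump c \<rho> x) * cis (k \<bullet> x))
      + (\<Sum>i\<in>UNIV. - \<beta> i * (of_real (bump_grad c \<rho> i x) * cis (k \<bullet> x))))"
    by simp
  also have "\<dots> = ball_int \<rho> (\<lambda>x. \<alpha> * (of_real (bump c \<rho> x) * cis (k \<bullet> x)))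
      + ball_int \<rho> (\<lambda>x. \<Sum>i\<in>UNIV. - \<beta> i * (of_real (bump_grad c \<rho> i x) * cis (k \<bullet> x)))"
    by (intro ball_int_add cont)
  also have "ball_int \<rho> (\<lambda>x. \<alpha> * (of_real (bump c \<rho> x) * cis (k \<bullet> x))) = \<alpha> * bump_fourier c \<rho> k"
    unfolding bump_fourier_def by (intro ball_int_cmult cont)
  also have "ball_int \<rho> (\<lambda>x. \<Sum>i\<in>UNIV. - \<beta> i * (of_real (bump_grad c \<rho> i x) * cis (k \<bullet> x)))
      = (\<Sum>i\<in>UNIV. ball_int \<rho> (\<lambda>x. - \<beta> i * (of_real (bump_grad c \<rho> i x) * cis (k \<bullet> x))))"
    by (intro ball_int_sum cont)
  also have "\<dots> = (\<Sum>i\<in>UNIV. - \<beta> i * ball_int \<rho> (\<lambda>x. of_real (bump_grad c \<rho> i x) * cis (k \<bullet> x)))"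
    by (intro sum.cong refl ball_int_cmult cont)
  finally show ?thesis
    unfolding bump_grad_fourier[OF assms] by (simp add: sum_distrib_left distrib_left mult_ac)
qed

section \<open>Discrete Fourier transform\<close>

definition ivec :: "int ^ 'd \<Rightarrow> real ^ 'd" where
  "ivec j = (\<chi> i. of_int (j $ i))"

text \<open>Odd side length 2 M + 1: a residue system centred at 0. It indexes positions as well as
  frequencies.\<close>

definition int_box :: "nat \<Rightarrow> (int ^ 'd) set" where
  "int_box M = {j. \<forall>i. \<bar>j $ i\<bar> \<le> int M}"

definition periodic_vec :: "int \<Rightarrow> (int ^ 'd \<Rightarrow> 'b) \<Rightarrow> bool" where
  "periodic_vec N f \<longleftrightarrow> (\<forall>j m. (\<forall>i. N dvd m $ i) \<longrightarrow> f (j + m) = f j)"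

lemma ivec_nth [simp]: "ivec j $ i = of_int (j $ i)"
  by (simp add: ivec_def)

lemma ivec_add: "ivec (j + m) = ivec j + ivec m"
  and ivec_diff: "ivec (j - m) = ivec j - ivec m"
  by (simp_all add: vec_eq_iff)

lemma ivec_multiple:
  assumes "\<forall>i. 2 * int M + 1 dvd m $ i"
  shows "\<exists>l. ivec m = (2 * real M + 1) *\<^sub>R ivec l"
proof -
  have "\<forall>i. \<exists>l. m $ i = (2 * int M + 1) * l"
    using assms by (simp add: dvd_def)
  then obtain l where "\<And>i. m $ i = (2 * int M + 1) * l i"
    by metis
  then have "ivec m = (2 * real M + 1) *\<^sub>R ivec (\<chi> i. l i)"
    by (simp add: vec_eq_iff)
  then show ?thesis by blast
qed

lemma inj_ivec: "inj ivec"
  by (auto intro!: injI simp: vec_eq_iff)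

lemma int_lattice_eq_range_ivec: "int_lattice = range ivec"
proof (intro equalityI subsetI)
  fix l :: "real ^ 'd" assume "l \<in> int_lattice"
  then have "l = ivec (\<chi> i. \<lfloor>l $ i\<rfloor>)"
    by (auto simp: int_lattice_def vec_eq_iff elim!: Ints_cases)
  then show "l \<in> range ivec" by blast
qed (auto simp: int_lattice_def)

lemma int_box_eq_image:
  "int_box M = vec_lambda ` (UNIV \<rightarrow>\<^sub>E {- int M..int M})"
proof (intro equalityI subsetI)
  fix j :: "int ^ 'd" assume "j \<in> int_box M"
  then show "j \<in> vec_lambda ` (UNIV \<rightarrow>\<^sub>E {- int M..int M})"
    by (intro image_eqI[of _ _ "vec_nth j"]) (auto simp: int_box_def abs_le_iff minus_le_iff)
qed (auto simp: int_box_def PiE_iff abs_le_iff minus_le_iff)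

lemma finite_int_box [simp]: "finite (int_box M)"
  unfolding int_box_eq_image by (intro finite_imageI finite_PiE) auto

lemma card_int_box: "card (int_box M :: (int ^ 'd) set) = (2 * M + 1) ^ CARD('d)"
proof -
  have "inj_on (vec_lambda :: ('d \<Rightarrow> int) \<Rightarrow> int ^ 'd) S" for S
    by (auto intro!: inj_onI simp: vec_lambda_inject)
  then have "card (int_box M :: (int ^ 'd) set) = card ((UNIV :: 'd set) \<rightarrow>\<^sub>E {- int M..int M})"
    unfolding int_box_eq_image by (simp add: card_image)
  also have "\<dots> = (2 * M + 1) ^ CARD('d)"
    by (simp add: card_PiE nat_add_distrib nat_mult_distrib)
  finally show ?thesis .
qed

text \<open>The box is a complete residue system modulo 2 M + 1 in every coordinate, and a
  translation permutes the classes. The auxiliary r selects the representative in the box.\<close>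

lemma sum_int_box_shift:
  fixes f :: "int ^ 'd \<Rightarrow> 'b::comm_monoid_add"
  assumes "periodic_vec (2 * int M + 1) f"
  shows "(\<Sum>j\<in>int_box M. f (j + v)) = (\<Sum>j\<in>int_box M. f j)"
proof -
  define N where "N = 2 * int M + 1"
  define r where "r a = (a + int M) mod N - int M" for a
  have N: "N > 0" by (simp add: N_def)
  have r_range: "\<bar>r a\<bar> \<le> int M" for a
    using pos_mod_bound[OF N, of "a + int M"] pos_mod_sign[OF N, of "a + int M"]
    by (simp add: r_def N_def abs_le_iff)
  have r_dvd: "N dvd a - r a" for a
    using dvd_minus_mod[of N "a + int M"] by (simp add: r_def algebra_simps)
  have r_id: "r a = b" if "\<bar>b\<bar> \<le> int M" "N dvd a - b" for a b
  proof -
    have "(a + int M) mod N = (b + int M) mod N"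
      using that(2) by (simp add: mod_eq_dvd_iff)
    also have "\<dots> = b + int M"
      using that(1) by (intro mod_pos_pos_trivial) (auto simp: N_def)
    finally show ?thesis by (simp add: r_def)
  qed
  have per: "f a = f b" if "\<And>i. N dvd a $ i - b $ i" for a b
  proof -
    have "f (b + (a - b)) = f b"
      using assms that unfolding periodic_vec_def N_def by (metis vector_minus_component)
    then show ?thesis by simp
  qed
  show ?thesis
  proof (rule sum.reindex_bij_witness[where j = "\<lambda>j. \<chi> i. r ((j + v) $ i)"
        and i = "\<lambda>j. \<chi> i. r ((j - v) $ i)"])
    fix j :: "int ^ 'd" assume j: "j \<in> int_box M"
    have "r (r ((j + v) $ i) - v $ i) = j $ i" for i
    proof (rule r_id)
      show "\<bar>j $ i\<bar> \<le> int M"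
        using j by (simp add: int_box_def)
      show "N dvd r ((j + v) $ i) - v $ i - j $ i"
        using r_dvd[of "(j + v) $ i"] by (subst dvd_minus_iff[symmetric]) (simp add: algebra_simps)
    qed
    then show "(\<chi> i. r (((\<chi> i. r ((j + v) $ i)) - v) $ i)) = j"
      by (simp add: vec_eq_iff)
    have "r (r ((j - v) $ i) + v $ i) = j $ i" for i
    proof (rule r_id)
      show "\<bar>j $ i\<bar> \<le> int M"
        using j by (simp add: int_box_def)
      show "N dvd r ((j - v) $ i) + v $ i - j $ i"
        using r_dvd[of "(j - v) $ i"] by (subst dvd_minus_iff[symmetric]) (simp add: algebra_simps)
    qed
    then show "(\<chi> i. r (((\<chi> i. r ((j - v) $ i)) + v) $ i)) = j"
      by (simp add: vec_eq_iff)
    show "f (\<chi> i. r ((j + v) $ i)) = f (j + v)"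
      using r_dvd by (intro per) (subst dvd_minus_iff[symmetric], simp add: algebra_simps)
  qed (auto simp: int_box_def r_range)
qed

lemma periodic_vec_sum:
  "(\<And>t. t \<in> A \<Longrightarrow> periodic_vec N (f t)) \<Longrightarrow> periodic_vec N (\<lambda>j. \<Sum>t\<in>A. f t j)"
  by (simp add: periodic_vec_def)

lemma periodic_vec_grid:
  assumes "\<And>x l. f (x + ivec l) = f x"
  shows "periodic_vec (2 * int M + 1) (\<lambda>j. f (ivec j /\<^sub>R (2 * real M + 1) - t))"
  unfolding periodic_vec_def
proof (intro allI impI)
  fix j m :: "int ^ 'a" assume "\<forall>i. 2 * int M + 1 dvd m $ i"
  then obtain l where "ivec m = (2 * real M + 1) *\<^sub>R ivec l"
    using ivec_multiple by blast
  then have "ivec (j + m) /\<^sub>R (2 * real M + 1) - t = (ivec j /\<^sub>R (2 * real M + 1) - t) + ivec l"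
    by (simp add: ivec_add scaleR_right_distrib)
  then show "f (ivec (j + m) /\<^sub>R (2 * real M + 1) - t) = f (ivec j /\<^sub>R (2 * real M + 1) - t)"
    by (simp only: assms)
qed

definition dft_char :: "nat \<Rightarrow> int ^ 'd \<Rightarrow> int ^ 'd \<Rightarrow> complex" where
  "dft_char M k j = cis (- 2 * pi * (ivec k \<bullet> ivec j) / (2 * real M + 1))"

lemma inner_ivec_Ints: "ivec k \<bullet> ivec j \<in> \<int>"
  by (auto simp: inner_vec_def intro!: Ints_sum Ints_mult)

lemma cis_two_pi_Ints: "x \<in> \<int> \<Longrightarrow> cis (2 * pi * x) = 1"
  by (rule cis_multiple_2pi)

lemma periodic_dft_char: "periodic_vec (2 * int M + 1) (dft_char M k)"
  unfolding periodic_vec_def dft_char_def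
proof (intro allI impI)
  fix j m :: "int ^ 'a" assume "\<forall>i. 2 * int M + 1 dvd m $ i"
  then obtain l where "ivec m = (2 * real M + 1) *\<^sub>R ivec l"
    using ivec_multiple by blast
  then have "- 2 * pi * (ivec k \<bullet> ivec (j + m)) / (2 * real M + 1)
      = - 2 * pi * (ivec k \<bullet> ivec j) / (2 * real M + 1) + 2 * pi * (- (ivec k \<bullet> ivec l))"
    by (simp add: ivec_add inner_add_right field_simps)
  moreover have "cis (2 * pi * (- (ivec k \<bullet> ivec l))) = 1"
    by (intro cis_two_pi_Ints Ints_minus inner_ivec_Ints)
  ultimately show "cis (- 2 * pi * (ivec k \<bullet> ivec (j + m)) / (2 * real M + 1))
      = cis (- 2 * pi * (ivec k \<bullet> ivec j) / (2 * real M + 1))"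
    by (simp only: cis_mult[symmetric]) simp
qed

lemma dft_char_commute: "dft_char M k j = dft_char M j k"
  by (simp add: dft_char_def inner_commute)

lemma dft_char_add: "dft_char M k (j + m) = dft_char M k j * dft_char M k m"
  by (simp add: dft_char_def cis_mult ivec_add inner_add_right add_divide_distrib diff_divide_distrib
      right_diff_distrib distrib_left)

lemma cnj_dft_char_mult: "cnj (dft_char M k j) * dft_char M k j = 1"
  by (simp add: dft_char_def cis_cnj cis_mult)

lemma dft_char_mult_cnj: "dft_char M k j * cnj (dft_char M k j') = dft_char M k (j - j')"
  using dft_char_add[of M k "j - j'" j'] cnj_dft_char_mult[of M k j']
  by (simp add: mult.assoc mult.commute[of "dft_char M k j'"])

lemma dft_char_axis: "dft_char M k (axis i 1) = cis (- 2 * pi * real_of_int (k $ i) / (2 * real M + 1))"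
proof -
  have "ivec (axis i 1 :: int ^ 'a) = axis i 1"
    by (auto simp: vec_eq_iff axis_def)
  then show ?thesis
    by (simp add: dft_char_def inner_axis)
qed

text \<open>A unit shift in a direction with m_i nonzero multiplies the sum by a root of unity. It
  differs from 1, since |m_i| <= 2 M is below the modulus 2 M + 1. The range 2 M is the one taken by
  differences of two box points.\<close>

lemma dft_orthogonality:
  fixes m :: "int ^ 'd"
  assumes "m \<in> int_box (2 * M)"
  shows "(\<Sum>k\<in>int_box M. dft_char M k m) = (if m = 0 then (2 * of_nat M + 1) ^ CARD('d) else 0)"
proof (cases "m = 0")
  case True
  then have "ivec m = 0" by (simp add: vec_eq_iff)
  then show ?thesis
    using True by (simp add: dft_char_def card_int_box add.commute)
next
  case False
  then obtain i where i: "m $ i \<noteq> 0"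
    by (auto simp: vec_eq_iff)
  let ?S = "\<Sum>k\<in>int_box M. dft_char M k m"
  let ?w = "dft_char M m (axis i 1)"
  have "?S = (\<Sum>k\<in>int_box M. dft_char M m k)"
    by (simp only: dft_char_commute)
  also have "\<dots> = (\<Sum>k\<in>int_box M. dft_char M m (k + axis i 1))"
    by (rule sum_int_box_shift[symmetric, OF periodic_dft_char])
  also have "\<dots> = (\<Sum>k\<in>int_box M. dft_char M m k) * ?w"
    by (simp only: dft_char_add sum_distrib_right)
  also have "(\<Sum>k\<in>int_box M. dft_char M m k) = ?S"
    by (simp only: dft_char_commute)
  finally have "?S * (1 - ?w) = 0"
    by (simp add: algebra_simps)
  moreover have "?w \<noteq> 1"
  proof
    assume "?w = 1"
    then have "cos (- 2 * pi * real_of_int (m $ i) / (2 * real M + 1)) = 1"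
      unfolding dft_char_axis by (simp add: complex_eq_iff)
    then obtain n where "- 2 * pi * real_of_int (m $ i) / (2 * real M + 1) = of_int n * 2 * pi"
      unfolding cos_one_2pi_int by blast
    then have "2 * pi * - real_of_int (m $ i) = 2 * pi * (of_int n * (2 * real M + 1))"
      by (simp add: field_simps)
    then have "- real_of_int (m $ i) = of_int n * (2 * real M + 1)"
      by (subst (asm) mult_cancel_left) simp
    then have "real_of_int (- (m $ i)) = of_int (n * (2 * int M + 1))"
      by simp
    then have eq: "- (m $ i) = n * (2 * int M + 1)"
      by (simp only: of_int_eq_iff)
    then have "2 * int M + 1 dvd m $ i"
      by (metis dvd_minus_iff dvd_triv_right)
    moreover have "\<bar>m $ i\<bar> \<le> int (2 * M)"
      using assms by (simp add: int_box_def)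
    ultimately show False
      using i zdvd_not_zless[of "\<bar>m $ i\<bar>" "2 * int M + 1"] by simp
  qed
  ultimately show ?thesis
    using False by simp
qed

definition dft :: "nat \<Rightarrow> (int ^ 'd \<Rightarrow> complex) \<Rightarrow> int ^ 'd \<Rightarrow> complex" where
  "dft M f k = (\<Sum>j\<in>int_box M. f j * dft_char M k j)"

lemma dft_plancherel:
  fixes f :: "int ^ 'd \<Rightarrow> complex"
  shows "(\<Sum>k\<in>int_box M. (cmod (dft M f k))\<^sup>2)
    = (2 * real M + 1) ^ CARD('d) * (\<Sum>j\<in>int_box M. (cmod (f j))\<^sup>2)"
proof -
  let ?B = "int_box M :: (int ^ 'd) set"
  have "complex_of_real (\<Sum>k\<in>?B. (cmod (dft M f k))\<^sup>2) = (\<Sum>k\<in>?B. dft M f k * cnj (dft M f k))"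
    by (simp only: of_real_sum complex_norm_square)
  also have "\<dots> = (\<Sum>k\<in>?B. \<Sum>j\<in>?B. \<Sum>j'\<in>?B. f j * cnj (f j') * dft_char M k (j - j'))"
  proof (rule sum.cong[OF refl])
    fix k
    show "dft M f k * cnj (dft M f k)
        = (\<Sum>j\<in>?B. \<Sum>j'\<in>?B. f j * cnj (f j') * dft_char M k (j - j'))"
      unfolding dft_def cnj_sum sum_product
      by (intro sum.cong refl) (simp add: mult_ac flip: dft_char_mult_cnj)
  qed
  also have "\<dots> = (\<Sum>j\<in>?B. \<Sum>j'\<in>?B. f j * cnj (f j') * (\<Sum>k\<in>?B. dft_char M k (j - j')))"
    unfolding sum_distrib_left
    by (rule trans[OF sum.swap]) (intro sum.cong refl sum.swap)
  also have "\<dots> = (\<Sum>j\<in>?B. \<Sum>j'\<in>?B. f j * cnj (f j') * (if j' = j then (2 * of_nat M + 1) ^ CARD('d) else 0))"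
  proof (intro sum.cong refl)
    fix j j' :: "int ^ 'd" assume j: "j \<in> ?B" "j' \<in> ?B"
    have "\<bar>j $ i - j' $ i\<bar> \<le> int (2 * M)" for i
    proof -
      have "\<bar>j $ i\<bar> \<le> int M" "\<bar>j' $ i\<bar> \<le> int M"
        using j by (auto simp: int_box_def)
      then show ?thesis by linarith
    qed
    then have "j - j' \<in> int_box (2 * M)"
      by (simp add: int_box_def)
    from dft_orthogonality[OF this]
    show "f j * cnj (f j') * (\<Sum>k\<in>?B. dft_char M k (j - j'))
        = f j * cnj (f j') * (if j' = j then (2 * of_nat M + 1) ^ CARD('d) else 0)"
      by auto
  qed
  also have "\<dots> = (\<Sum>j\<in>?B. f j * cnj (f j) * (2 * of_nat M + 1) ^ CARD('d))"
    by (intro sum.cong refl) (simp add: if_distrib[of "\<lambda>x. _ * x"] cong: if_cong)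
  also have "\<dots> = complex_of_real ((2 * real M + 1) ^ CARD('d) * (\<Sum>j\<in>?B. (cmod (f j))\<^sup>2))"
    by (simp add: sum_distrib_left sum_distrib_right mult.commute flip: complex_norm_square)
  finally show ?thesis
    by (simp only: of_real_eq_iff)
qed

lemma dft_shift:
  assumes "periodic_vec (2 * int M + 1) f"
  shows "dft M (\<lambda>j. f (j + v)) k = cnj (dft_char M k v) * dft M f k"
proof -
  have per: "periodic_vec (2 * int M + 1) (\<lambda>j. f j * dft_char M k j)"
    using assms periodic_dft_char[of M k] unfolding periodic_vec_def by metis
  have "dft M f k = (\<Sum>j\<in>int_box M. f (j + v) * dft_char M k (j + v))"
    unfolding dft_def by (rule sum_int_box_shift[OF per, symmetric])
  also have "\<dots> = dft_char M k v * dft M (\<lambda>j. f (j + v)) k"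
    unfolding dft_def sum_distrib_left dft_char_add by (intro sum.cong refl) (simp only: mult_ac)
  finally have "cnj (dft_char M k v) * dft M f k
      = cnj (dft_char M k v) * (dft_char M k v * dft M (\<lambda>j. f (j + v)) k)"
    by simp
  also have "\<dots> = (cnj (dft_char M k v) * dft_char M k v) * dft M (\<lambda>j. f (j + v)) k"
    by (simp only: mult.assoc)
  finally show ?thesis
    by (simp add: cnj_dft_char_mult)
qed

section \<open>Discrete gradients and frequency bounds\<close>

lemma cmod_cis_double_minus_one: "(cmod (cis (2 * x) - 1))\<^sup>2 = 4 * (sin x)\<^sup>2"
proof -
  have "(cmod (cis (2 * x) - 1))\<^sup>2 = (cos (2 * x) - 1)\<^sup>2 + (sin (2 * x))\<^sup>2"
    by (simp add: cmod_power2)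
  also have "\<dots> = 2 - 2 * cos (2 * x)"
    using sin_cos_squared_add[of "2 * x"] by (simp add: power2_eq_square algebra_simps)
  finally show ?thesis
    by (simp add: cos_double_sin)
qed

text \<open>The Fourier symbol of minus the discrete Laplacian of mesh 1 / (2 M + 1). For fixed k it
  tends to 4 pi^2 |k|^2.\<close>

definition grid_symbol :: "nat \<Rightarrow> int ^ 'd \<Rightarrow> real" where
  "grid_symbol M k = (\<Sum>i\<in>UNIV. 4 * (2 * real M + 1)\<^sup>2 * (sin (pi * of_int (k $ i) / (2 * real M + 1)))\<^sup>2)"

lemma dft_gradient:
  fixes f :: "int ^ 'd \<Rightarrow> complex"
  assumes "periodic_vec (2 * int M + 1) f"
  shows "(2 * real M + 1) ^ CARD('d) *
      (\<Sum>i\<in>UNIV. \<Sum>j\<in>int_box M. (2 * real M + 1)\<^sup>2 * (cmod (f (j + axis i 1) - f j))\<^sup>2)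
    = (\<Sum>k\<in>int_box M. grid_symbol M k * (cmod (dft M f k))\<^sup>2)"
proof -
  let ?N = "2 * real M + 1"
  have "?N ^ CARD('d) * (\<Sum>j\<in>int_box M. ?N\<^sup>2 * (cmod (f (j + axis i 1) - f j))\<^sup>2)
    = (\<Sum>k\<in>int_box M. 4 * ?N\<^sup>2 * (sin (pi * of_int (k $ i) / ?N))\<^sup>2 * (cmod (dft M f k))\<^sup>2)" for i
  proof -
    have "dft M (\<lambda>j. f (j + axis i 1) - f j) k
        = (cis (2 * (pi * real_of_int (k $ i) / ?N)) - 1) * dft M f k" for k
    proof -
      have "dft M (\<lambda>j. f (j + axis i 1) - f j) k = dft M (\<lambda>j. f (j + axis i 1)) k - dft M f k"
        by (simp add: dft_def left_diff_distrib sum_subtractf)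
      then show ?thesis
        unfolding dft_shift[OF assms] dft_char_axis by (simp add: cis_cnj left_diff_distrib mult.assoc)
    qed
    then have "(cmod (dft M (\<lambda>j. f (j + axis i 1) - f j) k))\<^sup>2
        = 4 * (sin (pi * of_int (k $ i) / ?N))\<^sup>2 * (cmod (dft M f k))\<^sup>2" for k
      by (simp only: norm_mult power_mult_distrib cmod_cis_double_minus_one)
    then have "?N ^ CARD('d) * (\<Sum>j\<in>int_box M. (cmod (f (j + axis i 1) - f j))\<^sup>2)
        = (\<Sum>k\<in>int_box M. 4 * (sin (pi * of_int (k $ i) / ?N))\<^sup>2 * (cmod (dft M f k))\<^sup>2)"
      unfolding dft_plancherel[symmetric] by simp
    then have "?N\<^sup>2 * (?N ^ CARD('d) * (\<Sum>j\<in>int_box M. (cmod (f (j + axis i 1) - f j))\<^sup>2))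
        = ?N\<^sup>2 * (\<Sum>k\<in>int_box M. 4 * (sin (pi * of_int (k $ i) / ?N))\<^sup>2 * (cmod (dft M f k))\<^sup>2)"
      by simp
    then show ?thesis
      by (simp only: sum_distrib_left mult_ac)
  qed
  then have "(\<Sum>i\<in>UNIV. ?N ^ CARD('d) * (\<Sum>j\<in>int_box M. ?N\<^sup>2 * (cmod (f (j + axis i 1) - f j))\<^sup>2))
    = (\<Sum>i\<in>UNIV. \<Sum>k\<in>int_box M. 4 * ?N\<^sup>2 * (sin (pi * of_int (k $ i) / ?N))\<^sup>2 * (cmod (dft M f k))\<^sup>2)"
    by simp
  also have "\<dots> = (\<Sum>k\<in>int_box M. grid_symbol M k * (cmod (dft M f k))\<^sup>2)"
    unfolding grid_symbol_def sum_distrib_right by (rule sum.swap)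
  finally show ?thesis
    by (simp add: sum_distrib_left)
qed

lemma grid_symbol_nonneg: "grid_symbol M k \<ge> 0"
  unfolding grid_symbol_def by (intro sum_nonneg) auto

text \<open>On the Fourier side the left-hand side is a sum of squared coefficients with weights A
  minus the symbol. These weights are not positive off K and at most A on K.\<close>

lemma dft_bandlimit_inequality:
  fixes f :: "int ^ 'd \<Rightarrow> complex"
  assumes per: "periodic_vec (2 * int M + 1) f" and "A \<ge> 0"
    and K: "\<And>k. k \<in> int_box M \<Longrightarrow> k \<notin> K \<Longrightarrow> grid_symbol M k \<ge> A" and "finite K"
  shows "A * (\<Sum>j\<in>int_box M. (cmod (f j))\<^sup>2)
      - (\<Sum>i\<in>UNIV. \<Sum>j\<in>int_box M. (2 * real M + 1)\<^sup>2 * (cmod (f (j + axis i 1) - f j))\<^sup>2)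
    \<le> A * (\<Sum>k\<in>K. (cmod (dft M f k))\<^sup>2) / (2 * real M + 1) ^ CARD('d)"
proof -
  let ?N = "(2 * real M + 1) ^ CARD('d)"
  have "?N * (A * (\<Sum>j\<in>int_box M. (cmod (f j))\<^sup>2)
      - (\<Sum>i\<in>UNIV. \<Sum>j\<in>int_box M. (2 * real M + 1)\<^sup>2 * (cmod (f (j + axis i 1) - f j))\<^sup>2))
    = A * (\<Sum>k\<in>int_box M. (cmod (dft M f k))\<^sup>2) - (\<Sum>k\<in>int_box M. grid_symbol M k * (cmod (dft M f k))\<^sup>2)"
    unfolding dft_plancherel dft_gradient[OF per, symmetric] by (simp add: algebra_simps)
  also have "\<dots> = (\<Sum>k\<in>int_box M. (A - grid_symbol M k) * (cmod (dft M f k))\<^sup>2)"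
    by (simp add: left_diff_distrib sum_subtractf sum_distrib_left)
  also have "\<dots> \<le> (\<Sum>k\<in>int_box M. if k \<in> K then A * (cmod (dft M f k))\<^sup>2 else 0)"
    using K grid_symbol_nonneg
    by (intro sum_mono) (auto intro!: mult_right_mono mult_nonpos_nonneg)
  also have "\<dots> = (\<Sum>k\<in>int_box M \<inter> K. A * (cmod (dft M f k))\<^sup>2)"
    by (simp add: sum.inter_restrict)
  also have "\<dots> \<le> (\<Sum>k\<in>K. A * (cmod (dft M f k))\<^sup>2)"
    using \<open>finite K\<close> \<open>A \<ge> 0\<close> by (intro sum_mono2) auto
  also have "\<dots> = A * (\<Sum>k\<in>K. (cmod (dft M f k))\<^sup>2)"
    by (simp add: sum_distrib_left)
  finally show ?thesis
    by (subst pos_le_divide_eq) (auto simp: mult.commute)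
qed

text \<open>
  Coordinates with \<open>\<bar>k\<^sub>i\<bar> \<le> x\<^sub>0 N / \<pi>\<close> contribute at least \<open>\<theta> (2 \<pi> k\<^sub>i)\<^sup>2\<close> to the symbol, and a
  single larger coordinate already contributes a multiple of \<open>N\<^sup>2\<close>.
\<close>

lemma grid_symbol_lower_bound:
  assumes "0 < \<theta>" "\<theta> < 1" "n > 0"
  shows "eventually (\<lambda>M. \<forall>k \<in> int_box M :: (int ^ 'd) set. norm (ivec k) > n \<longrightarrow>
    grid_symbol M k \<ge> 4 * pi\<^sup>2 * n\<^sup>2 * \<theta>) sequentially"
proof -
  \<comment> \<open>The discrete symbol lies below the continuous one. For arguments small enough
    the deficit is absorbed by \<theta> < 1.\<close>
  have "((\<lambda>x::real. sin x / x) \<longlongrightarrow> 1) (at 0)"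
    using DERIV_sin[of 0] by (simp add: has_field_derivative_iff)
  moreover have "sqrt \<theta> < 1" using assms by simp
  ultimately have "eventually (\<lambda>x::real. sin x / x > sqrt \<theta>) (at 0)"
    by (rule order_tendstoD)
  then obtain x0 where x0: "x0 > 0" "\<And>x. x \<noteq> 0 \<Longrightarrow> \<bar>x\<bar> < x0 \<Longrightarrow> sin x / x > sqrt \<theta>"
    unfolding eventually_at by (auto simp: dist_real_def)
  have small: "(sin x)\<^sup>2 \<ge> \<theta> * x\<^sup>2" if "\<bar>x\<bar> < x0" for x
  proof (cases "x = 0")
    case False
    then have "(sin x / x)\<^sup>2 \<ge> (sqrt \<theta>)\<^sup>2"
      using x0(2)[OF False that] assms by (intro power_mono) auto
    then show ?thesis
      using False assms by (simp add: field_simps power_divide)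
  qed simp
  define x1 where "x1 = min x0 (pi / 2)"
  have x1: "0 < x1" "x1 \<le> pi / 2" "x1 \<le> x0"
    using x0 by (auto simp: x1_def)
  have large: "(sin x)\<^sup>2 \<ge> (sin x1)\<^sup>2" if "\<bar>x\<bar> \<ge> x1" "\<bar>x\<bar> \<le> pi / 2" for x
  proof -
    have "sin x1 \<le> sin \<bar>x\<bar>"
      using that x1 by (intro sin_monotone_2pi_le) auto
    moreover have "sin x1 \<ge> 0"
      using x1 by (intro sin_ge_zero) auto
    ultimately have "(sin x1)\<^sup>2 \<le> (sin \<bar>x\<bar>)\<^sup>2"
      by (intro power_mono) auto
    then show ?thesis
      by (cases "x \<ge> 0") auto
  qed
  have s1: "sin x1 > 0"
    using x1 by (intro sin_gt_zero) (auto intro: le_less_trans[OF x1(2)])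
  \<comment> \<open>From M0 on, (2 M + 1) sin x1 >= pi n, so a single coordinate with argument
    beyond x1 gives at least 4 pi^2 n^2.\<close>
  obtain M0 :: nat where M0: "real M0 \<ge> pi * n / sin x1"
    using real_arch_simple by blast
  show ?thesis
  proof (rule eventually_sequentiallyI[of M0], intro ballI impI)
    fix M and k :: "int ^ 'd"
    assume M: "M0 \<le> M" and k: "k \<in> int_box M" and norm_k: "norm (ivec k) > n"
    let ?N = "2 * real M + 1"
    let ?x = "\<lambda>i. pi * of_int (k $ i) / ?N"
    have term_nonneg: "4 * ?N\<^sup>2 * (sin (?x i))\<^sup>2 \<ge> 0" for i
      by simp
    show "grid_symbol M k \<ge> 4 * pi\<^sup>2 * n\<^sup>2 * \<theta>"
    proof (cases "\<forall>i. \<bar>?x i\<bar> < x1")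
      case True
      have "4 * pi\<^sup>2 * n\<^sup>2 * \<theta> \<le> 4 * pi\<^sup>2 * (norm (ivec k))\<^sup>2 * \<theta>"
        using norm_k assms by (intro mult_right_mono mult_left_mono power_mono) auto
      also have "(norm (ivec k))\<^sup>2 = (\<Sum>i\<in>UNIV. (of_int (k $ i))\<^sup>2)"
        by (simp add: norm_vec_def L2_set_def sum_nonneg)
      also have "4 * pi\<^sup>2 * \<dots> * \<theta> = (\<Sum>i\<in>UNIV. 4 * ?N\<^sup>2 * (\<theta> * (?x i)\<^sup>2))"
        unfolding sum_distrib_left sum_distrib_right
        by (intro sum.cong refl) (simp add: power_divide power_mult_distrib)
      also have "\<dots> \<le> (\<Sum>i\<in>UNIV. 4 * ?N\<^sup>2 * (sin (?x i))\<^sup>2)"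
        using True x1 by (intro sum_mono mult_left_mono small) (auto intro: less_le_trans)
      finally show ?thesis
        by (simp add: grid_symbol_def)
    next
      case False
      then obtain i where i: "\<bar>?x i\<bar> \<ge> x1"
        by (auto simp: not_less)
      \<comment> \<open>Membership in the box keeps the argument of the sine within pi / 2, up to
        which it is increasing.\<close>
      have "\<bar>k $ i\<bar> \<le> int M"
        using k by (simp add: int_box_def)
      then have "\<bar>real_of_int (k $ i)\<bar> \<le> real M"
        by linarith
      then have "\<bar>real_of_int (k $ i)\<bar> * 2 \<le> ?N" by simp
      then have "pi * (\<bar>real_of_int (k $ i)\<bar> * 2) \<le> pi * ?N"
        by (intro mult_left_mono) auto
      then have "\<bar>?x i\<bar> \<le> pi / 2"
        by (simp add: abs_mult divide_simps algebra_simps)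
      have "4 * pi\<^sup>2 * n\<^sup>2 * \<theta> \<le> 4 * (pi * n)\<^sup>2"
        using assms by (simp add: power_mult_distrib mult_le_cancel_left1)
      also have "\<dots> \<le> 4 * (?N * sin x1)\<^sup>2"
      proof -
        have "pi * n / sin x1 \<le> ?N"
          using M0 M by simp
        then have "pi * n \<le> ?N * sin x1"
          using s1 by (simp add: pos_divide_le_eq)
        then show ?thesis
          using assms by (intro mult_left_mono power_mono) auto
      qed
      also have "\<dots> \<le> 4 * ?N\<^sup>2 * (sin (?x i))\<^sup>2"
        using large[OF i \<open>\<bar>?x i\<bar> \<le> pi / 2\<close>] by (simp add: power_mult_distrib mult_left_mono)
      also have "\<dots> \<le> grid_symbol M k"
        unfolding grid_symbol_def by (rule member_le_sum) auto
      finally show ?thesis .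
    qed
  qed
qed

section \<open>Grid means of periodic functions\<close>

abbreviation grid_size :: "nat \<Rightarrow> real" where
  "grid_size M \<equiv> 2 * real M + 1"

lemma inverse_grid_size_tendsto: "(\<lambda>M. inverse (grid_size M)) \<longlonglongrightarrow> 0"
proof (rule Lim_null_comparison[OF always_eventually LIMSEQ_inverse_real_of_nat], rule allI)
  show "norm (inverse (grid_size M)) \<le> inverse (real (Suc M))" for M
    by (simp add: le_imp_inverse_le)
qed

text \<open>Half-open, so that the cells are disjoint and the cell of a point is found by rounding;
  see \<open>in_grid_cell_iff\<close>.\<close>

definition grid_cell :: "nat \<Rightarrow> int ^ 'd \<Rightarrow> (real ^ 'd) set" where
  "grid_cell M j = {x. \<forall>i. (of_int (j $ i) - 1/2) / grid_size M \<le> x $ i \<and>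
     x $ i < (of_int (j $ i) + 1/2) / grid_size M}"

definition nearest :: "real ^ 'd \<Rightarrow> int ^ 'd" where
  "nearest x = (\<chi> i. \<lfloor>x $ i + 1/2\<rfloor>)"

lemma nearest_bounds: "- 1/2 \<le> (x - ivec (nearest x)) $ i" "(x - ivec (nearest x)) $ i < 1/2"
  using of_int_floor_le[of "x $ i + 1/2"] floor_correct[of "x $ i + 1/2"]
  by (simp_all add: nearest_def) linarith+

lemma nearest_add_ivec: "nearest (x + ivec l) = nearest x + l"
proof -
  have "\<lfloor>x $ i + of_int (l $ i) + 1/2\<rfloor> = \<lfloor>x $ i + 1/2\<rfloor> + l $ i" for i
  proof -
    have "x $ i + of_int (l $ i) + 1/2 = (x $ i + 1/2) + of_int (l $ i)"
      by simp
    then show ?thesis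
      by (simp only: floor_add_int)
  qed
  then show ?thesis
    by (simp add: nearest_def vec_eq_iff)
qed

lemma in_grid_cell_iff: "x \<in> grid_cell M j \<longleftrightarrow> j = nearest (grid_size M *\<^sub>R x)"
proof -
  have "(of_int a - 1/2) / grid_size M \<le> y \<and> y < (of_int a + 1/2) / grid_size M
      \<longleftrightarrow> a = \<lfloor>grid_size M * y + 1/2\<rfloor>" for a y
  proof -
    have "(of_int a - 1/2) / grid_size M \<le> y \<and> y < (of_int a + 1/2) / grid_size M
      \<longleftrightarrow> of_int a \<le> grid_size M * y + 1/2 \<and> grid_size M * y + 1/2 < of_int a + 1"
      by (subst pos_divide_le_eq pos_less_divide_eq, simp)+ (auto simp: algebra_simps)
    then show ?thesis
      by (simp only: floor_eq_iff eq_commute[of a])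
  qed
  then show ?thesis
    by (simp add: grid_cell_def nearest_def vec_eq_iff)
qed

lemma grid_cell_measurable [measurable]: "grid_cell M j \<in> sets borel"
proof -
  have "grid_cell M j = (\<Inter>i\<in>UNIV. {x. (of_int (j $ i) - 1/2) / grid_size M \<le> x $ i}
      \<inter> {x. x $ i < (of_int (j $ i) + 1/2) / grid_size M})"
    by (auto simp: grid_cell_def)
  also have "\<dots> \<in> sets borel"
    by (intro sets.finite_INT sets.Int borel_closed borel_open closed_Collect_le open_Collect_less
        continuous_intros) auto
  finally show ?thesis .
qed

lemma emeasure_grid_cell:
  "emeasure lborel (grid_cell M j :: (real ^ 'd) set) = ennreal (inverse (grid_size M) ^ CARD('d))"
proof -
  define a b :: "real ^ 'd" where "a = (\<chi> i. (of_int (j $ i) - 1/2) / grid_size M)"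
    and "b = (\<chi> i. (of_int (j $ i) + 1/2) / grid_size M)"
  have le: "a $ i \<le> b $ i" for i
    by (simp add: a_def b_def divide_right_mono)
  have ab: "b $ i - a $ i = inverse (grid_size M)" for i
    by (simp add: a_def b_def diff_divide_distrib[symmetric] inverse_eq_divide)
  have ne: "cbox a b \<noteq> {}"
    using le by (simp add: interval_ne_empty_cart not_less)
  have content: "measure lborel (cbox a b) = inverse (grid_size M) ^ CARD('d)"
    unfolding content_cbox_cart[OF ne] ab by simp
  have "emeasure lborel (cbox a b) = ennreal (inverse (grid_size M) ^ CARD('d))"
    unfolding content[symmetric] using emeasure_lborel_cbox_finite[of a b]
    by (intro emeasure_eq_ennreal_measure) auto
  moreover have "emeasure lborel (box a b) = emeasure lborel (cbox a b)"
    by (simp add: emeasure_lborel_box_eq emeasure_lborel_cbox_eq)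
  moreover have "emeasure lborel (box a b) \<le> emeasure lborel (grid_cell M j)"
    by (intro emeasure_mono) (auto simp: mem_box_cart grid_cell_def a_def b_def less_imp_le)
  moreover have "emeasure lborel (grid_cell M j) \<le> emeasure lborel (cbox a b)"
    by (intro emeasure_mono) (auto simp: mem_box_cart grid_cell_def a_def b_def less_imp_le)
  ultimately show ?thesis
    by (metis antisym)
qed

definition grid_mean :: "nat \<Rightarrow> (int ^ 'd \<Rightarrow> 'b) \<Rightarrow> 'b::real_normed_vector" where
  "grid_mean M f = (\<Sum>j\<in>int_box M. f j) /\<^sub>R grid_size M ^ CARD('d)"

text \<open>
  The means are integrals of step functions on cells centred at the grid points; since the grid has
  an odd number of points per direction, these cells tile the unit cube.
\<close>

lemma grid_mean_tendsto_integral: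
  fixes f :: "nat \<Rightarrow> real ^ 'd \<Rightarrow> 'b::euclidean_space"
  assumes bound: "eventually (\<lambda>M. \<forall>x. norm (f M x) \<le> B) sequentially"
    and conv: "AE y in lborel. (\<forall>i. \<bar>y $ i\<bar> \<le> 1/2) \<longrightarrow>
      (\<forall>z. z \<longlonglongrightarrow> y \<longrightarrow> (\<lambda>M. f M (z M)) \<longlonglongrightarrow> g y)"
    and outside: "\<And>y. \<not> (\<forall>i. \<bar>y $ i\<bar> < 1/2) \<Longrightarrow> g y = 0"
    and meas: "g \<in> borel_measurable borel"
  shows "(\<lambda>M. grid_mean M (\<lambda>j. f M (ivec j /\<^sub>R grid_size M))) \<longlonglongrightarrow> (LINT x|lborel. g x)"
proof -
  define s where "s M x = (\<Sum>j\<in>int_box M. indicator (grid_cell M j) x *\<^sub>R f M (ivec j /\<^sub>R grid_size M))"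
    for M and x :: "real ^ 'd"
  define z where "z M x = ivec (nearest (grid_size M *\<^sub>R x)) /\<^sub>R grid_size M" for M and x :: "real ^ 'd"
  define Q where "Q = cbox (\<chi> i. - 1/2) ((\<chi> i. 1/2) :: real ^ 'd)"
  have fin: "emeasure lborel (grid_cell M j :: (real ^ 'd) set) < \<infinity>" for M j
    by (simp add: emeasure_grid_cell)
  have int_s: "(LINT x|lborel. s M x) = grid_mean M (\<lambda>j. f M (ivec j /\<^sub>R grid_size M))" for M
  proof -
    have "(LINT x|lborel. s M x) = (\<Sum>j\<in>int_box M. LINT x|lborel.
        indicator (grid_cell M j) x *\<^sub>R f M (ivec j /\<^sub>R grid_size M))"
      unfolding s_def using fin by (intro Bochner_Integration.integral_sum integrable_indicator) auto
    also have "\<dots> = (\<Sum>j\<in>int_box M. (inverse (grid_size M) ^ CARD('d)) *\<^sub>R f M (ivec j /\<^sub>R grid_size M))"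
      using fin by (intro sum.cong refl) (simp add: measure_def emeasure_grid_cell)
    finally show ?thesis
      by (simp add: grid_mean_def scaleR_sum_right power_inverse)
  qed
  have s_eq: "s M x = (if nearest (grid_size M *\<^sub>R x) \<in> int_box M then f M (z M x) else 0)" for M x
  proof -
    have "s M x = (\<Sum>j\<in>int_box M. if j = nearest (grid_size M *\<^sub>R x) then f M (z M x) else 0)"
      unfolding s_def by (intro sum.cong refl) (auto simp: in_grid_cell_iff z_def)
    then show ?thesis by simp
  qed
  have in_cube: "x $ i \<ge> - 1/2" "x $ i < 1/2" if "nearest (grid_size M *\<^sub>R x) \<in> int_box M" for M x i
  proof -
    let ?j = "\<lfloor>grid_size M * x $ i + 1/2\<rfloor>"
    have "\<bar>?j\<bar> \<le> int M"
      using that by (simp add: int_box_def nearest_def)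
    then have "real_of_int ?j \<le> real M" "real_of_int ?j \<ge> - real M"
      by linarith+
    then have "grid_size M * x $ i < real M + 1/2" "grid_size M * x $ i \<ge> - real M - 1/2"
      using floor_correct[of "grid_size M * x $ i + 1/2"] by linarith+
    then have "grid_size M * x $ i < grid_size M * (1/2)" "grid_size M * (- 1/2) \<le> grid_size M * x $ i"
      by (simp_all add: algebra_simps)
    then show "x $ i \<ge> - 1/2" "x $ i < 1/2"
      by (simp_all only: mult_less_cancel_left_pos mult_le_cancel_left_pos)
  qed
  have cube_in: "nearest (grid_size M *\<^sub>R x) \<in> int_box M" if "\<And>i. \<bar>x $ i\<bar> < 1/2" for M x
  proof -
    have "\<bar>\<lfloor>grid_size M * x $ i + 1/2\<rfloor>\<bar> \<le> int M" for i
    proof -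
      have "\<bar>grid_size M * x $ i\<bar> < grid_size M * (1/2)"
        using that[of i] by (simp add: abs_mult)
      then have "- real M - 1/2 < grid_size M * x $ i" "grid_size M * x $ i < real M + 1/2"
        by (simp_all add: abs_less_iff algebra_simps)
      then show ?thesis
        using floor_correct[of "grid_size M * x $ i + 1/2"] by linarith
    qed
    then show ?thesis
      by (simp add: int_box_def nearest_def)
  qed
  \<comment> \<open>z M x is the grid point obtained by rounding x. It depends on M, which is why
    \<open>conv\<close> admits arbitrary sequences tending to y.\<close>
  have z_lim: "(\<lambda>M. z M x) \<longlonglongrightarrow> x" for x
  proof (rule vec_tendstoI)
    fix i
    have "\<bar>z M x $ i - x $ i\<bar> \<le> inverse (grid_size M)" for M
    proof -
      have "\<bar>of_int \<lfloor>grid_size M * x $ i + 1/2\<rfloor> - grid_size M * x $ i\<bar> \<le> 1"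
        using floor_correct[of "grid_size M * x $ i + 1/2"] by linarith
      moreover have "z M x $ i - x $ i
          = (of_int \<lfloor>grid_size M * x $ i + 1/2\<rfloor> - grid_size M * x $ i) * inverse (grid_size M)"
        by (simp add: z_def nearest_def left_diff_distrib)
      ultimately show ?thesis
        by (simp add: abs_mult mult_left_le_one_le)
    qed
    then have "(\<lambda>M. z M x $ i - x $ i) \<longlonglongrightarrow> 0"
      by (intro Lim_null_comparison[OF _ inverse_grid_size_tendsto] always_eventually) simp
    then show "(\<lambda>M. z M x $ i) \<longlonglongrightarrow> x $ i"
      by (rule LIM_zero_cancel)
  qed
  \<comment> \<open>The bound holds only from M0 on, so dominated convergence is applied to the
    shifted sequence; \<open>LIMSEQ_offset\<close> undoes the shift.\<close>
  obtain M0 where M0: "\<And>M x. M \<ge> M0 \<Longrightarrow> norm (f M x) \<le> B"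
    using bound by (auto simp: eventually_sequentially)
  have "(\<lambda>M. LINT x|lborel. s (M + M0) x) \<longlonglongrightarrow> (LINT x|lborel. g x)"
  proof (rule integral_dominated_convergence[where w = "\<lambda>x. \<bar>B\<bar> * indicator Q x"])
    show "g \<in> borel_measurable lborel"
      using meas by simp
    show "s (M + M0) \<in> borel_measurable lborel" for M
      unfolding s_def by (intro borel_measurable_sum borel_measurable_scaleR borel_measurable_indicator) auto
    show "integrable lborel (\<lambda>x. \<bar>B\<bar> * indicator Q x)"
      by (intro integrable_mult_right integrable_real_indicator) (auto simp: Q_def emeasure_lborel_cbox_finite[simplified])
    show "AE x in lborel. norm (s (M + M0) x) \<le> \<bar>B\<bar> * indicator Q x" for M
    proof (rule AE_I2)
      fix x
      show "norm (s (M + M0) x) \<le> \<bar>B\<bar> * indicator Q x"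
      proof (cases "nearest (grid_size (M + M0) *\<^sub>R x) \<in> int_box (M + M0)")
        case True
        then have "x \<in> Q"
          using in_cube[OF True] by (auto simp: Q_def mem_box_cart less_imp_le)
        moreover have "norm (s (M + M0) x) \<le> B"
          unfolding s_eq using True M0[of "M + M0"] by simp
        ultimately show ?thesis by simp
      qed (simp only: s_eq if_False norm_zero; simp)
    qed
    show "AE x in lborel. (\<lambda>M. s (M + M0) x) \<longlonglongrightarrow> g x"
      using conv
    proof eventually_elim
      case (elim x)
      have "(\<lambda>M. s M x) \<longlonglongrightarrow> g x"
      proof (cases "\<forall>i. \<bar>x $ i\<bar> \<le> 1/2")
        case False
        then obtain i where i: "\<bar>x $ i\<bar> > 1/2" by (auto simp: not_le)
        then have "s M x = 0" for M
          using in_cube[of M x i] by (auto simp: s_eq abs_if split: if_splits)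
        moreover have "g x = 0"
          using i by (intro outside) (auto simp: not_less intro!: exI[of _ i])
        ultimately show ?thesis by simp
      next
        case True
        then have f: "(\<lambda>M. f M (z M x)) \<longlonglongrightarrow> g x"
          using elim z_lim by blast
        show ?thesis
        proof (cases "\<forall>i. \<bar>x $ i\<bar> < 1/2")
          case True
          then have "nearest (grid_size M *\<^sub>R x) \<in> int_box M" for M
            by (intro cube_in) blast
          then show ?thesis
            using f by (simp add: s_eq)
        next
          \<comment> \<open>On a face of the cube the rounded point may fall outside the box, and s
            is then 0. This agrees with the limit, since g is 0 there.\<close>
          case False
          then have "g x = 0" by (rule outside)
          then have lim: "(\<lambda>M. norm (f M (z M x))) \<longlonglongrightarrow> 0"
            using f by (simp add: tendsto_norm_zero_iff)
          have "norm (s M x) \<le> norm (f M (z M x))" for M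
            by (simp add: s_eq)
          then have "(\<lambda>M. s M x) \<longlonglongrightarrow> 0"
            by (intro Lim_null_comparison[OF always_eventually lim] allI)
          then show ?thesis
            unfolding \<open>g x = 0\<close> .
        qed
      qed
      then show ?case
        by (rule LIMSEQ_ignore_initial_segment)
    qed
  qed
  then show ?thesis
    unfolding int_s by (rule LIMSEQ_offset)
qed

text \<open>A node t need not be a grid point. Reindexing a full period by the rounded position of t
  leaves a displacement of at most one mesh width per coordinate. It tends to 0 and is harmless
  because \<open>conv\<close> covers every sequence tending to y.\<close>

lemma periodic_grid_mean_tendsto_integral:
  fixes f :: "nat \<Rightarrow> real ^ 'd \<Rightarrow> 'b::euclidean_space"
  assumes per: "\<And>M x l. f M (x + ivec l) = f M x"
    and bound: "eventually (\<lambda>M. \<forall>x. norm (f M x) \<le> B) sequentially"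
    and conv: "AE y in lborel. (\<forall>i. \<bar>y $ i\<bar> \<le> 1/2) \<longrightarrow>
      (\<forall>z. z \<longlonglongrightarrow> y \<longrightarrow> (\<lambda>M. f M (z M)) \<longlonglongrightarrow> g y)"
    and outside: "\<And>y. \<not> (\<forall>i. \<bar>y $ i\<bar> < 1/2) \<Longrightarrow> g y = 0"
    and meas: "g \<in> borel_measurable borel"
  shows "(\<lambda>M. grid_mean M (\<lambda>j. f M (ivec j /\<^sub>R grid_size M - t))) \<longlonglongrightarrow> (LINT x|lborel. g x)"
proof -
  define v where "v M = nearest (grid_size M *\<^sub>R t)" for M
  define \<delta> where "\<delta> M = ivec (v M) /\<^sub>R grid_size M - t" for M
  have \<delta>: "\<delta> \<longlonglongrightarrow> 0"
  proof (rule vec_tendstoI)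
    fix i
    have "\<bar>\<delta> M $ i\<bar> \<le> inverse (grid_size M)" for M
    proof -
      have "\<bar>of_int \<lfloor>grid_size M * t $ i + 1/2\<rfloor> - grid_size M * t $ i\<bar> \<le> 1"
        using floor_correct[of "grid_size M * t $ i + 1/2"] by linarith
      moreover have "\<delta> M $ i
          = (of_int \<lfloor>grid_size M * t $ i + 1/2\<rfloor> - grid_size M * t $ i) * inverse (grid_size M)"
        by (simp add: \<delta>_def v_def nearest_def left_diff_distrib)
      ultimately show ?thesis
        by (simp add: abs_mult mult_left_le_one_le)
    qed
    then show "(\<lambda>M. \<delta> M $ i) \<longlonglongrightarrow> 0 $ i"
      unfolding zero_index
      by (intro Lim_null_comparison[OF _ inverse_grid_size_tendsto] always_eventually) simp
  qed
  have "grid_mean M (\<lambda>j. f M (ivec j /\<^sub>R grid_size M - t))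
      = grid_mean M (\<lambda>j. f M (ivec j /\<^sub>R grid_size M + \<delta> M))" for M
  proof -
    have "periodic_vec (2 * int M + 1) (\<lambda>j. f M (ivec j /\<^sub>R grid_size M - t))"
      by (intro periodic_vec_grid per)
    from sum_int_box_shift[OF this, of "v M"]
    show ?thesis
      by (simp add: grid_mean_def \<delta>_def ivec_add scaleR_right_distrib algebra_simps)
  qed
  moreover have "(\<lambda>M. grid_mean M (\<lambda>j. f M (ivec j /\<^sub>R grid_size M + \<delta> M))) \<longlonglongrightarrow> (LINT x|lborel. g x)"
  proof (rule grid_mean_tendsto_integral[where f = "\<lambda>M x. f M (x + \<delta> M)", OF _ _ outside meas])
    show "eventually (\<lambda>M. \<forall>x. norm (f M (x + \<delta> M)) \<le> B) sequentially"
      using bound by eventually_elim auto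
    show "AE y in lborel. (\<forall>i. \<bar>y $ i\<bar> \<le> 1/2) \<longrightarrow>
      (\<forall>z. z \<longlonglongrightarrow> y \<longrightarrow> (\<lambda>M. f M (z M + \<delta> M)) \<longlonglongrightarrow> g y)"
      using conv
    proof eventually_elim
      case (elim y)
      show ?case
      proof (intro impI allI)
        fix z assume "\<forall>i. \<bar>y $ i\<bar> \<le> 1/2" "z \<longlonglongrightarrow> y"
        moreover from this have "(\<lambda>M. z M + \<delta> M) \<longlonglongrightarrow> y"
          using tendsto_add[OF _ \<delta>, of z y] by simp
        ultimately show "(\<lambda>M. f M (z M + \<delta> M)) \<longlonglongrightarrow> g y"
          using elim by blast
      qed
    qed
  qed
  ultimately show ?thesis by simp
qed

section \<open>Periodic extension of functions supported in a small ball\<close>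

definition wrap :: "(real ^ 'd \<Rightarrow> 'b) \<Rightarrow> real ^ 'd \<Rightarrow> 'b" where
  "wrap u x = u (x - ivec (nearest x))"

lemma wrap_add_ivec [simp]: "wrap u (x + ivec l) = wrap u x"
  by (simp add: wrap_def nearest_add_ivec ivec_add)

text \<open>Copies of the ball at nonzero lattice points do not reach this region. For \<rho> < 1/2
  it is larger than the unit cube, so sampling points and difference steps may leave the cube
  slightly.\<close>

lemma wrap_ball_cut_eq:
  fixes x :: "real ^ 'd"
  assumes "\<rho> \<le> 1/2" and x: "\<And>i. \<bar>x $ i\<bar> \<le> 1 - \<rho>"
  shows "wrap (ball_cut \<rho> f) x = ball_cut \<rho> f x"
proof (cases "nearest x = 0")
  case True
  then have "ivec (nearest x) = 0" by (simp add: vec_eq_iff)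
  then show ?thesis by (simp add: wrap_def)
next
  case False
  then obtain i where i: "nearest x $ i \<noteq> 0"
    by (auto simp: vec_eq_iff)
  let ?x' = "x - ivec (nearest x)"
  have n1: "\<bar>real_of_int (nearest x $ i)\<bar> \<ge> 1"
    using i by linarith
  have "\<bar>?x' $ i\<bar> \<ge> \<rho>"
    using n1 x[of i] by simp
  then have "norm ?x' \<ge> \<rho>"
    using component_le_norm_cart[of ?x' i] by linarith
  moreover have "\<bar>x $ i\<bar> \<ge> 1/2"
    using n1 nearest_bounds[of x i] by simp
  then have "norm x \<ge> \<rho>"
    using component_le_norm_cart[of x i] assms(1) by linarith
  ultimately show ?thesis
    by (simp add: wrap_def ball_cut_def)
qed

lemma wrap_ball_cut_nonzero:
  "wrap (ball_cut \<rho> f) x \<noteq> 0 \<Longrightarrow> \<exists>l. norm (x - ivec l) < \<rho>"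
  by (auto simp: wrap_def ball_cut_def split: if_splits)

lemma norm_wrap_bound: "(\<And>x. norm (u x) \<le> B) \<Longrightarrow> norm (wrap u x) \<le> B"
  by (simp add: wrap_def)

lemma ball_cut_outside_cube: "\<rho> \<le> 1/2 \<Longrightarrow> \<not> (\<forall>i. \<bar>y $ i\<bar> < 1/2) \<Longrightarrow> ball_cut \<rho> f y = 0"
  for y :: "real ^ 'd"
proof -
  assume "\<rho> \<le> 1/2" "\<not> (\<forall>i. \<bar>y $ i\<bar> < 1/2)"
  then obtain i where "\<bar>y $ i\<bar> \<ge> 1/2" "1/2 \<ge> \<rho>"
    by (auto simp: not_less)
  then show ?thesis
    using component_le_norm_cart[of y i] by (intro ball_cut_outside) linarith
qed

lemma eventually_cube_interior:
  fixes y :: "real ^ 'd"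
  assumes "\<rho> < 1/2" "z \<longlonglongrightarrow> y" "\<forall>i. \<bar>y $ i\<bar> \<le> 1/2"
  shows "eventually (\<lambda>M. \<forall>i. \<bar>z M $ i\<bar> \<le> 1 - \<rho>) sequentially"
proof (rule eventually_all_finite)
  fix i
  have "(\<lambda>M. \<bar>z M $ i\<bar>) \<longlonglongrightarrow> \<bar>y $ i\<bar>"
    using assms(2) by (intro tendsto_intros)
  moreover have "\<bar>y $ i\<bar> < 1 - \<rho>"
    using assms(1) spec[OF assms(3), of i] by linarith
  ultimately have "eventually (\<lambda>M. \<bar>z M $ i\<bar> < 1 - \<rho>) sequentially"
    by (rule order_tendstoD)
  then show "eventually (\<lambda>M. \<bar>z M $ i\<bar> \<le> 1 - \<rho>) sequentially"
    by eventually_elim simp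
qed

lemma wrap_ball_cut_tendsto:
  fixes f :: "real ^ 'd \<Rightarrow> 'b::real_normed_vector"
  assumes "continuous_on UNIV f" "\<rho> < 1/2" "\<forall>i. \<bar>y $ i\<bar> \<le> 1/2" "norm y \<noteq> \<rho>" "z \<longlonglongrightarrow> y"
  shows "(\<lambda>M. wrap (ball_cut \<rho> f) (z M)) \<longlonglongrightarrow> ball_cut \<rho> f y"
proof -
  have "isCont f y"
    using assms(1) by (simp add: continuous_on_eq_continuous_at)
  then have f: "(\<lambda>M. f (z M)) \<longlonglongrightarrow> f y"
    using assms(5) by (rule isCont_tendsto_compose)
  have "(\<lambda>M. ball_cut \<rho> f (z M)) \<longlonglongrightarrow> ball_cut \<rho> f y"
  proof (cases "norm y < \<rho>")
    case True
    have "eventually (\<lambda>M. norm (z M) < \<rho>) sequentially"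
      using tendsto_norm[OF assms(5)] True by (rule order_tendstoD)
    then have "eventually (\<lambda>M. f (z M) = ball_cut \<rho> f (z M)) sequentially"
      by eventually_elim (simp add: ball_cut_def)
    then show ?thesis
      using f True by (simp add: ball_cut_def Lim_transform_eventually)
  next
    case False
    then have gt: "norm y > \<rho>" using assms(4) by simp
    have "eventually (\<lambda>M. norm (z M) > \<rho>) sequentially"
      using tendsto_norm[OF assms(5)] gt by (rule order_tendstoD)
    then have "eventually (\<lambda>M. ball_cut \<rho> f (z M) = ball_cut \<rho> f y) sequentially"
      by eventually_elim (use gt in \<open>simp add: ball_cut_def\<close>)
    then show ?thesis by (rule tendsto_eventually)
  qed
  moreover have "eventually (\<lambda>M. ball_cut \<rho> f (z M) = wrap (ball_cut \<rho> f) (z M)) sequentially"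
    using eventually_cube_interior[OF assms(2,5,3)]
    by eventually_elim (use assms(2) in \<open>simp add: wrap_ball_cut_eq\<close>)
  ultimately show ?thesis
    by (rule Lim_transform_eventually)
qed

lemma grid_mean_wrap_square:
  fixes f :: "real ^ 'd \<Rightarrow> complex"
  assumes cont: "continuous_on UNIV f" and "\<rho> < 1/2"
  shows "(\<lambda>M. grid_mean M (\<lambda>j. (cmod (wrap (ball_cut \<rho> f) (ivec j /\<^sub>R grid_size M - t)))\<^sup>2))
    \<longlonglongrightarrow> (LINT x|lborel. (cmod (ball_cut \<rho> f x))\<^sup>2)"
proof -
  obtain B where B: "\<And>x. norm (ball_cut \<rho> f x) \<le> B"
    using bounded_ball_cut[OF cont] by blast
  show ?thesis
  proof (rule periodic_grid_mean_tendsto_integral[where B = "B\<^sup>2"])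
    show "eventually (\<lambda>M. \<forall>x. norm ((cmod (wrap (ball_cut \<rho> f) x))\<^sup>2) \<le> B\<^sup>2) sequentially"
      using B by (intro always_eventually allI) (simp add: norm_wrap_bound power_mono)
    show "AE y in lborel. (\<forall>i. \<bar>y $ i\<bar> \<le> 1/2) \<longrightarrow> (\<forall>z. z \<longlonglongrightarrow> y \<longrightarrow>
        (\<lambda>M. (cmod (wrap (ball_cut \<rho> f) (z M)))\<^sup>2) \<longlonglongrightarrow> (cmod (ball_cut \<rho> f y))\<^sup>2)"
      using AE_norm_neq[of \<rho>]
      by eventually_elim (use assms in \<open>auto intro!: tendsto_intros wrap_ball_cut_tendsto\<close>)
    have "ball_cut \<rho> f \<in> borel_measurable borel"
      by (rule borel_measurable_ball_cut[OF cont])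
    then show "(\<lambda>x. (cmod (ball_cut \<rho> f x))\<^sup>2) \<in> borel_measurable borel"
      by measurable
  qed (use \<open>\<rho> < 1/2\<close> in \<open>auto simp: ball_cut_outside_cube\<close>)
qed

text \<open>The character at the grid point splits into its value at the node t and its value at the
  difference. The latter factor is periodic because k is integral, and the former comes out of the
  mean.\<close>

lemma grid_mean_wrap_fourier:
  fixes f :: "real ^ 'd \<Rightarrow> complex"
  assumes cont: "continuous_on UNIV f" and "\<rho> < 1/2"
  shows "(\<lambda>M. grid_mean M (\<lambda>j. wrap (ball_cut \<rho> f) (ivec j /\<^sub>R grid_size M - t) * dft_char M k j))
    \<longlonglongrightarrow> cis (- 2 * pi * (ivec k \<bullet> t)) * (LINT x|lborel. ball_cut \<rho> f x * cis (- 2 * pi * (ivec k \<bullet> x)))"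
proof -
  let ?e = "\<lambda>x. cis (- 2 * pi * (ivec k \<bullet> x))"
  obtain B where B: "\<And>x. norm (ball_cut \<rho> f x) \<le> B"
    using bounded_ball_cut[OF cont] by blast
  have lim: "(\<lambda>M. grid_mean M (\<lambda>j. wrap (ball_cut \<rho> f) (ivec j /\<^sub>R grid_size M - t) * ?e (ivec j /\<^sub>R grid_size M - t)))
    \<longlonglongrightarrow> (LINT x|lborel. ball_cut \<rho> f x * ?e x)"
  proof (rule periodic_grid_mean_tendsto_integral[where B = B and f = "\<lambda>_ x. wrap (ball_cut \<rho> f) x * ?e x"])
    show "wrap (ball_cut \<rho> f) (x + ivec l) * ?e (x + ivec l) = wrap (ball_cut \<rho> f) x * ?e x" for x l
    proof -
      have "?e (ivec l) = 1"
        using cis_two_pi_Ints[of "- (ivec k \<bullet> ivec l)"] inner_ivec_Ints[of k l] by simp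
      moreover have "?e (x + ivec l) = ?e x * ?e (ivec l)"
        by (simp add: cis_mult inner_add_right algebra_simps)
      ultimately show ?thesis by simp
    qed
    show "eventually (\<lambda>M. \<forall>x. norm (wrap (ball_cut \<rho> f) x * ?e x) \<le> B) sequentially"
      using B by (intro always_eventually allI) (simp add: norm_wrap_bound norm_mult)
    show "AE y in lborel. (\<forall>i. \<bar>y $ i\<bar> \<le> 1/2) \<longrightarrow> (\<forall>z. z \<longlonglongrightarrow> y \<longrightarrow>
        (\<lambda>M. wrap (ball_cut \<rho> f) (z M) * ?e (z M)) \<longlonglongrightarrow> ball_cut \<rho> f y * ?e y)"
      using AE_norm_neq[of \<rho>]
    proof eventually_elim
      case (elim y)
      have "continuous_on UNIV ?e"
        by (intro continuous_intros)
      then have "isCont ?e y"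
        by (simp add: continuous_on_eq_continuous_at)
      then show ?case
        using elim assms by (auto intro!: tendsto_mult wrap_ball_cut_tendsto elim: isCont_tendsto_compose)
    qed
    have "ball_cut \<rho> f \<in> borel_measurable borel"
      by (rule borel_measurable_ball_cut[OF cont])
    moreover have "?e \<in> borel_measurable borel"
      by (intro borel_measurable_continuous_onI continuous_intros)
    ultimately show "(\<lambda>x. ball_cut \<rho> f x * ?e x) \<in> borel_measurable borel"
      by (rule borel_measurable_times)
  qed (use \<open>\<rho> < 1/2\<close> in \<open>auto simp: ball_cut_outside_cube\<close>)
  have "grid_mean M (\<lambda>j. wrap (ball_cut \<rho> f) (ivec j /\<^sub>R grid_size M - t) * dft_char M k j)
      = ?e t * grid_mean M (\<lambda>j. wrap (ball_cut \<rho> f) (ivec j /\<^sub>R grid_size M - t) * ?e (ivec j /\<^sub>R grid_size M - t))" for M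
  proof -
    have "dft_char M k j = ?e t * ?e (ivec j /\<^sub>R grid_size M - t)" for j
      by (simp add: dft_char_def cis_mult inner_diff_right divide_inverse algebra_simps)
    then show ?thesis
      unfolding grid_mean_def by (simp add: sum_distrib_left mult_ac)
  qed
  then show ?thesis
    using tendsto_mult_left[OF lim, of "?e t"] by simp
qed

text \<open>The Lipschitz estimate for the extension by zero bounds the difference quotients
  uniformly. It applies once the mesh is below 1/2 - \<rho>: a step starting in the unit cube then
  ends where \<open>wrap\<close> is the plain cut-off function.\<close>

lemma grid_mean_wrap_gradient:
  fixes f :: "real ^ 'd \<Rightarrow> complex"
  assumes f: "has_partial i f f'" and cont: "continuous_on UNIV f" "continuous_on UNIV f'"
    and zero: "\<And>x. norm x = \<rho> \<Longrightarrow> f x = 0" and \<rho>: "\<rho> < 1/2"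
  shows "(\<lambda>M. grid_mean M (\<lambda>j. (grid_size M)\<^sup>2 *
      (cmod (wrap (ball_cut \<rho> f) (ivec (j + axis i 1) /\<^sub>R grid_size M - t)
        - wrap (ball_cut \<rho> f) (ivec j /\<^sub>R grid_size M - t)))\<^sup>2))
    \<longlonglongrightarrow> (LINT x|lborel. (cmod (ball_cut \<rho> f' x))\<^sup>2)"
proof -
  define h where "h M = inverse (grid_size M)" for M
  have h: "h \<longlonglongrightarrow> 0" "\<And>M. h M > 0" "\<And>M. grid_size M = inverse (h M)"
    using inverse_grid_size_tendsto by (auto simp: h_def[abs_def])
  define e :: "real ^ 'd" where "e = axis i 1"
  let ?w = "wrap (ball_cut \<rho> f)"
  let ?q = "\<lambda>M x. (cmod ((?w (x + h M *\<^sub>R e) - ?w x) /\<^sub>R h M))\<^sup>2"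
  obtain K where K: "K \<ge> 0"
    "\<And>x h. h \<ge> 0 \<Longrightarrow> norm (ball_cut \<rho> f (x + h *\<^sub>R e) - ball_cut \<rho> f x) \<le> K * h"
    using ball_cut_lipschitz[OF f cont(2) zero] unfolding e_def by blast
  have axis_bound: "\<bar>(x + s *\<^sub>R e) $ m\<bar> \<le> \<bar>x $ m\<bar> + s" if "s \<ge> 0" for x :: "real ^ 'd" and s m
    using that abs_triangle_ineq[of "x $ m" s] by (cases "m = i") (simp_all add: e_def axis_def)
  have "(\<lambda>M. grid_mean M (\<lambda>j. ?q M (ivec j /\<^sub>R grid_size M - t))) \<longlonglongrightarrow> (LINT x|lborel. (cmod (ball_cut \<rho> f' x))\<^sup>2)"
  proof (rule periodic_grid_mean_tendsto_integral[where B = "K\<^sup>2"])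
    show "?q M (x + ivec l) = ?q M x" for M l and x :: "real ^ 'd"
    proof -
      have "x + ivec l + h M *\<^sub>R e = (x + h M *\<^sub>R e) + ivec l"
        by simp
      then show ?thesis
        by (simp only: wrap_add_ivec)
    qed
    have "eventually (\<lambda>M. h M < 1/2 - \<rho>) sequentially"
      using h(1) \<rho> by (intro order_tendstoD) auto
    then show "eventually (\<lambda>M. \<forall>x. norm (?q M x) \<le> K\<^sup>2) sequentially"
    proof eventually_elim
      case (elim M)
      show ?case
      proof
        fix x :: "real ^ 'd"
        define x' where "x' = x - ivec (nearest x)"
        have x': "\<bar>x' $ m\<bar> \<le> 1/2" for m
          using nearest_bounds[of x m] unfolding x'_def by linarith
        have "?w x = ball_cut \<rho> f x'"
          by (simp add: wrap_def x'_def)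
        moreover have "?w (x + h M *\<^sub>R e) = ?w (x' + h M *\<^sub>R e)"
        proof -
          have "x + h M *\<^sub>R e = (x' + h M *\<^sub>R e) + ivec (nearest x)"
            by (simp add: x'_def)
          then show ?thesis
            by (simp only: wrap_add_ivec)
        qed
        moreover have "?w (x' + h M *\<^sub>R e) = ball_cut \<rho> f (x' + h M *\<^sub>R e)"
        proof (rule wrap_ball_cut_eq)
          show "\<bar>(x' + h M *\<^sub>R e) $ m\<bar> \<le> 1 - \<rho>" for m
            using axis_bound[of "h M" x' m] x'[of m] h(2)[of M] elim by linarith
        qed (use \<rho> in simp)
        ultimately have "cmod (?w (x + h M *\<^sub>R e) - ?w x) \<le> K * h M"
          using K(2)[of "h M" x'] h(2)[of M] by simp
        then have "cmod ((?w (x + h M *\<^sub>R e) - ?w x) /\<^sub>R h M) \<le> K"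
          using h(2)[of M] by (simp add: pos_divide_le_eq divide_inverse_commute[symmetric])
        then show "norm (?q M x) \<le> K\<^sup>2"
          by (simp add: power_mono)
      qed
    qed
    show "AE y in lborel. (\<forall>i. \<bar>y $ i\<bar> \<le> 1/2) \<longrightarrow> (\<forall>z. z \<longlonglongrightarrow> y \<longrightarrow>
        (\<lambda>M. ?q M (z M)) \<longlonglongrightarrow> (cmod (ball_cut \<rho> f' y))\<^sup>2)"
      using AE_norm_neq[of \<rho>]
    proof eventually_elim
      case (elim y)
      show ?case
      proof (intro impI allI)
        fix z assume y: "\<forall>i. \<bar>y $ i\<bar> \<le> 1/2" and z: "z \<longlonglongrightarrow> y"
        have "(\<lambda>M. (ball_cut \<rho> f (z M + h M *\<^sub>R e) - ball_cut \<rho> f (z M)) /\<^sub>R h M) \<longlonglongrightarrow> ball_cut \<rho> f' y"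
          unfolding e_def by (rule ball_cut_difference_quotient[OF f cont(2) elim z h(1,2)])
        then have lim: "(\<lambda>M. (cmod ((ball_cut \<rho> f (z M + h M *\<^sub>R e) - ball_cut \<rho> f (z M)) /\<^sub>R h M))\<^sup>2)
            \<longlonglongrightarrow> (cmod (ball_cut \<rho> f' y))\<^sup>2"
          by (intro tendsto_intros)
        have "(\<lambda>M. z M + h M *\<^sub>R e) \<longlonglongrightarrow> y + 0 *\<^sub>R e"
          by (intro tendsto_intros z h(1))
        then have "eventually (\<lambda>M. \<forall>i. \<bar>(z M + h M *\<^sub>R e) $ i\<bar> \<le> 1 - \<rho>) sequentially"
          using \<rho> y by (intro eventually_cube_interior[where y = y]) auto
        moreover have "eventually (\<lambda>M. \<forall>i. \<bar>z M $ i\<bar> \<le> 1 - \<rho>) sequentially"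
          using \<rho> y z by (intro eventually_cube_interior)
        ultimately have "eventually (\<lambda>M. (cmod ((ball_cut \<rho> f (z M + h M *\<^sub>R e) - ball_cut \<rho> f (z M)) /\<^sub>R h M))\<^sup>2
            = ?q M (z M)) sequentially"
        proof eventually_elim
          case (elim M)
          have "?w (z M + h M *\<^sub>R e) = ball_cut \<rho> f (z M + h M *\<^sub>R e)"
            using elim(1) \<rho> by (intro wrap_ball_cut_eq) auto
          moreover have "?w (z M) = ball_cut \<rho> f (z M)"
            using elim(2) \<rho> by (intro wrap_ball_cut_eq) auto
          ultimately show ?case by simp
        qed
        then show "(\<lambda>M. ?q M (z M)) \<longlonglongrightarrow> (cmod (ball_cut \<rho> f' y))\<^sup>2"
          by (rule Lim_transform_eventually[OF lim])
      qed
    qed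
    have "ball_cut \<rho> f' \<in> borel_measurable borel"
      by (rule borel_measurable_ball_cut[OF cont(2)])
    then show "(\<lambda>x. (cmod (ball_cut \<rho> f' x))\<^sup>2) \<in> borel_measurable borel"
      by measurable
  qed (use \<rho> in \<open>auto simp: ball_cut_outside_cube\<close>)
  moreover have "?q M (ivec j /\<^sub>R grid_size M - t) = (grid_size M)\<^sup>2 *
      (cmod (?w (ivec (j + axis i 1) /\<^sub>R grid_size M - t) - ?w (ivec j /\<^sub>R grid_size M - t)))\<^sup>2" for M j
  proof -
    have "ivec (axis i 1 :: int ^ 'd) = e"
      by (auto simp: vec_eq_iff axis_def e_def)
    then have eq: "ivec j /\<^sub>R grid_size M - t + h M *\<^sub>R e = ivec (j + axis i 1) /\<^sub>R grid_size M - t"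
      by (simp add: ivec_add h_def scaleR_right_distrib)
    show ?thesis
      unfolding eq using h(2)[of M] by (simp add: h_def power_mult_distrib power_inverse)
  qed
  ultimately show ?thesis by simp
qed

section \<open>Block Vandermonde matrices\<close>

text \<open>Two sampling points are allowed since a discrete derivative compares neighbouring grid
  points; the gap between the supports has to absorb the mesh. Some lattice translate of t - t' is
  shorter than the separation, hence 0, and the representatives coincide.\<close>

lemma nodes_disjoint:
  assumes "torus_representatives Y" "finite Y" "t \<in> Y" "t' \<in> Y"
    and "wrap (ball_cut \<rho> f) (p - t) \<noteq> 0" "wrap (ball_cut \<rho> f') (p' - t') \<noteq> 0"
    and "norm (p - p') \<le> sep Y - 2 * \<rho>"
  shows "t = t'"
proof -
  obtain l l' where l: "norm (p - t - ivec l) < \<rho>" "norm (p' - t' - ivec l') < \<rho>"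
    using wrap_ball_cut_nonzero[OF assms(5)] wrap_ball_cut_nonzero[OF assms(6)] by blast
  have "norm (t - t' + ivec (l - l')) \<le> norm (p - t - ivec l) + norm (p' - t' - ivec l') + norm (p - p')"
    unfolding ivec_diff by norm
  also have "\<dots> < sep Y"
    using l assms(7) by linarith
  finally have less: "norm (t - t' + ivec (l - l')) < sep Y" .
  have "t - t' + ivec (l - l') = 0"
  proof (rule ccontr)
    assume "t - t' + ivec (l - l') \<noteq> 0"
    moreover have "ivec (l - l') \<in> int_lattice"
      by (simp add: int_lattice_eq_range_ivec)
    ultimately have "norm (t - t' + ivec (l - l')) \<in> sep_norms Y"
      unfolding sep_norms_def using assms(3,4) by blast
    then show False
      using sep_attained(2)[of Y] assms(2,3) less by fastforce
  qed
  then have "t - t' = ivec (l' - l)"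
    by (simp add: ivec_diff algebra_simps)
  then have "t - t' \<in> int_lattice"
    by (simp add: int_lattice_eq_range_ivec)
  then show ?thesis
    using assms unfolding torus_representatives_def by blast
qed

lemma cmod_sum_disjoint:
  fixes w :: "'a \<Rightarrow> complex"
  assumes "finite Y" "\<And>t t'. t \<in> Y \<Longrightarrow> t' \<in> Y \<Longrightarrow> w t \<noteq> 0 \<Longrightarrow> w t' \<noteq> 0 \<Longrightarrow> t = t'"
  shows "(cmod (\<Sum>t\<in>Y. w t))\<^sup>2 = (\<Sum>t\<in>Y. (cmod (w t))\<^sup>2)"
proof (cases "\<exists>t\<in>Y. w t \<noteq> 0")
  case True
  then obtain t0 where t0: "t0 \<in> Y" "w t0 \<noteq> 0" by blast
  then have zero: "w t = 0" if "t \<in> Y - {t0}" for t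
    using assms(2)[of t t0] that by blast
  show ?thesis
    using t0 zero by (simp add: sum.remove[OF assms(1) t0(1)])
qed simp

text \<open>The limit of \<open>dft_bandlimit_inequality\<close> for samples of the periodic sum.
  Disjointness turns |F|^2 and the squared differences into sums over the nodes, so that each term
  is a grid mean with a known limit; \<theta> is the loss from the grid symbol.\<close>

lemma bandlimit_inequality:
  fixes Y :: "(real ^ 'd) set" and f :: "real ^ 'd \<Rightarrow> real ^ 'd \<Rightarrow> complex"
  assumes Y: "torus_representatives Y" "finite Y" and \<rho>: "2 * \<rho> < sep Y" "\<rho> < 1/2"
    and f: "\<And>t i. has_partial i (f t) (f' t i)" "\<And>t. continuous_on UNIV (f t)"
      "\<And>t i. continuous_on UNIV (f' t i)" "\<And>t x. norm x = \<rho> \<Longrightarrow> f t x = 0"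
    and \<theta>: "0 < \<theta>" "\<theta> < 1" and n: "n > 0" and A: "A = 4 * pi\<^sup>2 * n\<^sup>2 * \<theta>"
  shows "A * (\<Sum>t\<in>Y. ball_int \<rho> (\<lambda>x. (cmod (f t x))\<^sup>2))
      - (\<Sum>i\<in>UNIV. \<Sum>t\<in>Y. ball_int \<rho> (\<lambda>x. (cmod (f' t i x))\<^sup>2))
    \<le> A * (\<Sum>k | norm (ivec k) \<le> n. (cmod (\<Sum>t\<in>Y. cis (- 2 * pi * (ivec k \<bullet> t))
        * ball_int \<rho> (\<lambda>x. f t x * cis (- 2 * pi * (ivec k \<bullet> x)))))\<^sup>2)"
proof -
  define K where "K = {k :: int ^ 'd. norm (ivec k) \<le> n}"
  define w where "w t = wrap (ball_cut \<rho> (f t))" for t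
  define F where "F M j = (\<Sum>t\<in>Y. w t (ivec j /\<^sub>R grid_size M - t))" for M j
  have A0: "A \<ge> 0"
    using \<theta> by (simp add: A)
  have "finite K"
  proof -
    have "ivec ` K \<subseteq> freqs n"
      by (auto simp: K_def freqs_def int_lattice_eq_range_ivec)
    then show ?thesis
      using finite_freqs finite_subset finite_imageD inj_ivec inj_on_subset by (metis subset_UNIV)
  qed
  have per: "periodic_vec (2 * int M + 1) (F M)" for M
    unfolding F_def w_def by (intro periodic_vec_sum periodic_vec_grid wrap_add_ivec)
  have square: "(cmod (F M j))\<^sup>2 = (\<Sum>t\<in>Y. (cmod (w t (ivec j /\<^sub>R grid_size M - t)))\<^sup>2)" for M j
    unfolding F_def
  proof (rule cmod_sum_disjoint[OF Y(2)])
    fix t t' assume "t \<in> Y" "t' \<in> Y"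
      "w t (ivec j /\<^sub>R grid_size M - t) \<noteq> 0" "w t' (ivec j /\<^sub>R grid_size M - t') \<noteq> 0"
    then show "t = t'"
      using \<rho> by (intro nodes_disjoint[OF Y]) (auto simp: w_def)
  qed
  \<comment> \<open>Once the mesh is below the gap between the supports, two neighbouring grid
    points cannot see different nodes.\<close>
  have "eventually (\<lambda>M. inverse (grid_size M) < sep Y - 2 * \<rho>) sequentially"
    using inverse_grid_size_tendsto \<rho> by (intro order_tendstoD) auto
  then have grad: "eventually (\<lambda>M. \<forall>i j. (cmod (F M (j + axis i 1) - F M j))\<^sup>2 = (\<Sum>t\<in>Y.
      (cmod (w t (ivec (j + axis i 1) /\<^sub>R grid_size M - t) - w t (ivec j /\<^sub>R grid_size M - t)))\<^sup>2)) sequentially"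
  proof eventually_elim
    case (elim M)
    show ?case
    proof (intro allI)
      fix i :: 'd and j :: "int ^ 'd"
      let ?p = "ivec j /\<^sub>R grid_size M" and ?p' = "ivec (j + axis i 1) /\<^sub>R grid_size M"
      have "ivec (axis i 1 :: int ^ 'd) = axis i 1"
        by (auto simp: vec_eq_iff axis_def)
      then have "?p' - ?p = inverse (grid_size M) *\<^sub>R axis i 1"
        by (simp add: ivec_add scaleR_right_distrib)
      then have near: "norm (?p' - ?p) \<le> sep Y - 2 * \<rho>"
        using elim by simp
      have near': "norm (?p - ?p') \<le> sep Y - 2 * \<rho>" "norm (?p - ?p) \<le> sep Y - 2 * \<rho>"
          "norm (?p' - ?p') \<le> sep Y - 2 * \<rho>"
        using near \<rho> by (simp_all add: norm_minus_commute)
      have "(cmod (\<Sum>t\<in>Y. w t (?p' - t) - w t (?p - t)))\<^sup>2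
          = (\<Sum>t\<in>Y. (cmod (w t (?p' - t) - w t (?p - t)))\<^sup>2)"
      proof (rule cmod_sum_disjoint[OF Y(2)])
        fix t t' assume t: "t \<in> Y" "t' \<in> Y" and "w t (?p' - t) - w t (?p - t) \<noteq> 0"
          "w t' (?p' - t') - w t' (?p - t') \<noteq> 0"
        then have "w t (?p' - t) \<noteq> 0 \<or> w t (?p - t) \<noteq> 0"
          and "w t' (?p' - t') \<noteq> 0 \<or> w t' (?p - t') \<noteq> 0"
          by auto
        then show "t = t'"
          unfolding w_def using nodes_disjoint[OF Y t _ _ near] nodes_disjoint[OF Y t _ _ near'(1)]
            nodes_disjoint[OF Y t _ _ near'(2)] nodes_disjoint[OF Y t _ _ near'(3)] by blast
      qed
      then show "(cmod (F M (j + axis i 1) - F M j))\<^sup>2 = (\<Sum>t\<in>Y. (cmod (w t (?p' - t) - w t (?p - t)))\<^sup>2)"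
        by (simp add: F_def sum_subtractf)
    qed
  qed
  define L where "L M = A * (\<Sum>t\<in>Y. grid_mean M (\<lambda>j. (cmod (w t (ivec j /\<^sub>R grid_size M - t)))\<^sup>2))
      - (\<Sum>i\<in>UNIV. \<Sum>t\<in>Y. grid_mean M (\<lambda>j. (grid_size M)\<^sup>2 *
          (cmod (w t (ivec (j + axis i 1) /\<^sub>R grid_size M - t) - w t (ivec j /\<^sub>R grid_size M - t)))\<^sup>2))" for M
  define R where "R M = A * (\<Sum>k\<in>K. (cmod (\<Sum>t\<in>Y. grid_mean M
      (\<lambda>j. w t (ivec j /\<^sub>R grid_size M - t) * dft_char M k j)))\<^sup>2)" for M
  have "eventually (\<lambda>M. L M \<le> R M) sequentially"
    using grad grid_symbol_lower_bound[OF \<theta> n, where 'd = 'd]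
  proof eventually_elim
    case (elim M)
    define N where "N = grid_size M ^ CARD('d)"
    have N: "N > 0"
      by (simp add: N_def)
    have sum_mean: "(\<Sum>t\<in>Y. grid_mean M (g t)) = inverse N * (\<Sum>j\<in>int_box M. \<Sum>t\<in>Y. g t j)"
      for g :: "real ^ 'd \<Rightarrow> int ^ 'd \<Rightarrow> real"
      unfolding grid_mean_def N_def by (subst sum.swap) (simp add: sum_distrib_left)
    have "A * (\<Sum>j\<in>int_box M. (cmod (F M j))\<^sup>2)
      - (\<Sum>i\<in>UNIV. \<Sum>j\<in>int_box M. (grid_size M)\<^sup>2 * (cmod (F M (j + axis i 1) - F M j))\<^sup>2)
      \<le> A * (\<Sum>k\<in>K. (cmod (dft M (F M) k))\<^sup>2) / N"
      unfolding N_def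
    proof (rule dft_bandlimit_inequality[OF per A0 _ \<open>finite K\<close>])
      fix k :: "int ^ 'd" assume "k \<in> int_box M" "k \<notin> K"
      then show "A \<le> grid_symbol M k"
        using elim(2) by (auto simp: K_def A not_le)
    qed
    then have "inverse N * (A * (\<Sum>j\<in>int_box M. (cmod (F M j))\<^sup>2)
      - (\<Sum>i\<in>UNIV. \<Sum>j\<in>int_box M. (grid_size M)\<^sup>2 * (cmod (F M (j + axis i 1) - F M j))\<^sup>2))
      \<le> inverse N * (A * (\<Sum>k\<in>K. (cmod (dft M (F M) k))\<^sup>2) / N)"
      using N by (intro mult_left_mono) auto
    \<comment> \<open>One factor 1 / N comes from averaging over the grid and one from Plancherel;
      together they normalise the squared transform.\<close>
    also have "inverse N * (A * (\<Sum>k\<in>K. (cmod (dft M (F M) k))\<^sup>2) / N) = R M"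
    proof -
      have "(\<Sum>t\<in>Y. grid_mean M (\<lambda>j. w t (ivec j /\<^sub>R grid_size M - t) * dft_char M k j))
          = dft M (F M) k /\<^sub>R N" for k
        unfolding grid_mean_def dft_def F_def sum_distrib_right N_def
        by (subst sum.swap) (simp only: scaleR_sum_right)
      then have "(cmod (\<Sum>t\<in>Y. grid_mean M (\<lambda>j. w t (ivec j /\<^sub>R grid_size M - t) * dft_char M k j)))\<^sup>2
          = inverse N * inverse N * (cmod (dft M (F M) k))\<^sup>2" for k
        using N by (simp add: power_mult_distrib power2_eq_square)
      then show ?thesis
        unfolding R_def by (simp add: divide_inverse mult_ac flip: sum_distrib_left)
    qed
    also have "inverse N * (A * (\<Sum>j\<in>int_box M. (cmod (F M j))\<^sup>2)
      - (\<Sum>i\<in>UNIV. \<Sum>j\<in>int_box M. (grid_size M)\<^sup>2 * (cmod (F M (j + axis i 1) - F M j))\<^sup>2)) = L M"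
      unfolding L_def sum_mean square using elim(1)
      by (simp add: right_diff_distrib mult_ac flip: sum_distrib_left)
    finally show ?case .
  qed
  moreover have "R \<longlonglongrightarrow> A * (\<Sum>k\<in>K. (cmod (\<Sum>t\<in>Y. cis (- 2 * pi * (ivec k \<bullet> t))
        * (LINT x|lborel. ball_cut \<rho> (f t) x * cis (- 2 * pi * (ivec k \<bullet> x)))))\<^sup>2)"
    unfolding R_def w_def using f \<rho> by (intro tendsto_intros grid_mean_wrap_fourier)
  moreover have "L \<longlonglongrightarrow> A * (\<Sum>t\<in>Y. LINT x|lborel. (cmod (ball_cut \<rho> (f t) x))\<^sup>2)
      - (\<Sum>i\<in>UNIV. \<Sum>t\<in>Y. LINT x|lborel. (cmod (ball_cut \<rho> (f' t i) x))\<^sup>2)"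
    unfolding L_def w_def using f \<rho> by (intro tendsto_intros grid_mean_wrap_square grid_mean_wrap_gradient)
  ultimately have "A * (\<Sum>t\<in>Y. LINT x|lborel. (cmod (ball_cut \<rho> (f t) x))\<^sup>2)
      - (\<Sum>i\<in>UNIV. \<Sum>t\<in>Y. LINT x|lborel. (cmod (ball_cut \<rho> (f' t i) x))\<^sup>2)
    \<le> A * (\<Sum>k\<in>K. (cmod (\<Sum>t\<in>Y. cis (- 2 * pi * (ivec k \<bullet> t))
        * (LINT x|lborel. ball_cut \<rho> (f t) x * cis (- 2 * pi * (ivec k \<bullet> x)))))\<^sup>2)"
    by (intro tendsto_le[OF sequentially_bot])
  moreover have "(LINT x|lborel. (cmod (ball_cut \<rho> g x))\<^sup>2) = ball_int \<rho> (\<lambda>x. (cmod (g x))\<^sup>2)" for g :: "real ^ 'd \<Rightarrow> complex"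
    unfolding ball_int_def by (intro Bochner_Integration.integral_cong) (auto simp: ball_cut_def)
  moreover have "(LINT x|lborel. ball_cut \<rho> g x * h x) = ball_int \<rho> (\<lambda>x. g x * h x)"
    for g h :: "real ^ 'd \<Rightarrow> complex"
    unfolding ball_int_def by (intro Bochner_Integration.integral_cong) (auto simp: ball_cut_def)
  ultimately show ?thesis
    by (simp add: K_def)
qed

section \<open>Matrix entries and the final estimate\<close>

lemma sum_option_times:
  fixes g :: "'d::finite option \<times> 'a \<Rightarrow> 'b::comm_monoid_add"
  shows "(\<Sum>c\<in>UNIV \<times> Y. g c) = (\<Sum>t\<in>Y. g (None, t) + (\<Sum>i\<in>UNIV. g (Some i, t)))"
proof -
  have "(\<Sum>c\<in>UNIV \<times> Y. g c) = (\<Sum>b\<in>UNIV. \<Sum>t\<in>Y. g (b, t))"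
    by (simp add: sum.cartesian_product)
  also have "\<dots> = (\<Sum>t\<in>Y. \<Sum>b\<in>UNIV. g (b, t))"
    by (rule sum.swap)
  also have "\<dots> = (\<Sum>t\<in>Y. g (None, t) + (\<Sum>i\<in>UNIV. g (Some i, t)))"
    by (simp add: UNIV_option_conv sum.reindex)
  finally show ?thesis .
qed

text \<open>The bracket has the shape produced by \<open>cprobe_fourier\<close> at frequency -2 pi
  k, so the transform of g can be factored out of the sum over all nodes.\<close>

lemma mat_vec_block_matrix:
  "mat_vec (UNIV \<times> Y) block_matrix u k = (\<Sum>t\<in>Y. cis (- 2 * pi * (k \<bullet> t)) *
    (u (None, t) + \<i> * (\<Sum>i\<in>UNIV. of_real (((- 2 * pi) *\<^sub>R k) $ i) * u (Some i, t))))"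
proof -
  have e: "exp (- 2 * of_real pi * \<i> * of_real (t \<bullet> k)) = cis (- 2 * pi * (k \<bullet> t))" for t
    by (simp add: cis_conv_exp inner_commute mult_ac)
  show ?thesis
    unfolding mat_vec_def sum_option_times block_matrix_def prod.case option.case
      vandermonde_def confluent_vandermonde_def e
    by (intro sum.cong refl) (simp add: distrib_left right_diff_distrib sum_distrib_left mult_ac sum_negf)
qed

text \<open>The pair t = t' with a unit vector of the lattice. This forces radii below 1/2, so that
  a ball does not meet its own translates.\<close>

lemma sep_le_one:
  fixes Y :: "(real ^ 'd) set"
  assumes "finite Y" "Y \<noteq> {}"
  shows "sep Y \<le> 1"
proof -
  obtain t where t: "t \<in> Y" using assms by blast
  have "axis undefined 1 \<in> (int_lattice :: (real ^ 'd) set)"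
    by (simp add: int_lattice_def axis_def)
  moreover have "t - t + axis undefined 1 \<noteq> 0"
    by (simp add: axis_eq_0_iff)
  moreover have "norm (t - t + axis undefined 1) = 1"
    by simp
  ultimately have "1 \<in> sep_norms Y"
    unfolding sep_norms_def using t by (smt (verit) mem_Collect_eq)
  then show ?thesis
    using sep_attained(2)[OF assms] by blast
qed

theorem proposition2p4:
  fixes \<tau> :: real
  assumes "\<tau> > 0"
  shows "\<exists>c>0. \<forall>n>0. \<forall>Y :: (real ^ 'd) set.
    finite Y \<longrightarrow> Y \<noteq> {} \<longrightarrow> torus_representatives Y \<longrightarrow>
    n * sep Y = sqrt (1 + \<tau>) * (bessel_first_zero (real CARD('d) / 2) / pi) \<longrightarrow>
    (sigma_min (freqs n) (UNIV \<times> Y) block_matrix)\<^sup>2 \<ge> c * n ^ CARD('d)"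
proof -
  define j where "j = bessel_first_zero (real CARD('d) / 2)"
  \<comment> \<open>A zero j of J corresponds to the zero j^2 / 4 of the entire series.\<close>
  define c where "c = j\<^sup>2 / 4"
  have j: "j > 0" and E: "bessel_E (real CARD('d) / 2) c = 0"
    using bessel_first_zero[of "real CARD('d) / 2"] by (simp_all add: j_def c_def)
  have c: "c > 0"
    using j by (simp add: c_def)
  \<comment> \<open>The fourth root of 1 + \<tau>. By hypothesis (2 pi n)^2 = s^4 (2 j / q)^2. The
    radius q / (2 s) uses s^2 of this surplus, the discretisation factor \<theta> = 1 / s uses s,
    and the last s leaves the gap 1 - 1 / s.\<close>
  define s where "s = sqrt (sqrt (1 + \<tau>))"
  have s: "s > 1" and s2: "sqrt (1 + \<tau>) = s\<^sup>2"
    using assms by (simp_all add: s_def)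
  obtain C where C: "C > 0" "\<And>\<rho> \<alpha> \<beta>. \<rho> > 0 \<Longrightarrow>
      ball_int \<rho> (\<lambda>x :: real ^ 'd. (cmod (cprobe c \<rho> \<alpha> \<beta> x))\<^sup>2)
      \<ge> C * \<rho> ^ CARD('d) * ((cmod \<alpha>)\<^sup>2 + (\<Sum>i\<in>UNIV. (cmod (\<beta> i))\<^sup>2) / \<rho>\<^sup>2)"
    using cprobe_lower_bound[OF c E] by blast
  obtain S where S: "S > 0" "\<And>\<rho> k. \<rho> > 0 \<Longrightarrow> cmod (bump_fourier c \<rho> (k :: real ^ 'd)) \<le> S * \<rho> ^ CARD('d)"
    using bump_fourier_bound[of c, where 'd = 'd] by blast
  \<comment> \<open>Norms contribute C \<rho>^d and transforms S^2 \<rho>^(2d). In the quotient,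
    \<rho>^(-d) becomes a power of n through n \<rho> = s j / (2 pi).\<close>
  define C0 where "C0 = (1 - 1 / s) * C / S\<^sup>2 * (2 * pi / (s * j)) ^ CARD('d)"
  have "C0 > 0"
    using s C S j by (simp add: C0_def)
  moreover have "C0 * n ^ CARD('d) \<le> (sigma_min (freqs n) (UNIV \<times> Y) block_matrix)\<^sup>2"
    if n: "n > 0" and Y: "finite Y" "Y \<noteq> {}" "torus_representatives Y"
      and nq: "n * sep Y = sqrt (1 + \<tau>) * (bessel_first_zero (real CARD('d) / 2) / pi)"
    for n and Y :: "(real ^ 'd) set"
  proof -
    define q where "q = sep Y"
    have nq': "n * q = s\<^sup>2 * j / pi"
      using nq by (simp add: q_def s2 j_def)
    moreover have "s\<^sup>2 * j / pi > 0"
      using s j by simp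
    ultimately have q: "q > 0"
      using n by (metis zero_less_mult_pos)
    have q1: "q \<le> 1"
      using sep_le_one[OF Y(1,2)] by (simp add: q_def)
    define \<rho> where "\<rho> = q / (2 * s)"
    have \<rho>: "\<rho> > 0" "2 * \<rho> < q"
      using q s by (simp_all add: \<rho>_def divide_less_eq)
    then have \<rho>': "\<rho> < 1/2"
      using q1 by simp
    obtain u where u: "l2_norm_on (UNIV \<times> Y) u = 1"
      "sigma_min (freqs n) (UNIV \<times> Y) block_matrix = l2_norm_on (freqs n) (mat_vec (UNIV \<times> Y) block_matrix u)"
      using sigma_min_attained[of "UNIV \<times> Y" "freqs n" block_matrix] Y by auto
    define \<alpha> where "\<alpha> t = u (None, t)" for t
    define \<beta> where "\<beta> t i = u (Some i, t)" for t i
    have "(l2_norm_on (UNIV \<times> Y) u)\<^sup>2 = (\<Sum>t\<in>Y. (cmod (\<alpha> t))\<^sup>2 + (\<Sum>i\<in>UNIV. (cmod (\<beta> t i))\<^sup>2))"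
      unfolding l2_norm_on_def L2_set_def \<alpha>_def \<beta>_def
      by (simp add: sum_nonneg sum_option_times)
    then have unit: "(\<Sum>t\<in>Y. (cmod (\<alpha> t))\<^sup>2 + (\<Sum>i\<in>UNIV. (cmod (\<beta> t i))\<^sup>2)) = 1"
      using u(1) by simp
    define P where "P = (\<Sum>k | norm (ivec k) \<le> n. (cmod (mat_vec (UNIV \<times> Y) block_matrix u (ivec k)))\<^sup>2)"
    have sigma: "(sigma_min (freqs n) (UNIV \<times> Y) block_matrix)\<^sup>2 = P"
    proof -
      have "freqs n = ivec ` {k :: int ^ 'd. norm (ivec k) \<le> n}"
        by (auto simp: freqs_def int_lattice_eq_range_ivec)
      moreover have "inj_on ivec {k :: int ^ 'd. norm (ivec k) \<le> n}"
        using inj_ivec inj_on_subset by blast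
      ultimately show ?thesis
        unfolding u(2) l2_norm_on_def L2_set_def P_def by (simp add: sum_nonneg sum.reindex)
    qed
    define I where "I t = ball_int \<rho> (\<lambda>x. (cmod (cprobe c \<rho> (\<alpha> t) (\<beta> t) x))\<^sup>2)" for t
    \<comment> \<open>The squared band limit after discretisation. The eigenvalue j^2 / \<rho>^2 of
      the probes is A / s, smaller by the reserved factor.\<close>
    define A where "A = 4 * pi\<^sup>2 * n\<^sup>2 * (1 / s)"
    have A: "A > 0"
      using n s by (simp add: A_def)
    have A_eq: "4 * (c / \<rho>\<^sup>2) = A / s"
    proof -
      have "pi * n = s\<^sup>2 * j / q"
        using nq' q by (simp add: field_simps)
      then have "A = 4 * (s\<^sup>2 * j / q)\<^sup>2 * (1 / s)"
        by (simp add: A_def flip: power_mult_distrib)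
      then show ?thesis
        using q s by (simp add: c_def \<rho>_def power2_eq_square field_simps)
    qed
    have "(1 - 1 / s) * (C * \<rho> ^ CARD('d)) \<le> (S * \<rho> ^ CARD('d))\<^sup>2 * P"
    proof -
      have "A * (\<Sum>t\<in>Y. I t)
          - (\<Sum>i\<in>UNIV. \<Sum>t\<in>Y. ball_int \<rho> (\<lambda>x. (cmod (cprobe_grad c \<rho> (\<alpha> t) (\<beta> t) i x))\<^sup>2))
        \<le> A * (\<Sum>k | norm (ivec k) \<le> n. (cmod (\<Sum>t\<in>Y. cis (- 2 * pi * (ivec k \<bullet> t))
            * ball_int \<rho> (\<lambda>x. cprobe c \<rho> (\<alpha> t) (\<beta> t) x * cis (- 2 * pi * (ivec k \<bullet> x)))))\<^sup>2)"
        unfolding I_def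
        by (rule bandlimit_inequality[OF Y(3,1) _ \<rho>' has_partial_cprobe continuous_cprobe
              continuous_cprobe_grad cprobe_sphere[OF E _ \<rho>(1)] _ _ n A_def])
          (use \<rho>(2) s in \<open>auto simp: q_def\<close>)
      also have "\<dots> \<le> A * ((S * \<rho> ^ CARD('d))\<^sup>2 * P)"
      proof -
        have "(\<Sum>t\<in>Y. cis (- 2 * pi * (ivec k \<bullet> t))
            * ball_int \<rho> (\<lambda>x. cprobe c \<rho> (\<alpha> t) (\<beta> t) x * cis (- 2 * pi * (ivec k \<bullet> x))))
          = bump_fourier c \<rho> ((- 2 * pi) *\<^sub>R ivec k) * mat_vec (UNIV \<times> Y) block_matrix u (ivec k)" for k
        proof -
          have "ball_int \<rho> (\<lambda>x. cprobe c \<rho> (\<alpha> t) (\<beta> t) x * cis (- 2 * pi * (ivec k \<bullet> x)))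
            = bump_fourier c \<rho> ((- 2 * pi) *\<^sub>R ivec k)
              * (\<alpha> t + \<i> * (\<Sum>i\<in>UNIV. of_real (((- 2 * pi) *\<^sub>R ivec k) $ i) * \<beta> t i))" for t
            using cprobe_fourier[OF \<rho>(1), of c "\<alpha> t" "\<beta> t" "(- 2 * pi) *\<^sub>R ivec k"] by simp
          then show ?thesis
            unfolding mat_vec_block_matrix \<alpha>_def \<beta>_def sum_distrib_left
            by (simp add: mult_ac sum_distrib_left)
        qed
        moreover have "(cmod (bump_fourier c \<rho> ((- 2 * pi) *\<^sub>R ivec k) * mat_vec (UNIV \<times> Y) block_matrix u (ivec k)))\<^sup>2
            \<le> (S * \<rho> ^ CARD('d))\<^sup>2 * (cmod (mat_vec (UNIV \<times> Y) block_matrix u (ivec k)))\<^sup>2" for k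
          unfolding norm_mult power_mult_distrib[of "cmod _"]
          by (intro mult_right_mono power_mono S \<rho>) auto
        ultimately show ?thesis
          unfolding P_def sum_distrib_left[of "(S * \<rho> ^ CARD('d))\<^sup>2"] using A
          by (intro mult_left_mono sum_mono) auto
      qed
      finally have upper: "A * (\<Sum>t\<in>Y. I t)
          - (\<Sum>i\<in>UNIV. \<Sum>t\<in>Y. ball_int \<rho> (\<lambda>x. (cmod (cprobe_grad c \<rho> (\<alpha> t) (\<beta> t) i x))\<^sup>2))
        \<le> A * ((S * \<rho> ^ CARD('d))\<^sup>2 * P)" .
      have "(\<Sum>i\<in>UNIV. \<Sum>t\<in>Y. ball_int \<rho> (\<lambda>x. (cmod (cprobe_grad c \<rho> (\<alpha> t) (\<beta> t) i x))\<^sup>2))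
          \<le> (A / s) * (\<Sum>t\<in>Y. I t)"
        unfolding I_def A_eq[symmetric] sum_distrib_left
        by (subst sum.swap) (intro sum_mono cprobe_rayleigh \<rho> c E)
      with upper have "A * (\<Sum>t\<in>Y. I t) - (A / s) * (\<Sum>t\<in>Y. I t) \<le> A * ((S * \<rho> ^ CARD('d))\<^sup>2 * P)"
        by linarith
      then have "A * ((1 - 1 / s) * (\<Sum>t\<in>Y. I t)) \<le> A * ((S * \<rho> ^ CARD('d))\<^sup>2 * P)"
        by (simp add: left_diff_distrib right_diff_distrib)
      then have "(1 - 1 / s) * (\<Sum>t\<in>Y. I t) \<le> (S * \<rho> ^ CARD('d))\<^sup>2 * P"
        using A by simp
      moreover have "C * \<rho> ^ CARD('d) \<le> (\<Sum>t\<in>Y. I t)"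
      proof -
        have "C * \<rho> ^ CARD('d) * ((cmod (\<alpha> t))\<^sup>2 + (\<Sum>i\<in>UNIV. (cmod (\<beta> t i))\<^sup>2)) \<le> I t" for t
        proof -
          have "\<rho>\<^sup>2 \<le> 1"
            using \<rho> \<rho>' by (intro power_le_one) auto
          then have "(\<Sum>i\<in>UNIV. (cmod (\<beta> t i))\<^sup>2) \<le> (\<Sum>i\<in>UNIV. (cmod (\<beta> t i))\<^sup>2) / \<rho>\<^sup>2"
            using \<rho> by (simp add: pos_le_divide_eq mult_left_le sum_nonneg)
          then have "C * \<rho> ^ CARD('d) * ((cmod (\<alpha> t))\<^sup>2 + (\<Sum>i\<in>UNIV. (cmod (\<beta> t i))\<^sup>2))
              \<le> C * \<rho> ^ CARD('d) * ((cmod (\<alpha> t))\<^sup>2 + (\<Sum>i\<in>UNIV. (cmod (\<beta> t i))\<^sup>2) / \<rho>\<^sup>2)"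
            using C \<rho> by (intro mult_left_mono) auto
          also have "\<dots> \<le> I t"
            unfolding I_def by (rule C(2)[OF \<rho>(1)])
          finally show ?thesis .
        qed
        then have "(\<Sum>t\<in>Y. C * \<rho> ^ CARD('d) * ((cmod (\<alpha> t))\<^sup>2 + (\<Sum>i\<in>UNIV. (cmod (\<beta> t i))\<^sup>2))) \<le> (\<Sum>t\<in>Y. I t)"
          by (intro sum_mono)
        then show ?thesis
          unfolding sum_distrib_left[symmetric] unit by simp
      qed
      then have "(1 - 1 / s) * (C * \<rho> ^ CARD('d)) \<le> (1 - 1 / s) * (\<Sum>t\<in>Y. I t)"
        using s by (intro mult_left_mono) auto
      ultimately show ?thesis by linarith
    qed
    moreover have "(1 - 1 / s) * (C * \<rho> ^ CARD('d)) = (S * \<rho> ^ CARD('d))\<^sup>2 * (C0 * n ^ CARD('d))"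
    proof -
      have "2 * pi / (s * j) * n * \<rho> = 1"
        using nq' q s j by (simp add: \<rho>_def field_simps power2_eq_square)
      then have "(2 * pi / (s * j)) ^ CARD('d) * n ^ CARD('d) * \<rho> ^ CARD('d) = 1"
        by (simp only: power_one flip: power_mult_distrib)
      moreover have "(S * \<rho> ^ CARD('d))\<^sup>2 * (C0 * n ^ CARD('d))
          = (1 - 1 / s) * (C * \<rho> ^ CARD('d)) * ((2 * pi / (s * j)) ^ CARD('d) * n ^ CARD('d) * \<rho> ^ CARD('d))"
        using S by (simp add: C0_def power_mult_distrib power2_eq_square)
      ultimately show ?thesis
        by simp
    qed
    ultimately show ?thesis
      using S \<rho> unfolding sigma by (simp add: mult_le_cancel_left_pos)
  qed
  ultimately show ?thesis
    by blast
qed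

end
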